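(* Let $n\ge 1$ and let $K$ be an $n$-dimensional compact submanifold (with boundary) embedded in $\mathbb{R}^n$, with rectifiable boundary $\Sigma=\partial K$. Let $\mathcal{L}$ be the set of all oriented lines in $\mathbb{R}^n$ and, for $\ell\in\mathcal{L}$, let $\#(\ell\cap\Sigma)$ be the number of intersection points of $\ell$ and $\Sigma$. Then the surface area $\mathcal{V}_{n-1}(\Sigma)$ of $K$ is given by $$\mathcal{V}_{n-1}(\Sigma)=\frac{1}{2\,\omega_{n-1}}\int_{\ell\in\mathcal{L}}\#(\ell\cap\Sigma)\,d\ell .$$
   Context: $\mathcal{V}_{n-1}(\Sigma)$ is the $(n-1)$-dimensional volume (surface area) of $\Sigma$, and $\omega_{n-1}$ is the $(n-1)$-dimensional volume of the unit ball in $\mathbb{R}^{n-1}$. An oriented line $\ell$ is determined by its unit direction vector $v\in\mathbb{S}^{n-1}$ and the point $u$ at which it meets $\ell^\perp$, the linear hyperplane through the origin orthogonal to $\ell$ (that is, $\ell^\perp=v^\perp$ and $\ell=\{u+tv: t\in\mathbb{R}\}$ with $u\in v^\perp$). The invariant measure on $\mathcal{L}$ is $d\ell=dS_v\wedge d\ell^\perp_u$, where $dS_v$ is the area element of $\mathbb{S}^{n-1}$ at $v$ and $d\ell^\perp_u$ is the $(n-1)$-dimensional area element of $\ell^\perp=v^\perp$ at $u$. Thus $$\int_{\ell\in\mathcal{L}} f(\ell)\,d\ell=\int_{v\in\mathbb{S}^{n-1}}\int_{u\in v^\perp} f(u+\mathbb{R}v)\,d\ell^\perp_u\,dS_v .$$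 *)

theory Defs
  imports "HOL-Analysis.Analysis"
begin

section \<open>Hausdorff measure\<close>

text \<open>
  The gauge of a nonempty set is the volume of the \<open>m\<close>-dimensional ball of the same diameter; with
  this normalisation the \<open>m\<close>-dimensional Hausdorff measure is the usual \<open>m\<close>-dimensional volume.
  Since \<open>0 ^ 0 = 1\<close>, it is the counting measure for \<open>m = 0\<close>.
\<close>

definition hausdorff_gauge :: "nat \<Rightarrow> 'a::metric_space set \<Rightarrow> ennreal" where
  "hausdorff_gauge m C =
     (if C = {} then 0 else ennreal (unit_ball_vol (real m) * (diameter C / 2) ^ m))"

definition hausdorff_pre :: "nat \<Rightarrow> real \<Rightarrow> 'a::metric_space set \<Rightarrow> ennreal" where
  "hausdorff_pre m \<delta> A =
     (INF C\<in>{C :: nat \<Rightarrow> 'a set. (\<forall>i. bounded (C i) \<and> diameter (C i) \<le> \<delta>) \<and> A \<subseteq> (\<Union>i. C i)}.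
        \<Sum>i. hausdorff_gauge m (C i))"

definition hausdorff_outer :: "nat \<Rightarrow> 'a::metric_space set \<Rightarrow> ennreal" where
  "hausdorff_outer m A = (SUP \<delta>\<in>{0<..}. hausdorff_pre m \<delta> A)"

definition hausdorff_measure :: "nat \<Rightarrow> 'a::metric_space measure" where
  "hausdorff_measure m = measure_of UNIV (sets borel) (hausdorff_outer m)"

lemma hausdorff_pre_empty: "\<delta> > 0 \<Longrightarrow> hausdorff_pre m \<delta> {} = 0"
proof -
  assume "\<delta> > 0"
  then have "hausdorff_pre m \<delta> ({} :: 'a set) \<le> (\<Sum>i::nat. hausdorff_gauge m ({} :: 'a set))"
    unfolding hausdorff_pre_def by (intro INF_lower2[of "\<lambda>_. {}"]) auto
  then show ?thesis by (simp add: hausdorff_gauge_def)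
qed

lemma hausdorff_pre_mono: "A \<subseteq> B \<Longrightarrow> hausdorff_pre m \<delta> A \<le> hausdorff_pre m \<delta> B"
  unfolding hausdorff_pre_def by (rule INF_superset_mono) auto

lemma hausdorff_pre_antimono: "\<delta> \<le> \<delta>' \<Longrightarrow> hausdorff_pre m \<delta>' A \<le> hausdorff_pre m \<delta> A"
  unfolding hausdorff_pre_def by (rule INF_superset_mono) (auto intro: order_trans)

lemma hausdorff_pre_subadditive:
  fixes A :: "nat \<Rightarrow> 'a::metric_space set"
  shows "hausdorff_pre m \<delta> (\<Union>i. A i) \<le> (\<Sum>i. hausdorff_pre m \<delta> (A i))"
proof (rule ennreal_le_epsilon)
  fix e :: real
  assume fin: "(\<Sum>i. hausdorff_pre m \<delta> (A i)) < top" and e: "0 < e"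
  have "\<exists>C. (\<forall>i. bounded (C i) \<and> diameter (C i) \<le> \<delta>) \<and> A n \<subseteq> (\<Union>i. C i) \<and>
          (\<Sum>i. hausdorff_gauge m (C i)) \<le> hausdorff_pre m \<delta> (A n) + ennreal (e * (1/2) ^ Suc n)" for n
  proof -
    have "hausdorff_pre m \<delta> (A n) \<noteq> top"
      using ennreal_suminf_lessD[OF fin, of n] by simp
    moreover have "0 < ennreal (e * (1/2) ^ Suc n)"
      using e by simp
    ultimately have
      "hausdorff_pre m \<delta> (A n) < hausdorff_pre m \<delta> (A n) + ennreal (e * (1/2) ^ Suc n)"
      by (simp add: ennreal_add_left_cancel_less less_top[symmetric])
    then show ?thesis
      unfolding hausdorff_pre_def[of m \<delta> "A n"] INF_less_iff by (auto intro: less_imp_le)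
  qed
  then obtain C where C: "\<And>n i. bounded (C n i)" "\<And>n i. diameter (C n i) \<le> \<delta>"
      "\<And>n. A n \<subseteq> (\<Union>i. C n i)"
      "\<And>n. (\<Sum>i. hausdorff_gauge m (C n i)) \<le> hausdorff_pre m \<delta> (A n) + ennreal (e * (1/2) ^ Suc n)"
    by metis
  define D where "D = (\<lambda>k. case prod_decode k of (n, i) \<Rightarrow> C n i)"
  have "(\<Union>n. A n) \<subseteq> (\<Union>k. D k)"
  proof
    fix x assume "x \<in> (\<Union>n. A n)"
    then obtain n i where "x \<in> C n i" using C(3) by blast
    then have "x \<in> D (prod_encode (n, i))" by (simp add: D_def)
    then show "x \<in> (\<Union>k. D k)" by blast
  qed
  then have "hausdorff_pre m \<delta> (\<Union>n. A n) \<le> (\<Sum>k. hausdorff_gauge m (D k))"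
    unfolding hausdorff_pre_def using C(1,2)
    by (intro INF_lower) (auto simp: D_def split: prod.split)
  also have "\<dots> = (\<Sum>k. case prod_decode k of (n, i) \<Rightarrow> hausdorff_gauge m (C n i))"
    by (simp add: D_def case_prod_unfold)
  also have "\<dots> = (\<Sum>n. \<Sum>i. hausdorff_gauge m (C n i))"
    using suminf_ennreal_2dimen[of "\<lambda>n. \<Sum>i. hausdorff_gauge m (C n i)"
        "\<lambda>(n, i). hausdorff_gauge m (C n i)"]
    by (simp add: comp_def case_prod_unfold)
  also have "\<dots> \<le> (\<Sum>n. hausdorff_pre m \<delta> (A n) + ennreal (e * (1/2) ^ Suc n))"
    by (intro suminf_le C(4)) auto
  also have "\<dots> = (\<Sum>n. hausdorff_pre m \<delta> (A n)) + (\<Sum>n. ennreal (e * (1/2) ^ Suc n))"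
    by (rule suminf_add[symmetric]) auto
  also have "(\<Sum>n. ennreal (e * (1/2) ^ Suc n)) = ennreal e"
    using sums_mult[OF power_half_series, of e] e by (intro suminf_ennreal_eq) auto
  finally show "hausdorff_pre m \<delta> (\<Union>i. A i) \<le> (\<Sum>i. hausdorff_pre m \<delta> (A i)) + ennreal e" .
qed

lemma hausdorff_pre_le_outer: "\<delta> > 0 \<Longrightarrow> hausdorff_pre m \<delta> A \<le> hausdorff_outer m A"
  unfolding hausdorff_outer_def by (rule SUP_upper) auto

lemma hausdorff_outer_empty: "hausdorff_outer m {} = 0"
proof -
  have "hausdorff_outer m {} \<le> 0"
    unfolding hausdorff_outer_def by (rule SUP_least) (simp add: hausdorff_pre_empty)
  then show ?thesis by simp
qed

lemma hausdorff_outer_mono: "A \<subseteq> B \<Longrightarrow> hausdorff_outer m A \<le> hausdorff_outer m B"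
  unfolding hausdorff_outer_def by (rule SUP_mono) (auto intro: hausdorff_pre_mono)

lemma hausdorff_outer_subadditive:
  "hausdorff_outer m (\<Union>i::nat. A i) \<le> (\<Sum>i. hausdorff_outer m (A i))"
proof -
  have "hausdorff_pre m \<delta> (\<Union>i. A i) \<le> (\<Sum>i. hausdorff_outer m (A i))" if "\<delta> > 0" for \<delta>
    using hausdorff_pre_subadditive[of m \<delta> A]
    by (rule order_trans) (intro suminf_le hausdorff_pre_le_outer that; simp)
  then show ?thesis
    unfolding hausdorff_outer_def[of m "\<Union>i. A i"] by (intro SUP_least) auto
qed

lemma hausdorff_outer_Un: "hausdorff_outer m (A \<union> B) \<le> hausdorff_outer m A + hausdorff_outer m B"
proof -
  have "(\<Union>i::nat. if i = 0 then A else if i = 1 then B else {}) = A \<union> B"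
    by (auto split: if_splits)
  moreover have "(\<Sum>i::nat. hausdorff_outer m (if i = 0 then A else if i = 1 then B else {})) =
      (\<Sum>i\<in>{0, 1::nat}. hausdorff_outer m (if i = 0 then A else if i = 1 then B else {}))"
    by (rule suminf_finite) (auto simp: hausdorff_outer_empty)
  ultimately show ?thesis
    using hausdorff_outer_subadditive[of m "\<lambda>i. if i = 0 then A else if i = 1 then B else {}"]
    by simp
qed

lemma outer_measure_space_hausdorff: "outer_measure_space (Pow UNIV) (hausdorff_outer m)"
  unfolding outer_measure_space_def positive_def increasing_def countably_subadditive_def
  by (auto simp: hausdorff_outer_empty hausdorff_outer_mono hausdorff_outer_subadditive)

lemma hausdorff_outer_separated:
  fixes A B :: "'a::metric_space set"
  assumes "\<epsilon> > 0" and sep: "\<And>x y. x \<in> A \<Longrightarrow> y \<in> B \<Longrightarrow> \<epsilon> \<le> dist x y"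
  shows "hausdorff_outer m A + hausdorff_outer m B \<le> hausdorff_outer m (A \<union> B)"
proof -
  have small: "hausdorff_pre m \<delta> A + hausdorff_pre m \<delta> B \<le> hausdorff_pre m \<delta> (A \<union> B)"
    if \<delta>: "\<delta> > 0" "\<delta> < \<epsilon>" for \<delta>
    unfolding hausdorff_pre_def[of m \<delta> "A \<union> B"]
  proof (rule INF_greatest, safe)
    fix C :: "nat \<Rightarrow> 'a set"
    assume C: "\<forall>i. bounded (C i) \<and> diameter (C i) \<le> \<delta>" and cov: "A \<union> B \<subseteq> (\<Union>i. C i)"
    define D where "D = (\<lambda>i. if C i \<inter> A = {} then {} else C i)"
    define E where "E = (\<lambda>i. if C i \<inter> A = {} then C i else {})"
    have "A \<subseteq> (\<Union>i. D i)" using cov by (force simp: D_def)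
    then have 1: "hausdorff_pre m \<delta> A \<le> (\<Sum>i. hausdorff_gauge m (D i))"
      unfolding hausdorff_pre_def using C \<delta> by (intro INF_lower) (auto simp: D_def)
    have "B \<subseteq> (\<Union>i. E i)"
    proof
      fix y assume y: "y \<in> B"
      then obtain i where i: "y \<in> C i" using cov by blast
      have "C i \<inter> A = {}"
      proof (rule ccontr)
        assume "C i \<inter> A \<noteq> {}"
        then obtain x where x: "x \<in> C i" "x \<in> A" by blast
        have "dist x y \<le> diameter (C i)"
          using C x i by (intro diameter_bounded_bound) auto
        then show False using sep[OF x(2) y] C \<delta> by (meson not_le order_trans)
      qed
      then show "y \<in> (\<Union>i. E i)" using i by (auto simp: E_def)
    qed
    then have 2: "hausdorff_pre m \<delta> B \<le> (\<Sum>i. hausdorff_gauge m (E i))"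
      unfolding hausdorff_pre_def using C \<delta> by (intro INF_lower) (auto simp: E_def)
    have "hausdorff_gauge m (D i) + hausdorff_gauge m (E i) = hausdorff_gauge m (C i)" for i
      by (auto simp: D_def E_def hausdorff_gauge_def)
    then have "(\<Sum>i. hausdorff_gauge m (D i)) + (\<Sum>i. hausdorff_gauge m (E i)) =
        (\<Sum>i. hausdorff_gauge m (C i))"
      by (simp add: suminf_add)
    then show "hausdorff_pre m \<delta> A + hausdorff_pre m \<delta> B \<le> (\<Sum>i. hausdorff_gauge m (C i))"
      using add_mono[OF 1 2] by simp
  qed
  have "hausdorff_pre m \<delta> A + hausdorff_pre m \<delta>' B \<le> hausdorff_outer m (A \<union> B)"
    if "\<delta> > 0" "\<delta>' > 0" for \<delta> \<delta>'
  proof -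
    define d where "d = min (min \<delta> \<delta>') (\<epsilon> / 2)"
    have d: "d > 0" "d < \<epsilon>" "d \<le> \<delta>" "d \<le> \<delta>'"
      using that assms(1) by (auto simp: d_def)
    have "hausdorff_pre m \<delta> A + hausdorff_pre m \<delta>' B \<le> hausdorff_pre m d A + hausdorff_pre m d B"
      using d by (intro add_mono hausdorff_pre_antimono)
    also have "\<dots> \<le> hausdorff_pre m d (A \<union> B)" using small d by blast
    also have "\<dots> \<le> hausdorff_outer m (A \<union> B)" using d by (intro hausdorff_pre_le_outer)
    finally show ?thesis .
  qed
  then have "(SUP \<delta>\<in>{0<..}. hausdorff_pre m \<delta> A + hausdorff_pre m \<delta>' B) \<le> hausdorff_outer m (A \<union> B)"
    if "\<delta>' > 0" for \<delta>' using that by (intro SUP_least) auto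
  then have "hausdorff_pre m \<delta>' B + hausdorff_outer m A \<le> hausdorff_outer m (A \<union> B)"
    if "\<delta>' > 0" for \<delta>'
    using that by (subst (asm) ennreal_SUP_add_left) (auto simp: hausdorff_outer_def add.commute)
  then have "(SUP \<delta>'\<in>{0<..}. hausdorff_pre m \<delta>' B + hausdorff_outer m A) \<le> hausdorff_outer m (A \<union> B)"
    by (intro SUP_least) auto
  then show ?thesis
    by (subst (asm) ennreal_SUP_add_left) (auto simp: hausdorff_outer_def add.commute)
qed

lemma hausdorff_outer_closed_split:
  fixes A C :: "'a::metric_space set"
  assumes "closed C"
  shows "hausdorff_outer m (A \<inter> C) + hausdorff_outer m (A - C) \<le> hausdorff_outer m A"
proof (cases "C = {} \<or> hausdorff_outer m A = top")
  case True
  then show ?thesis by (auto simp: hausdorff_outer_empty)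
next
  case False
  then have ne: "C \<noteq> {}" and fin: "hausdorff_outer m A \<noteq> top" by auto
  let ?H = "hausdorff_outer m"
  define D where "D = (\<lambda>k::nat. {x \<in> A. 1 / real (Suc k) \<le> infdist x C})"
  define R where "R = (\<lambda>k. D (Suc k) - D k)"
  have sepR: "?H (D k) + ?H (R (Suc k)) \<le> ?H (D k \<union> R (Suc k))" for k
  proof (rule hausdorff_outer_separated)
    show "1 / real (Suc k) - 1 / real (Suc (Suc k)) > 0"
      by (simp add: divide_simps)
    fix x y assume "x \<in> D k" "y \<in> R (Suc k)"
    then have "1 / real (Suc k) \<le> infdist x C" "infdist y C < 1 / real (Suc (Suc k))"
      by (auto simp: D_def R_def)
    moreover have "infdist x C \<le> infdist y C + dist x y" by (rule infdist_triangle)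
    ultimately show "1 / real (Suc k) - 1 / real (Suc (Suc k)) \<le> dist x y" by linarith
  qed
  have D_mono: "D i \<subseteq> D j" if "i \<le> j" for i j
  proof -
    have "1 / real (Suc j) \<le> 1 / real (Suc i)" using that by (simp add: divide_simps)
    then show ?thesis by (auto simp: D_def)
  qed
  have half: "(\<Sum>j<N. ?H (R (2 * j + r))) \<le> ?H (D (2 * N + r - 1))" for N r
  proof (induction N)
    case (Suc N)
    show ?case
    proof (cases "2 * N + r = 0")
      case True
      have "R 0 \<subseteq> D 1" by (auto simp: R_def)
      then show ?thesis using True by (simp add: hausdorff_outer_mono)
    next
      case False
      then obtain k where k: "2 * N + r = Suc k" by (cases "2 * N + r") auto
      have "(\<Sum>j<Suc N. ?H (R (2 * j + r))) \<le> ?H (D k) + ?H (R (Suc k))"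
        using Suc.IH k by (simp add: add_mono)
      also have "\<dots> \<le> ?H (D k \<union> R (Suc k))" by (rule sepR)
      also have "D k \<union> R (Suc k) \<subseteq> D (2 * Suc N + r - 1)"
        using k D_mono[of k "2 * N + r + 1"] by (auto simp: R_def)
      then have "?H (D k \<union> R (Suc k)) \<le> ?H (D (2 * Suc N + r - 1))"
        by (rule hausdorff_outer_mono)
      finally show ?thesis .
    qed
  qed simp
  have half': "(\<Sum>j<N. ?H (R (2 * j + r))) \<le> ?H A" for N r
    by (rule order_trans[OF half]) (auto simp: D_def intro: hausdorff_outer_mono)
  have "(\<Sum>k<n. ?H (R k)) \<le> ?H A + ?H A" for n
  proof -
    have split2: "(\<Sum>k<2 * n. f k) = (\<Sum>j<n. f (2 * j + 0)) + (\<Sum>j<n. f (2 * j + 1))"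
      for f :: "nat \<Rightarrow> ennreal" and n by (induction n) (auto simp: algebra_simps)
    have "(\<Sum>k<n. ?H (R k)) \<le> (\<Sum>k<2 * n. ?H (R k))" by (rule sum_mono2) auto
    also have "\<dots> \<le> ?H A + ?H A" unfolding split2 by (intro add_mono half')
    finally show ?thesis .
  qed
  then have "(\<Sum>k. ?H (R k)) \<le> ?H A + ?H A" by (intro suminf_le_const) auto
  then have sumfin: "(\<Sum>k. ?H (R k)) \<noteq> top" using fin by (auto simp: top_unique)
  have tail: "(\<lambda>n. \<Sum>k. ?H (R (k + n))) \<longlonglongrightarrow> 0"
  proof -
    have "(\<lambda>n. (\<Sum>k. ?H (R k)) - (\<Sum>k<n. ?H (R k))) \<longlonglongrightarrow> (\<Sum>k. ?H (R k)) - (\<Sum>k. ?H (R k))"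
      using sumfin by (intro tendsto_diff_ennreal tendsto_const summable_LIMSEQ) auto
    moreover have "(\<Sum>k. ?H (R k)) - (\<Sum>k<n. ?H (R k)) = (\<Sum>k. ?H (R (k + n)))" for n
    proof -
      have eq: "(\<Sum>k. ?H (R k)) = (\<Sum>k. ?H (R (k + n))) + (\<Sum>k<n. ?H (R k))"
        by (rule suminf_offset) auto
      have "(\<Sum>k<n. ?H (R k)) \<noteq> top" using sumfin unfolding eq by auto
      then show ?thesis unfolding eq by (simp add: add.commute)
    qed
    ultimately show ?thesis using sumfin by simp
  qed
  have bound: "?H (A \<inter> C) + ?H (A - C) \<le> ?H A + (\<Sum>k. ?H (R (k + n)))" for n
  proof -
    have "A - C \<subseteq> D n \<union> (\<Union>k. R (k + n))"
    proof
      fix x assume x: "x \<in> A - C"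
      then have "infdist x C > 0"
        using assms ne by (simp add: infdist_pos_not_in_closed)
      then obtain N where "1 / real (Suc N) < infdist x C"
        using nat_approx_posE by metis
      then have "x \<in> D N" using x by (auto simp: D_def)
      then have "x \<in> D (N + n)" using D_mono[of N "N + n"] by auto
      then have "x \<in> D n \<union> (\<Union>k<N. R (k + n))"
      proof (induction N)
        case (Suc N)
        then show ?case by (cases "x \<in> D (N + n)") (auto simp: R_def less_Suc_eq)
      qed auto
      then show "x \<in> D n \<union> (\<Union>k. R (k + n))" by auto
    qed
    then have "?H (A - C) \<le> ?H (D n \<union> (\<Union>k. R (k + n)))" by (rule hausdorff_outer_mono)
    also have "\<dots> \<le> ?H (D n) + ?H (\<Union>k. R (k + n))" by (rule hausdorff_outer_Un)
    also have "\<dots> \<le> ?H (D n) + (\<Sum>k. ?H (R (k + n)))"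
      by (intro add_left_mono hausdorff_outer_subadditive)
    finally have "?H (A \<inter> C) + ?H (A - C) \<le> (?H (A \<inter> C) + ?H (D n)) + (\<Sum>k. ?H (R (k + n)))"
      by (simp add: add.assoc add_left_mono)
    also have "?H (A \<inter> C) + ?H (D n) \<le> ?H (A \<inter> C \<union> D n)"
    proof (rule hausdorff_outer_separated)
      show "1 / real (Suc n) > 0" by simp
      fix x y assume "x \<in> A \<inter> C" "y \<in> D n"
      then have "1 / real (Suc n) \<le> infdist y C" "infdist y C \<le> dist y x"
        by (auto simp: D_def intro: infdist_le)
      then show "1 / real (Suc n) \<le> dist x y" by (simp add: dist_commute)
    qed
    also have "?H (A \<inter> C \<union> D n) \<le> ?H A" by (rule hausdorff_outer_mono) (auto simp: D_def)
    finally show ?thesis by (simp add: add_right_mono)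
  qed
  have "(\<lambda>n. ?H A + (\<Sum>k. ?H (R (k + n)))) \<longlonglongrightarrow> ?H A + 0"
    by (intro tendsto_add tendsto_const tail)
  then have "?H (A \<inter> C) + ?H (A - C) \<le> ?H A + 0"
    by (rule LIMSEQ_le_const) (use bound in auto)
  then show ?thesis by simp
qed

lemma measure_space_hausdorff:
  "measure_space UNIV (sets (borel :: 'a::metric_space measure)) (hausdorff_outer m)"
proof -
  interpret P: sigma_algebra UNIV "Pow (UNIV :: 'a set)" by (rule sigma_algebra_Pow)
  let ?L = "lambda_system UNIV (Pow UNIV) (hausdorff_outer m :: 'a set \<Rightarrow> ennreal)"
  have ms: "measure_space UNIV ?L (hausdorff_outer m)"
    by (rule P.caratheodory_lemma[OF outer_measure_space_hausdorff])
  then interpret L: sigma_algebra UNIV ?L by (simp add: measure_space_def)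
  have "closed C \<Longrightarrow> C \<in> ?L" for C :: "'a set"
  proof -
    assume C: "closed C"
    have "hausdorff_outer m (C \<inter> A) + hausdorff_outer m ((UNIV - C) \<inter> A) = hausdorff_outer m A" for A
    proof (rule antisym)
      have eq: "(UNIV - C) \<inter> A = A - C" "C \<inter> A = A \<inter> C" by auto
      show "hausdorff_outer m (C \<inter> A) + hausdorff_outer m ((UNIV - C) \<inter> A) \<le> hausdorff_outer m A"
        unfolding eq by (rule hausdorff_outer_closed_split[OF C])
      show "hausdorff_outer m A \<le> hausdorff_outer m (C \<inter> A) + hausdorff_outer m ((UNIV - C) \<inter> A)"
        using hausdorff_outer_Un[of m "C \<inter> A" "(UNIV - C) \<inter> A"] by (simp add: Int_Un_distrib2[symmetric])
    qed
    then show "C \<in> ?L" by (auto simp: lambda_system_def)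
  qed
  then have "sets (borel :: 'a measure) \<subseteq> ?L"
    unfolding borel_eq_closed using L.sigma_sets_subset[of "Collect closed"] by auto
  then show ?thesis
    using ms sets.sigma_algebra_axioms[of "borel :: 'a measure"] by (auto intro: measure_down)
qed

lemma space_hausdorff_measure [simp]: "space (hausdorff_measure m) = UNIV"
  by (simp add: hausdorff_measure_def space_measure_of_conv)

lemma sets_hausdorff_measure [simp, measurable_cong]: "sets (hausdorff_measure m) = sets borel"
  using sets.sigma_sets_eq[of borel] by (simp add: hausdorff_measure_def sets_measure_of_conv)

lemma emeasure_hausdorff_measure:
  "A \<in> sets borel \<Longrightarrow> emeasure (hausdorff_measure m) A = hausdorff_outer m A"
  using measure_space_hausdorff[of m] unfolding hausdorff_measure_def
  by (intro emeasure_measure_of_sigma) (auto simp: measure_space_def)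


section \<open>Rectifiable sets\<close>

text \<open>
  Up to a set of \<open>m\<close>-dimensional measure zero, \<open>E\<close> is covered by countably many Lipschitz images of
  the Euclidean space of dimension \<open>m\<close>, which for \<open>m \<le> DIM('a)\<close> is represented by an
  \<open>m\<close>-dimensional linear subspace \<open>V\<close>; all choices of \<open>V\<close> are isometric.
\<close>

definition rectifiable :: "nat \<Rightarrow> 'a::euclidean_space set \<Rightarrow> bool" where
  "rectifiable m E \<longleftrightarrow>
     (\<exists>(V :: 'a set) (f :: nat \<Rightarrow> 'a \<Rightarrow> 'a).
        subspace V \<and> dim V = m \<and> (\<forall>i. \<exists>L. L-lipschitz_on V (f i)) \<and>
        hausdorff_outer m (E - (\<Union>i. f i ` V)) = 0)"


section \<open>Full-dimensional submanifolds with boundary\<close>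

definition half_space :: "'a::euclidean_space \<Rightarrow> 'a set" where
  "half_space e = {x. 0 \<le> x \<bullet> e}"

definition half_space_chart ::
  "'a::euclidean_space set \<Rightarrow> 'a \<Rightarrow> 'a set \<Rightarrow> 'a set \<Rightarrow> ('a \<Rightarrow> 'a) \<Rightarrow> bool" where
  "half_space_chart K e U V h \<longleftrightarrow>
     openin (top_of_set K) U \<and> openin (top_of_set (half_space e)) V \<and> (\<exists>g. homeomorphism U V h g)"

text \<open>
  A chart may take values in the interior of the half space, so charts onto open subsets of the
  Euclidean space need no separate clause.
\<close>

definition submanifold_with_boundary :: "'a::euclidean_space set \<Rightarrow> bool" where
  "submanifold_with_boundary K \<longleftrightarrow>
     (\<forall>x\<in>K. \<exists>e\<in>Basis. \<exists>U V h. half_space_chart K e U V h \<and> x \<in> U)"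

definition manifold_boundary :: "'a::euclidean_space set \<Rightarrow> 'a set" where
  "manifold_boundary K =
     {x \<in> K. \<exists>e\<in>Basis. \<exists>U V h. half_space_chart K e U V h \<and> x \<in> U \<and> h x \<bullet> e = 0}"


section \<open>Oriented lines\<close>

text \<open>
  The oriented line with unit direction vector \<open>v\<close> that meets the hyperplane orthogonal to \<open>v\<close>
  in \<open>u\<close> is the pair \<open>(v, u)\<close>.
\<close>

definition oriented_lines :: "('a::euclidean_space \<times> 'a) set" where
  "oriented_lines = {(v, u). norm v = 1 \<and> v \<bullet> u = 0}"

definition line_points :: "'a::euclidean_space \<times> 'a \<Rightarrow> 'a set" where
  "line_points l = (case l of (v, u) \<Rightarrow> {u + t *\<^sub>R v | t. t \<in> UNIV})"

text \<open>Integration over \<^const>\<open>oriented_lines\<close> with respect to the invariant measure.\<close>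

definition lines_nn_integral :: "('a::euclidean_space \<times> 'a \<Rightarrow> ennreal) \<Rightarrow> ennreal" where
  "lines_nn_integral f =
     (\<integral>\<^sup>+v\<in>sphere 0 1. (\<integral>\<^sup>+u\<in>{u. (v, u) \<in> oriented_lines}. f (v, u) \<partial>hausdorff_measure (DIM('a) - 1))
        \<partial>hausdorff_measure (DIM('a) - 1))"

end

theory Submission
  imports Defs
begin

text \<open>
  For a topological submanifold \<open>K\<close> of full dimension, invariance of domain identifies \<open>\<Sigma>\<close> with the
  frontier of \<open>K\<close>, so \<open>\<Sigma>\<close> is closed; only this and rectifiability matter from then on. Write
  \<open>m = n - 1\<close>. The isodiametric inequality and Vitali's covering theorem show that \<open>m\<close>-dimensional
  Hausdorff measure on \<open>m\<close>-dimensional Euclidean space is Lebesgue measure. By Rademacher's theorem, \<open>\<Sigma>\<close> is,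
  up to a null set, a countable disjoint union of pieces on which the parametrisation is arbitrarily
  close to an injective linear map. On such a piece, projection along a direction that is not almost
  tangential is bi-Lipschitz, with nearly the same volume distortion as on the tangent plane, while
  the almost tangential directions have small measure. Hence the line integral of the piece is nearly \<open>c\<close> times
  its area, where \<open>c\<close> is the line integral of a unit cube in a hyperplane, which by rotation invariance
  does not depend on the hyperplane. Refining the pieces shows that the line integral is exactly \<open>c\<close> times the area.
  The constant need not be computed directly: for the unit sphere, almost every line through the open
  ball meets it twice, so \<open>c = 2 \<omega>\<^sub>m\<close>.
\<close>

section \<open>The Brunn--Minkowski inequality for finite unions of boxes\<close>

text \<open>All estimates are inequalities between values in \<open>ennreal\<close> that add up over
  countably many disjoint pieces, so the area of \<open>\<Sigma>\<close> may be infinite. The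
  obstacle that shapes the construction is measurability: pieces, their parameter sets and their
  projections must be Borel, which images of Borel sets need not be. Hence every piece is a
  countable union of closed sets (\<open>F_sigma\<close>), a class that survives removing closed
  sets, continuous preimages, and continuous images as long as everything stays inside a compact
  set. Rademacher's theorem alone does not provide injective linear maps: the parameters with a
  singular derivative are discarded because their image is null, as in Sard's theorem. How close a
  map must be to its linear model depends on that model, so the decomposition works with a tolerance
  that varies with the matrix. Dimension one is separate, because a hyperplane is then a point and
  has no Euclidean coordinates.\<close>

definition mid :: "'a::real_vector set \<Rightarrow> 'a set \<Rightarrow> 'a set" where
  "mid A B = (\<lambda>(a, b). (1/2) *\<^sub>R (a + b)) ` (A \<times> B)"

lemma mid_commute: "mid A B = mid B A"
  unfolding mid_def by (auto simp: image_iff) (metis add.commute)+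

lemma mid_mono: "A \<subseteq> A' \<Longrightarrow> B \<subseteq> B' \<Longrightarrow> mid A B \<subseteq> mid A' B'"
  unfolding mid_def by blast

lemma open_mid:
  fixes A B :: "'a::real_normed_vector set"
  assumes "open A"
  shows "open (mid A B)"
proof -
  have "mid A B = (\<Union>b\<in>B. (\<lambda>a. (1/2) *\<^sub>R a) ` ((\<lambda>a. b + a) ` A))"
    unfolding mid_def by (force simp: image_iff add.commute)
  then show ?thesis
    using assms by (auto intro!: open_scaling open_translation)
qed

lemma bounded_mid:
  fixes A B :: "'a::real_normed_vector set"
  assumes "bounded A" "bounded B"
  shows "bounded (mid A B)"
proof -
  have "mid A B = (\<lambda>x. (1/2) *\<^sub>R x) ` ((\<lambda>(x, y). x + y) ` (A \<times> B))"
    unfolding mid_def by (simp add: image_image case_prod_unfold)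
  then show ?thesis
    using assms by (auto intro!: bounded_scaling bounded_plus)
qed

lemma emeasure_bounded_lborel_neq_top:
  "bounded A \<Longrightarrow> emeasure lborel (A :: 'a::euclidean_space set) \<noteq> \<infinity>"
  using emeasure_bounded_finite[of A] by auto

lemma measure_lborel_mono:
  fixes A B :: "'a::euclidean_space set"
  assumes "A \<subseteq> B" "B \<in> sets borel" "bounded B"
  shows "measure lborel A \<le> measure lborel B"
  unfolding measure_def
  by (rule enn2real_mono) (use assms emeasure_bounded_finite[of B] in \<open>auto intro: emeasure_mono\<close>)

lemma measure_lborel_disjoint:
  fixes A B C :: "'a::euclidean_space set"
  assumes "A \<subseteq> C" "B \<subseteq> C" "A \<inter> B = {}" "A \<in> sets borel" "B \<in> sets borel" "C \<in> sets borel" "bounded C"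
  shows "measure lborel A + measure lborel B \<le> measure lborel C"
proof -
  have b: "bounded A" "bounded B" using assms bounded_subset by blast+
  have "measure lborel A + measure lborel B = measure lborel (A \<union> B)"
    using assms b emeasure_bounded_lborel_neq_top[of A] emeasure_bounded_lborel_neq_top[of B]
    by (intro measure_Union[symmetric]) auto
  also have "\<dots> \<le> measure lborel C" using assms by (intro measure_lborel_mono) auto
  finally show ?thesis .
qed

lemma measure_lborel_open_pos:
  fixes U :: "'a::euclidean_space set"
  assumes "open U" "U \<noteq> {}" "bounded U"
  shows "0 < measure lborel U"
proof -
  obtain x e where "x \<in> U" "e > 0" "ball x e \<subseteq> U"
    using assms by (meson ex_in_conv open_contains_ball)
  have "0 < measure lborel (ball x e)" using \<open>e > 0\<close> content_ball_gt_0_iff[of x e] by simp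
  moreover have "measure lborel (ball x e) \<le> measure lborel U"
    using \<open>ball x e \<subseteq> U\<close> assms by (intro measure_lborel_mono) auto
  ultimately show ?thesis by linarith
qed

lemma null_sets_hyperplane:
  fixes b :: "'a::euclidean_space"
  assumes "b \<noteq> 0"
  shows "{x. b \<bullet> x = c} \<in> null_sets lborel"
proof -
  have "negligible {x. b \<bullet> x = c}" using assms negligible_hyperplane by blast
  moreover have "{x. b \<bullet> x = c} \<in> sets borel"
    by (intro borel_closed closed_hyperplane)
  ultimately show ?thesis
    using negligible_iff_null_sets null_sets_completion_iff by (metis sets_lborel)
qed

lemma measure_halfspace_cut:
  fixes V :: "'a::euclidean_space set"
  assumes V: "V \<in> sets borel" "bounded V" and b: "b \<noteq> 0"
  shows "measure lborel (V \<inter> {x. b \<bullet> x < d}) + measure lborel (V \<inter> {x. b \<bullet> x > d}) = measure lborel V"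
proof -
  let ?A = "V \<inter> {x. b \<bullet> x < d}" and ?B = "V \<inter> {x. b \<bullet> x > d}" and ?N = "V \<inter> {x. b \<bullet> x = d}"
  have m: "?A \<in> sets borel" "?B \<in> sets borel"
    using V by (auto intro!: sets.Int borel_open open_halfspace_lt open_halfspace_gt)
  have bd: "bounded ?A" "bounded ?B" using V by (auto intro: bounded_subset)
  have "measure lborel ?A + measure lborel ?B = measure lborel (?A \<union> ?B)"
    using m bd by (intro measure_Union[symmetric]) (auto simp: emeasure_bounded_lborel_neq_top[simplified])
  also have "?N \<in> null_sets lborel"
    using null_sets_hyperplane[OF b, of d] V null_set_Int1[of "{x. b \<bullet> x = d}" lborel V] by (simp add: Int_commute)
  then have "measure lborel (?A \<union> ?B) = measure lborel ((?A \<union> ?B) \<union> ?N)"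
    using m by (intro measure_Un_null_set[symmetric]) auto
  also have "(?A \<union> ?B) \<union> ?N = V" by auto
  finally show ?thesis .
qed

lemma isCont_measure_halfspace:
  fixes V :: "'a::euclidean_space set"
  assumes V: "V \<in> sets borel" "bounded V" and b: "b \<noteq> 0"
  shows "isCont (\<lambda>d. measure lborel (V \<inter> {x. b \<bullet> x < d})) d"
  unfolding continuous_at_sequentially comp_def
proof (intro allI impI)
  fix D :: "nat \<Rightarrow> real" assume D: "D \<longlonglongrightarrow> d"
  have m: "V \<inter> {x. b \<bullet> x < c} \<in> sets borel" for c
    using V by (auto intro!: sets.Int borel_open open_halfspace_lt)
  have eq: "measure lborel (V \<inter> {x. b \<bullet> x < c}) = integral\<^sup>L lborel (indicat_real (V \<inter> {x. b \<bullet> x < c}))" for c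
    by simp
  have "AE x in lborel. x \<notin> {x. b \<bullet> x = d}"
    using null_sets_hyperplane[OF b, of d] by (rule AE_not_in)
  then have ae: "AE x in lborel. (\<lambda>n. indicat_real (V \<inter> {x. b \<bullet> x < D n}) x) \<longlonglongrightarrow> indicat_real (V \<inter> {x. b \<bullet> x < d}) x"
  proof (rule AE_mp, intro AE_I2 impI)
    fix x assume "x \<notin> {x. b \<bullet> x = d}"
    then consider "b \<bullet> x < d" | "d < b \<bullet> x" by force
    then show "(\<lambda>n. indicat_real (V \<inter> {x. b \<bullet> x < D n}) x) \<longlonglongrightarrow> indicat_real (V \<inter> {x. b \<bullet> x < d}) x"
    proof cases
      case 1
      then have "\<forall>\<^sub>F n in sequentially. b \<bullet> x < D n" using D order_tendstoD by blast
      then show ?thesis using 1 by (intro tendsto_eventually) (auto elim!: eventually_mono simp: indicator_def)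
    next
      case 2
      then have "\<forall>\<^sub>F n in sequentially. b \<bullet> x > D n" using D order_tendstoD by blast
      then show ?thesis using 2 by (intro tendsto_eventually) (auto elim!: eventually_mono simp: indicator_def)
    qed
  qed
  show "(\<lambda>n. measure lborel (V \<inter> {x. b \<bullet> x < D n})) \<longlonglongrightarrow> measure lborel (V \<inter> {x. b \<bullet> x < d})"
    unfolding eq
  proof (rule integral_dominated_convergence[where w = "indicat_real V"])
    show "integrable lborel (indicat_real V)"
      using V emeasure_bounded_finite[of V] by (intro integrable_real_indicator) auto
  qed (use m ae V in \<open>auto simp: indicator_def\<close>)
qed

text \<open>Supplies the cut of the second family in \<open>mid_families_step\<close>: hyperplanes
  are null, so the volume below a moving hyperplane is continuous and attains every intermediate
  value.\<close>

lemma measure_halfspace_ivt: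
  fixes V :: "'a::euclidean_space set"
  assumes V: "V \<in> sets borel" "bounded V" and b: "b \<noteq> 0" and r: "0 \<le> r" "r \<le> measure lborel V"
  obtains d where "measure lborel (V \<inter> {x. b \<bullet> x < d}) = r"
proof -
  obtain K where K: "\<And>x. x \<in> V \<Longrightarrow> norm x \<le> K" using V(2) bounded_iff by blast
  define M where "M = norm b * \<bar>K\<bar> + 1"
  have M: "\<bar>b \<bullet> x\<bar> < M" if "x \<in> V" for x
    using Cauchy_Schwarz_ineq2[of b x] K[OF that] mult_left_mono[of "norm x" "\<bar>K\<bar>" "norm b"] that
    unfolding M_def by force
  have "V \<inter> {x. b \<bullet> x < -M} = {}" "V \<inter> {x. b \<bullet> x < M} = V" using M by (force simp: abs_less_iff)+
  moreover have "0 \<le> M" unfolding M_def by (simp add: add_nonneg_nonneg)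
  ultimately have "\<exists>d\<ge>-M. d \<le> M \<and> measure lborel (V \<inter> {x. b \<bullet> x < d}) = r"
    using r isCont_measure_halfspace[OF V b] by (intro IVT) auto
  then show ?thesis using that by blast
qed

lemma box_cut_lt:
  fixes l u b :: "'a::euclidean_space"
  assumes "b \<in> Basis"
  shows "box l u \<inter> {x. b \<bullet> x < c} = box l (\<Sum>i\<in>Basis. (if i = b then min (u \<bullet> b) c else u \<bullet> i) *\<^sub>R i)"
  using assms by (auto simp: box_def inner_commute[of b] split: if_splits)

lemma box_cut_gt:
  fixes l u b :: "'a::euclidean_space"
  assumes "b \<in> Basis"
  shows "box l u \<inter> {x. b \<bullet> x > c} = box (\<Sum>i\<in>Basis. (if i = b then max (l \<bullet> b) c else l \<bullet> i) *\<^sub>R i) u"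
  using assms by (auto simp: box_def inner_commute[of b] split: if_splits)

text \<open>Open boxes, because a hyperplane cut then loses only a null set and leaves open boxes.
  Empty boxes are excluded so that the cardinality can serve as induction measure.\<close>

definition box_family :: "'a::euclidean_space set set \<Rightarrow> bool" where
  "box_family \<A> \<longleftrightarrow> finite \<A> \<and> \<A> \<noteq> {} \<and> (\<forall>Q\<in>\<A>. Q \<noteq> {} \<and> (\<exists>l u. Q = box l u)) \<and> disjoint \<A>"

lemma box_family_open: "box_family \<A> \<Longrightarrow> open (\<Union>\<A>)"
  unfolding box_family_def by (auto intro!: open_Union simp: open_box)

lemma box_family_bounded: "box_family \<A> \<Longrightarrow> bounded (\<Union>\<A>)"
  unfolding box_family_def by (intro bounded_Union) (auto simp: bounded_box)

lemma box_family_pos: "box_family \<A> \<Longrightarrow> 0 < measure lborel (\<Union>\<A>)"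
  using box_family_open box_family_bounded
  by (intro measure_lborel_open_pos) (auto simp: box_family_def)

text \<open>Empty remains are dropped, so one box on the far side of the cut already lowers the
  number of boxes. The last conclusion is what makes the induction in \<open>mid_families\<close>
  descend.\<close>

lemma box_family_cut:
  fixes b :: "'a::euclidean_space"
  assumes \<A>: "box_family \<A>" and b: "b \<in> Basis" and H: "H = {x. b \<bullet> x < c} \<or> H = {x. b \<bullet> x > c}"
    and ne: "\<Union>\<A> \<inter> H \<noteq> {}"
  obtains \<B> where "box_family \<B>" "\<Union>\<B> = \<Union>\<A> \<inter> H" "card \<B> \<le> card \<A>"
    "\<And>Q. Q \<in> \<A> \<Longrightarrow> Q \<inter> H = {} \<Longrightarrow> card \<B> < card \<A>"
proof -
  define \<B> where "\<B> = (\<lambda>Q. Q \<inter> H) ` {Q \<in> \<A>. Q \<inter> H \<noteq> {}}"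
  have fin: "finite \<A>" and dj: "disjoint \<A>" using \<A> by (auto simp: box_family_def)
  have bx: "\<forall>Q\<in>\<A>. \<exists>l u. Q = box l u" using \<A> by (simp add: box_family_def)
  have "disjoint \<B>"
    unfolding disjoint_def
  proof (intro ballI impI)
    fix X Y assume "X \<in> \<B>" "Y \<in> \<B>" "X \<noteq> Y"
    then obtain Q R where QR: "X = Q \<inter> H" "Y = R \<inter> H" "Q \<in> \<A>" "R \<in> \<A>" "Q \<noteq> R" unfolding \<B>_def by auto
    then have "Q \<inter> R = {}" using dj unfolding disjoint_def by blast
    then show "X \<inter> Y = {}" using QR by blast
  qed
  moreover have "\<exists>l u. Q \<inter> H = box l u" if Qin: "Q \<in> \<A>" for Q
  proof -
    obtain l u where Q: "Q = box l u" using bx[rule_format, OF Qin] by (elim exE)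
    show ?thesis using H
    proof
      assume "H = {x. b \<bullet> x < c}"
      then show ?thesis unfolding Q using box_cut_lt[OF b, of l u c] by metis
    next
      assume "H = {x. b \<bullet> x > c}"
      then show ?thesis unfolding Q using box_cut_gt[OF b, of l u c] by metis
    qed
  qed
  ultimately have "box_family \<B>"
    unfolding box_family_def using fin ne by (auto simp: \<B>_def)
  moreover have "\<Union>\<B> = \<Union>\<A> \<inter> H" unfolding \<B>_def by blast
  moreover have "card \<B> \<le> card {Q \<in> \<A>. Q \<inter> H \<noteq> {}}" unfolding \<B>_def using fin by (intro card_image_le) auto
  moreover have "card {Q \<in> \<A>. Q \<inter> H \<noteq> {}} \<le> card \<A>" using fin by (intro card_mono) auto
  moreover have "card {Q \<in> \<A>. Q \<inter> H \<noteq> {}} < card \<A>" if "Q \<in> \<A>" "Q \<inter> H = {}" for Q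
    using fin that by (intro psubset_card_mono) auto
  ultimately show ?thesis using that[of \<B>] by (meson le_trans le_less_trans)
qed

text \<open>The intersection of two boxes is a box and can be empty only if one of its coordinate
  intervals is. Since neither box is empty itself, that coordinate separates them.\<close>

lemma disjoint_boxes_separated:
  fixes l u l' u' :: "'a::euclidean_space"
  assumes "box l u \<inter> box l' u' = {}" "box l u \<noteq> {}" "box l' u' \<noteq> {}"
  obtains b c where "b \<in> Basis" "box l u \<inter> {x. b \<bullet> x < c} = {}" "box l' u' \<inter> {x. b \<bullet> x > c} = {}"
    | b c where "b \<in> Basis" "box l u \<inter> {x. b \<bullet> x > c} = {}" "box l' u' \<inter> {x. b \<bullet> x < c} = {}"
proof -
  obtain b where b: "b \<in> Basis" "min (u \<bullet> b) (u' \<bullet> b) \<le> max (l \<bullet> b) (l' \<bullet> b)"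
    using assms(1) unfolding box_Int_box box_eq_empty by auto
  have "l \<bullet> b < u \<bullet> b" "l' \<bullet> b < u' \<bullet> b" using assms(2,3) b(1) by (auto simp: box_ne_empty)
  then consider "u \<bullet> b \<le> l' \<bullet> b" | "u' \<bullet> b \<le> l \<bullet> b" using b by linarith
  then show ?thesis
  proof cases
    case 1
    then have "box l u \<inter> {x. b \<bullet> x > u \<bullet> b} = {}" "box l' u' \<inter> {x. b \<bullet> x < u \<bullet> b} = {}"
      using b by (force simp: box_def inner_commute)+
    then show ?thesis using that b by blast
  next
    case 2
    then have "box l u \<inter> {x. b \<bullet> x < u' \<bullet> b} = {}" "box l' u' \<inter> {x. b \<bullet> x > u' \<bullet> b} = {}"
      using b by (force simp: box_def inner_commute)+
    then show ?thesis using that b by blast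
  qed
qed

lemma mid_box:
  fixes l u l' u' :: "'a::euclidean_space"
  assumes "box l u \<noteq> {}" "box l' u' \<noteq> {}"
  shows "box ((1/2) *\<^sub>R (l + l')) ((1/2) *\<^sub>R (u + u')) \<subseteq> mid (box l u) (box l' u')"
proof
  fix x assume x: "x \<in> box ((1/2) *\<^sub>R (l + l')) ((1/2) *\<^sub>R (u + u'))"
  define t where "t i = (2 * (x \<bullet> i) - l \<bullet> i - l' \<bullet> i) / (u \<bullet> i - l \<bullet> i + (u' \<bullet> i - l' \<bullet> i))" for i
  define y where "y = (\<Sum>i\<in>Basis. (l \<bullet> i + t i * (u \<bullet> i - l \<bullet> i)) *\<^sub>R i)"
  define z where "z = (\<Sum>i\<in>Basis. (l' \<bullet> i + t i * (u' \<bullet> i - l' \<bullet> i)) *\<^sub>R i)"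
  have pos: "l \<bullet> i < u \<bullet> i" "l' \<bullet> i < u' \<bullet> i" if "i \<in> Basis" for i
    using assms that by (auto simp: box_ne_empty)
  have t: "0 < t i" "t i < 1" if "i \<in> Basis" for i
    using x pos[OF that] that unfolding t_def box_def by (auto simp: inner_simps field_simps)
  have ti: "p < p + t i * (q - p) \<and> p + t i * (q - p) < q" if "i \<in> Basis" "p < q" for i p q
  proof -
    have qp: "0 < q - p" using that by simp
    define w where "w = t i * (q - p)"
    have "w < q - p" "0 < w"
      using mult_strict_right_mono[OF t(2)[OF that(1)] qp] mult_pos_pos[OF t(1)[OF that(1)] qp] by (auto simp: w_def)
    then show ?thesis unfolding w_def[symmetric] by linarith
  qed
  have "y \<in> box l u" "z \<in> box l' u'"
    using pos ti[OF _ pos(1)] ti[OF _ pos(2)] unfolding y_def z_def box_def by auto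
  moreover have "x = (1/2) *\<^sub>R (y + z)"
  proof (rule euclidean_eqI)
    fix i :: 'a assume i: "i \<in> Basis"
    have "t i * (u \<bullet> i - l \<bullet> i) + t i * (u' \<bullet> i - l' \<bullet> i) = 2 * (x \<bullet> i) - l \<bullet> i - l' \<bullet> i"
      using pos[OF i] unfolding t_def distrib_left[symmetric] by simp
    then show "x \<bullet> i = (1/2) *\<^sub>R (y + z) \<bullet> i"
      using i unfolding y_def z_def by (simp add: inner_simps)
  qed
  ultimately show "x \<in> mid (box l u) (box l' u')" unfolding mid_def by (auto simp: image_iff)
qed

text \<open>The midpoint set contains the box with averaged sides, so this is the inequality of
  arithmetic and geometric means in each coordinate.\<close>

lemma mid_box_measure:
  fixes l u l' u' :: "'a::euclidean_space"
  assumes "box l u \<noteq> {}" "box l' u' \<noteq> {}"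
  shows "measure lborel (box l u) * measure lborel (box l' u') \<le> (measure lborel (mid (box l u) (box l' u')))\<^sup>2"
proof -
  have pos: "l \<bullet> i < u \<bullet> i" "l' \<bullet> i < u' \<bullet> i" if "i \<in> Basis" for i
    using assms that by (auto simp: box_ne_empty)
  have "measure lborel (box l u) * measure lborel (box l' u') = (\<Prod>i\<in>Basis. ((u - l) \<bullet> i) * ((u' - l') \<bullet> i))"
    using pos by (simp add: measure_lborel_box_eq prod.distrib less_imp_le)
  also have "\<dots> \<le> (\<Prod>i\<in>Basis. (((1/2) *\<^sub>R (u + u') - (1/2) *\<^sub>R (l + l')) \<bullet> i)\<^sup>2)"
  proof (rule prod_mono, safe)
    fix i :: 'a assume i: "i \<in> Basis"
    have ag: "p * q \<le> ((p + q) / 2)\<^sup>2" for p q :: real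
      using sum_squares_bound[of p q] by (simp add: power2_eq_square field_simps)
    show "0 \<le> ((u - l) \<bullet> i) * ((u' - l') \<bullet> i)" using pos[OF i] by (simp add: inner_simps)
    show "((u - l) \<bullet> i) * ((u' - l') \<bullet> i) \<le> (((1/2) *\<^sub>R (u + u') - (1/2) *\<^sub>R (l + l')) \<bullet> i)\<^sup>2"
      using ag[of "(u - l) \<bullet> i" "(u' - l') \<bullet> i"] by (simp add: inner_simps add_divide_distrib diff_divide_distrib algebra_simps)
  qed
  also have "\<dots> = (measure lborel (box ((1/2) *\<^sub>R (l + l')) ((1/2) *\<^sub>R (u + u'))))\<^sup>2"
  proof -
    have "((1/2) *\<^sub>R (l + l')) \<bullet> i \<le> ((1/2) *\<^sub>R (u + u')) \<bullet> i" if "i \<in> Basis" for i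
      using pos[OF that] by (simp add: inner_simps)
    then show ?thesis by (simp add: measure_lborel_box_eq prod_power_distrib)
  qed
  also have "\<dots> \<le> (measure lborel (mid (box l u) (box l' u')))\<^sup>2"
    by (intro power_mono measure_lborel_mono mid_box assms borel_open open_mid bounded_mid) (auto simp: open_box bounded_box)
  finally show ?thesis .
qed

text \<open>A hyperplane \<open>b \<bullet> x = c\<close> with a whole box of \<open>\<A>\<close> on
  either side leaves fewer boxes in both halves of \<open>\<A>\<close>. Cutting \<open>\<B>\<close>
  by a parallel hyperplane at \<open>d\<close> in the same ratio \<open>r\<close> lets
  \<open>IH\<close> be applied to the lower and to the upper halves. The two midpoint sets lie on
  different sides of the hyperplane at \<open>(c + d) / 2\<close>, so their volumes, at least
  \<open>r * s\<close> and \<open>(1 - r) * s\<close>, add up to at least the geometric mean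
  \<open>s\<close>.\<close>

lemma mid_families_step:
  fixes \<A> \<B> :: "'a::euclidean_space set set"
  assumes \<A>: "box_family \<A>" and \<B>: "box_family \<B>" and two: "card \<A> \<ge> 2"
    and IH: "\<And>\<A>' \<B>'. box_family (\<A>' :: 'a set set) \<Longrightarrow> box_family \<B>' \<Longrightarrow> card \<A>' + card \<B>' < card \<A> + card \<B> \<Longrightarrow>
       measure lborel (\<Union>\<A>') * measure lborel (\<Union>\<B>') \<le> (measure lborel (mid (\<Union>\<A>') (\<Union>\<B>')))\<^sup>2"
  shows "measure lborel (\<Union>\<A>) * measure lborel (\<Union>\<B>) \<le> (measure lborel (mid (\<Union>\<A>) (\<Union>\<B>)))\<^sup>2"
proof -
  obtain Q1 Q2 where Q: "Q1 \<in> \<A>" "Q2 \<in> \<A>" "Q1 \<noteq> Q2"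
    using two by (metis One_nat_def Suc_1 card_le_Suc0_iff_eq not_less_eq_eq card.infinite le_zero_eq zero_neq_numeral)
  have QQ: "Q1 \<inter> Q2 = {}" "Q1 \<noteq> {}" "Q2 \<noteq> {}" using \<A> Q by (auto simp: box_family_def disjoint_def)
  obtain l u l' u' where lu: "Q1 = box l u" "Q2 = box l' u'" using \<A> Q unfolding box_family_def by metis
  \<comment> \<open>The names \<open>Q1\<close> and \<open>Q2\<close> are taken anew, exchanged if
    necessary so that \<open>Q1\<close> is on the upper side.\<close>
  obtain b c Q1 Q2 where b: "b \<in> Basis" and Q: "Q1 \<in> \<A>" "Q2 \<in> \<A>" "Q1 \<inter> {x. b \<bullet> x < c} = {}" "Q2 \<inter> {x. b \<bullet> x > c} = {}"
  proof (rule disjoint_boxes_separated[of l u l' u'])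
    show "box l u \<inter> box l' u' = {}" "box l u \<noteq> {}" "box l' u' \<noteq> {}" using QQ lu by auto
  next
    fix b c assume "b \<in> Basis" "box l u \<inter> {x. b \<bullet> x < c} = {}" "box l' u' \<inter> {x. b \<bullet> x > c} = {}"
    then show thesis using that Q lu by blast
  next
    fix b c assume "b \<in> Basis" "box l u \<inter> {x. b \<bullet> x > c} = {}" "box l' u' \<inter> {x. b \<bullet> x < c} = {}"
    then show thesis using that Q lu by blast
  qed
  have ob: "open Q" "Q \<noteq> {}" if "Q \<in> \<A>" for Q using \<A> that by (auto simp: box_family_def open_box)
  have b0: "b \<noteq> 0" using b by auto
  define A where "A = \<Union>\<A>"
  define B where "B = \<Union>\<B>"
  have A: "open A" "bounded A" "A \<in> sets borel" "measure lborel A > 0"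
    and B: "open B" "bounded B" "B \<in> sets borel" "measure lborel B > 0"
    using \<A> \<B> unfolding A_def B_def by (auto intro: box_family_open box_family_bounded box_family_pos borel_open)
  have strict: "\<not> Q \<subseteq> {x. b \<bullet> x = c}" if "Q \<in> \<A>" for Q
    using interior_hyperplane[OF b0, of c] interior_maximal[of Q "{x. b \<bullet> x = c}"] ob[OF that] by auto
  have ne: "A \<inter> {x. b \<bullet> x < c} \<noteq> {}" "A \<inter> {x. b \<bullet> x > c} \<noteq> {}"
  proof -
    show "A \<inter> {x. b \<bullet> x < c} \<noteq> {}" using strict[OF Q(2)] Q unfolding A_def by fastforce
    show "A \<inter> {x. b \<bullet> x > c} \<noteq> {}" using strict[OF Q(1)] Q unfolding A_def by fastforce
  qed
  obtain \<A>1 where A1: "box_family \<A>1" "\<Union>\<A>1 = A \<inter> {x. b \<bullet> x < c}" "card \<A>1 < card \<A>"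
    using box_family_cut[OF \<A> b, of "{x. b \<bullet> x < c}" c] ne Q unfolding A_def by metis
  obtain \<A>2 where A2: "box_family \<A>2" "\<Union>\<A>2 = A \<inter> {x. b \<bullet> x > c}" "card \<A>2 < card \<A>"
    using box_family_cut[OF \<A> b, of "{x. b \<bullet> x > c}" c] ne Q unfolding A_def by metis
  define a1 a2 where "a1 = measure lborel (\<Union>\<A>1)" and "a2 = measure lborel (\<Union>\<A>2)"
  have a: "a1 > 0" "a2 > 0"
    using box_family_pos[OF A1(1)] box_family_pos[OF A2(1)] unfolding a1_def a2_def by auto
  have aa: "a1 + a2 = measure lborel A"
    unfolding a1_def a2_def A1 A2 using A b0 by (intro measure_halfspace_cut)
  define r where "r = a1 / (a1 + a2)"
  have r: "0 < r" "r < 1" "1 - r = a2 / (a1 + a2)" using a by (auto simp: r_def field_simps)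
  obtain d where d: "measure lborel (B \<inter> {x. b \<bullet> x < d}) = r * measure lborel B"
    using measure_halfspace_ivt[OF B(3,2) b0, of "r * measure lborel B"] r B
    by (metis less_eq_real_def mult_le_cancel_right1 mult_nonneg_nonneg not_less)
  have d2: "measure lborel (B \<inter> {x. b \<bullet> x > d}) = (1 - r) * measure lborel B"
    using measure_halfspace_cut[OF B(3,2) b0, of d] d by (simp add: algebra_simps)
  have neB: "B \<inter> {x. b \<bullet> x < d} \<noteq> {}" "B \<inter> {x. b \<bullet> x > d} \<noteq> {}"
    using d d2 r B by (auto dest!: arg_cong[where f = "measure lborel"])
  obtain \<B>1 where B1: "box_family \<B>1" "\<Union>\<B>1 = B \<inter> {x. b \<bullet> x < d}" "card \<B>1 \<le> card \<B>"
    using box_family_cut[OF \<B> b, of "{x. b \<bullet> x < d}" d] neB unfolding B_def by metis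
  obtain \<B>2 where B2: "box_family \<B>2" "\<Union>\<B>2 = B \<inter> {x. b \<bullet> x > d}" "card \<B>2 \<le> card \<B>"
    using box_family_cut[OF \<B> b, of "{x. b \<bullet> x > d}" d] neB unfolding B_def by metis
  define M1 M2 where "M1 = mid (\<Union>\<A>1) (\<Union>\<B>1)" and "M2 = mid (\<Union>\<A>2) (\<Union>\<B>2)"
  define s where "s = sqrt (measure lborel A * measure lborel B)"
  have ss: "s * s = measure lborel A * measure lborel B" "s > 0" unfolding s_def using A B by auto
  have "(r * s)\<^sup>2 \<le> (measure lborel M1)\<^sup>2"
  proof -
    have "(r * s)\<^sup>2 = (r * measure lborel A) * (r * measure lborel B)"
      using ss by (simp add: power2_eq_square algebra_simps)
    also have "r * measure lborel A = a1" using a aa by (simp add: r_def aa[symmetric])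
    also have "a1 * (r * measure lborel B) = measure lborel (\<Union>\<A>1) * measure lborel (\<Union>\<B>1)"
      unfolding a1_def B1 d by simp
    also have "\<dots> \<le> (measure lborel M1)\<^sup>2" unfolding M1_def using A1 B1 by (intro IH) auto
    finally show ?thesis .
  qed
  then have m1: "r * s \<le> measure lborel M1" by (rule power2_le_imp_le) simp
  have "((1 - r) * s)\<^sup>2 \<le> (measure lborel M2)\<^sup>2"
  proof -
    have "((1 - r) * s)\<^sup>2 = ((1 - r) * measure lborel A) * ((1 - r) * measure lborel B)"
      using ss by (simp add: power2_eq_square algebra_simps)
    also have "(1 - r) * measure lborel A = a2" using a aa r by (simp add: aa[symmetric])
    also have "a2 * ((1 - r) * measure lborel B) = measure lborel (\<Union>\<A>2) * measure lborel (\<Union>\<B>2)"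
      unfolding a2_def B2 d2 by simp
    also have "\<dots> \<le> (measure lborel M2)\<^sup>2" unfolding M2_def using A2 B2 by (intro IH) auto
    finally show ?thesis .
  qed
  then have m2: "(1 - r) * s \<le> measure lborel M2" by (rule power2_le_imp_le) simp
  have "M1 \<inter> M2 = {}"
  proof -
    have "b \<bullet> x < (c + d) / 2" if "x \<in> M1" for x
      using that unfolding M1_def A1 B1 mid_def by (auto simp: inner_simps)
    moreover have "b \<bullet> x > (c + d) / 2" if "x \<in> M2" for x
      using that unfolding M2_def A2 B2 mid_def by (auto simp: inner_simps)
    ultimately show ?thesis by fastforce
  qed
  moreover have "open M1" "open M2" unfolding M1_def M2_def using box_family_open[OF A1(1)] box_family_open[OF A2(1)] by (auto intro: open_mid)
  moreover have "M1 \<subseteq> mid A B" "M2 \<subseteq> mid A B" unfolding M1_def M2_def A1 A2 B1 B2 by (intro mid_mono; blast)+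
  ultimately have "measure lborel M1 + measure lborel M2 \<le> measure lborel (mid A B)"
    using A B by (intro measure_lborel_disjoint) (auto intro!: borel_open open_mid bounded_mid)
  then have "s \<le> measure lborel (mid A B)" using m1 m2 by (simp add: algebra_simps)
  then have "s\<^sup>2 \<le> (measure lborel (mid A B))\<^sup>2" using ss by (intro power_mono) auto
  then show ?thesis unfolding A_def[symmetric] B_def[symmetric] ss(1)[symmetric] power2_eq_square .
qed

text \<open>Brunn--Minkowski in multiplicative form, by the induction of Hadwiger and Ohmann on the number of boxes.\<close>

lemma mid_families:
  fixes \<A> \<B> :: "'a::euclidean_space set set"
  assumes "box_family \<A>" "box_family \<B>"
  shows "measure lborel (\<Union>\<A>) * measure lborel (\<Union>\<B>) \<le> (measure lborel (mid (\<Union>\<A>) (\<Union>\<B>)))\<^sup>2"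
  using assms
proof (induction "card \<A> + card \<B>" arbitrary: \<A> \<B> rule: less_induct)
  case less
  have c: "card \<A> \<ge> 1" "card \<B> \<ge> 1"
    using less.prems by (auto simp: box_family_def Suc_le_eq card_gt_0_iff)
  consider "card \<A> \<ge> 2" | "card \<B> \<ge> 2" | "card \<A> = 1" "card \<B> = 1" using c by linarith
  then show ?case
  proof cases
    case 1
    show ?thesis by (rule mid_families_step[OF less.prems 1]) (rule less.hyps)
  next
    case 2
    have "measure lborel (\<Union>\<B>) * measure lborel (\<Union>\<A>) \<le> (measure lborel (mid (\<Union>\<B>) (\<Union>\<A>)))\<^sup>2"
      by (rule mid_families_step[OF less.prems(2,1) 2]) (rule less.hyps, simp_all)
    then show ?thesis by (simp add: mult.commute mid_commute)
  next
    case 3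
    then obtain Q R where QR: "\<A> = {Q}" "\<B> = {R}" by (auto simp: card_1_singleton_iff)
    have "Q \<noteq> {}" "R \<noteq> {}" "\<exists>l u. Q = box l u" "\<exists>l u. R = box l u"
      using less.prems unfolding QR box_family_def by simp_all
    then show ?thesis using mid_box_measure unfolding QR by (metis cSup_singleton)
  qed
qed

section \<open>Hausdorff measure and Lebesgue measure\<close>

lemma emeasure_lborel_uminus:
  fixes A :: "'a::euclidean_space set"
  assumes "A \<in> sets borel"
  shows "emeasure lborel (uminus ` A) = emeasure lborel A"
proof -
  have eq: "uminus ` A = uminus -` A"
    by (force simp: image_iff)
  have "lborel = density (distr lborel borel (\<lambda>x::'a. 0 + (-1) *\<^sub>R x)) (\<lambda>_. ennreal (\<bar>-1\<bar>^DIM('a)))"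
    by (rule lborel_affine) simp
  then have "lborel = distr lborel borel (uminus :: 'a \<Rightarrow> 'a)"
    by (simp add: density_1)
  then have "emeasure lborel A = emeasure (distr lborel borel (uminus :: 'a \<Rightarrow> 'a)) A" by simp
  also have "\<dots> = emeasure lborel (uminus -` A)"
    using assms by (subst emeasure_distr) auto
  finally show ?thesis by (simp add: eq)
qed

lemma box_family_uminus:
  fixes \<A> :: "'a::euclidean_space set set"
  assumes "box_family \<A>"
  shows "box_family ((`) uminus ` \<A>)"
proof -
  have "uminus ` box l u = box (- u) (- l)" for l u :: 'a
  proof -
    have "x \<in> uminus ` box l u \<longleftrightarrow> - x \<in> box l u" for x by (force simp: image_iff)
    then show ?thesis by (auto simp: box_def) (metis minus_less_iff neg_less_iff_less less_minus_iff)+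
  qed
  then have "\<exists>l u. uminus ` Q = box l u" if "Q \<in> \<A>" for Q
    using assms that unfolding box_family_def by metis
  moreover have "disjoint ((`) uminus ` \<A>)"
    unfolding disjoint_def
  proof (intro ballI impI)
    fix X Y assume "X \<in> (`) uminus ` \<A>" "Y \<in> (`) uminus ` \<A>" "X \<noteq> Y"
    then obtain Q R where QR: "X = uminus ` Q" "Y = uminus ` R" "Q \<in> \<A>" "R \<in> \<A>" "Q \<noteq> R" by blast
    then have "Q \<inter> R = {}" using assms unfolding box_family_def disjoint_def by blast
    then show "X \<inter> Y = {}" using QR by auto
  qed
  moreover have "finite \<A>" "\<A> \<noteq> {}" "\<forall>Q\<in>\<A>. Q \<noteq> {}" using assms by (auto simp: box_family_def)
  ultimately show ?thesis
    unfolding box_family_def by simp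
qed

text \<open>Finitely many small boxes around points of \<open>K\<close> are refined to a division
  without overlaps, and taking interiors loses only a null set. The positive measure of
  \<open>K\<close> keeps the family nonempty.\<close>

lemma compact_box_approx:
  fixes K :: "'a::euclidean_space set"
  assumes K: "compact K" and e: "e > 0" and pos: "measure lborel K > 0"
  obtains \<A> where "box_family \<A>" "measure lborel K \<le> measure lborel (\<Union>\<A>)"
    "\<And>x. x \<in> \<Union>\<A> \<Longrightarrow> \<exists>y\<in>K. dist x y \<le> e"
proof -
  have "\<forall>x::'a. \<exists>a b. x \<in> box a b \<and> box a b \<subseteq> ball x e"
    using rational_boxes[OF e] by metis
  then obtain a b :: "'a \<Rightarrow> 'a" where ab: "\<And>x. x \<in> box (a x) (b x)" "\<And>x. box (a x) (b x) \<subseteq> ball x e" by metis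
  have cb: "cbox (a x) (b x) \<subseteq> cball x e" for x
  proof -
    have "cbox (a x) (b x) = closure (box (a x) (b x))" using ab(1)[of x] by (intro closure_box[symmetric]) auto
    also have "\<dots> \<subseteq> closure (ball x e)" using ab(2) by (rule closure_mono)
    finally show ?thesis using e by simp
  qed
  obtain T where T: "T \<subseteq> K" "finite T" "K \<subseteq> (\<Union>x\<in>T. box (a x) (b x))"
  proof (rule compactE_image[OF K, of K "\<lambda>x. box (a x) (b x)"])
    show "K \<subseteq> (\<Union>x\<in>K. box (a x) (b x))" using ab(1) by blast
  qed (auto simp: open_box)
  define F where "F = (\<lambda>x. cbox (a x) (b x)) ` T"
  obtain p where p: "p division_of \<Union>F"
  proof (rule elementary_unions_intervals)
    show "finite F" using T(2) by (simp add: F_def)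
    show "\<exists>l u. s = cbox l u" if "s \<in> F" for s using that by (auto simp: F_def)
  qed
  define \<A> where "\<A> = interior ` p - {{}}"
  have fp: "finite p" using p by auto
  have pbox: "\<exists>l u. k = cbox l u" if "k \<in> p" for k using division_ofD(4)[OF p that] by blast
  have KF: "K \<subseteq> \<Union>F" using T box_subset_cbox unfolding F_def by blast
  have null: "(\<Union>k\<in>p. k - interior k) \<in> null_sets lborel"
  proof (rule null_sets.finite_UN[OF fp])
    fix k assume "k \<in> p"
    then obtain l u where "k = cbox l u" using pbox by blast
    then show "k - interior k \<in> null_sets lborel" using null_sets_cbox_Diff_box by (simp add: interior_cbox)
  qed
  have op: "open (\<Union>\<A>)" unfolding \<A>_def by auto
  have bd: "bounded (\<Union>\<A>)"
  proof (rule bounded_subset)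
    show "bounded (\<Union>F)" using elementary_bounded[OF p] by simp
    have "\<Union>\<A> \<subseteq> \<Union>p" unfolding \<A>_def using interior_subset by fast
    then show "\<Union>\<A> \<subseteq> \<Union>F" using division_ofD(6)[OF p] by simp
  qed
  have "emeasure lborel K \<le> emeasure lborel (\<Union>\<A> \<union> (\<Union>k\<in>p. k - interior k))"
  proof (rule emeasure_mono)
    show "K \<subseteq> \<Union>\<A> \<union> (\<Union>k\<in>p. k - interior k)"
    proof
      fix x assume "x \<in> K"
      then have "x \<in> \<Union>p" using KF division_ofD(6)[OF p] by blast
      then obtain k where "k \<in> p" "x \<in> k" by blast
      then show "x \<in> \<Union>\<A> \<union> (\<Union>k\<in>p. k - interior k)" unfolding \<A>_def by blast
    qed
    show "\<Union>\<A> \<union> (\<Union>k\<in>p. k - interior k) \<in> sets lborel" using null op by auto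
  qed
  also have "\<dots> = emeasure lborel (\<Union>\<A>)" using null op by (intro emeasure_Un_null_set) auto
  finally have le: "measure lborel K \<le> measure lborel (\<Union>\<A>)"
    unfolding measure_def using emeasure_bounded_finite[OF bd] by (intro enn2real_mono) auto
  have "disjoint \<A>"
    unfolding disjoint_def
  proof (intro ballI impI)
    fix X Y assume "X \<in> \<A>" "Y \<in> \<A>" "X \<noteq> Y"
    then obtain Q R where "X = interior Q" "Y = interior R" "Q \<in> p" "R \<in> p" "Q \<noteq> R" unfolding \<A>_def by blast
    then show "X \<inter> Y = {}" using division_ofD(5)[OF p] by simp
  qed
  moreover have "\<A> \<noteq> {}" using le pos by auto
  moreover have "\<exists>l u. Q = box l u" if Q: "Q \<in> \<A>" for Q
  proof -
    obtain k where "k \<in> p" "Q = interior k" using Q unfolding \<A>_def by auto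
    then show ?thesis using pbox[of k] interior_cbox by metis
  qed
  moreover have "finite \<A>" "\<forall>Q\<in>\<A>. Q \<noteq> {}" using fp by (auto simp: \<A>_def)
  ultimately have bf: "box_family \<A>" unfolding box_family_def by simp
  have "\<exists>y\<in>K. dist x y \<le> e" if "x \<in> \<Union>\<A>" for x
  proof -
    have "\<Union>\<A> \<subseteq> \<Union>p" unfolding \<A>_def using interior_subset by fast
    then have "x \<in> \<Union>F" using division_ofD(6)[OF p] that by auto
    then obtain y where "y \<in> T" "x \<in> cbox (a y) (b y)" unfolding F_def by blast
    then have "y \<in> K" "x \<in> cball y e" using cb[of y] T(1) by blast+
    then show ?thesis by (intro bexI[of _ y]) (auto simp: dist_commute)
  qed
  with bf le show ?thesis by (rule that)
qed

text \<open>A set of diameter \<open>d\<close> need not fit into a ball of radius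
  \<open>d / 2\<close>, but the half differences of its points do, and these form the midpoint set
  of \<open>A\<close> and its reflection, two sets of equal volume. Brunn--Minkowski bounds their
  volume by that of the midpoint set. Points of the box approximation are within \<open>e\<close> of
  \<open>K\<close>, which enlarges the radius by \<open>e\<close>.\<close>

lemma isodiametric_compact:
  fixes K :: "'a::euclidean_space set"
  assumes K: "compact K" and d: "diameter K \<le> d"
  shows "measure lborel K \<le> unit_ball_vol (DIM('a)) * (d / 2) ^ DIM('a)"
proof (cases "measure lborel K > 0")
  case True
  have d0: "0 \<le> d" using d diameter_ge_0[OF compact_imp_bounded[OF K]] by linarith
  have le: "measure lborel K \<le> unit_ball_vol (DIM('a)) * (d / 2 + e) ^ DIM('a)" if e: "e > 0" for e
  proof -
    obtain \<A> where \<A>: "box_family \<A>" "measure lborel K \<le> measure lborel (\<Union>\<A>)"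
      and near: "\<And>x. x \<in> \<Union>\<A> \<Longrightarrow> \<exists>y\<in>K. dist x y \<le> e"
      using compact_box_approx[OF K e True] by blast
    define A where "A = \<Union>\<A>"
    have U: "\<Union>((`) uminus ` \<A>) = uminus ` A" unfolding A_def by blast
    have "mid A (uminus ` A) \<subseteq> cball 0 (d / 2 + e)"
    proof
      fix z assume "z \<in> mid A (uminus ` A)"
      then obtain x y where xy: "x \<in> A" "y \<in> A" "z = (1/2) *\<^sub>R (x - y)" unfolding mid_def by auto
      obtain x' y' where x'y': "x' \<in> K" "y' \<in> K" "dist x x' \<le> e" "dist y y' \<le> e" using near xy unfolding A_def by metis
      have "dist x' y' \<le> d" using diameter_bounded_bound[OF compact_imp_bounded[OF K] x'y'(1,2)] d by linarith
      then have "norm (x - y) \<le> d + 2 * e" using x'y'(3,4) dist_triangle[of x y x'] dist_triangle[of x' y y']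
        by (simp add: dist_norm[symmetric] dist_commute)
      then show "z \<in> cball 0 (d / 2 + e)" using xy by simp
    qed
    then have "measure lborel (mid A (uminus ` A)) \<le> measure lborel (cball (0::'a) (d / 2 + e))"
      by (intro measure_lborel_mono) auto
    also have "\<dots> = unit_ball_vol (DIM('a)) * (d / 2 + e) ^ DIM('a)"
      using content_cball[of "d / 2 + e" "0::'a"] d0 e by simp
    finally have m: "measure lborel (mid A (uminus ` A)) \<le> unit_ball_vol (DIM('a)) * (d / 2 + e) ^ DIM('a)" .
    have "measure lborel (uminus ` A) = measure lborel A"
      using emeasure_lborel_uminus[of A] box_family_open[OF \<A>(1)] by (simp add: measure_def A_def)
    then have "(measure lborel A)\<^sup>2 \<le> (measure lborel (mid A (uminus ` A)))\<^sup>2"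
      using mid_families[OF \<A>(1) box_family_uminus[OF \<A>(1)]] unfolding U A_def[symmetric] by (simp add: power2_eq_square)
    then have "measure lborel A \<le> measure lborel (mid A (uminus ` A))" by (rule power2_le_imp_le) simp
    then show ?thesis using m \<A>(2) unfolding A_def by linarith
  qed
  have lim: "(\<lambda>n. unit_ball_vol (DIM('a)) * (d / 2 + 1 / real (Suc n)) ^ DIM('a)) \<longlonglongrightarrow> unit_ball_vol (DIM('a)) * (d / 2 + 0) ^ DIM('a)"
    by (intro tendsto_intros LIMSEQ_Suc lim_const_over_n)
  show ?thesis
    using LIMSEQ_le_const[OF lim, of "measure lborel K"] le by simp
next
  case False
  have "0 \<le> d" using d diameter_ge_0[OF compact_imp_bounded[OF K]] by linarith
  then show ?thesis using False by (smt (verit) divide_nonneg_nonneg mult_nonneg_nonneg of_nat_0_le_iff unit_ball_vol_nonneg zero_le_power)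
qed

text \<open>Covers consist of arbitrary sets; passing to the closure makes them measurable and keeps
  the diameter.\<close>

lemma emeasure_le_hausdorff_gauge:
  fixes C :: "'a::euclidean_space set"
  assumes "bounded C"
  shows "emeasure lborel (closure C) \<le> hausdorff_gauge DIM('a) C"
proof (cases "C = {}")
  case False
  have c: "compact (closure C)" using assms by (simp add: compact_closure)
  have "emeasure lborel (closure C) = ennreal (measure lborel (closure C))"
    using emeasure_compact_finite[OF c] by (intro emeasure_eq_ennreal_measure) auto
  also have "\<dots> \<le> ennreal (unit_ball_vol (DIM('a)) * (diameter C / 2) ^ DIM('a))"
    using isodiametric_compact[OF c, of "diameter C"] assms by (intro ennreal_leI) (simp add: diameter_closure)
  finally show ?thesis using False by (simp add: hausdorff_gauge_def)
qed (simp add: hausdorff_gauge_def)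

lemma lborel_le_hausdorff:
  fixes A :: "'a::euclidean_space set"
  assumes "A \<in> sets borel"
  shows "emeasure lborel A \<le> hausdorff_outer DIM('a) A"
proof -
  \<comment> \<open>The scale 1 is an arbitrary choice, as the isodiametric inequality holds for
    sets of every size.\<close>
  have "emeasure lborel A \<le> hausdorff_pre DIM('a) 1 A"
    unfolding hausdorff_pre_def
  proof (rule INF_greatest, safe)
    fix C :: "nat \<Rightarrow> 'a set"
    assume C: "\<forall>i. bounded (C i) \<and> diameter (C i) \<le> 1" and sub: "A \<subseteq> (\<Union>i. C i)"
    have "(\<Union>i. C i) \<subseteq> (\<Union>i. closure (C i))" by (rule UN_mono) (auto intro: closure_subset[THEN subsetD])
    then have "emeasure lborel A \<le> emeasure lborel (\<Union>i. closure (C i))"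
      using sub by (intro emeasure_mono) auto
    also have "\<dots> \<le> (\<Sum>i. emeasure lborel (closure (C i)))"
      by (intro emeasure_subadditive_countably) auto
    also have "\<dots> \<le> (\<Sum>i. hausdorff_gauge DIM('a) (C i))"
      using C by (intro suminf_le emeasure_le_hausdorff_gauge) auto
    finally show "emeasure lborel A \<le> (\<Sum>i. hausdorff_gauge DIM('a) (C i))" .
  qed
  also have "\<dots> \<le> hausdorff_outer DIM('a) A" by (intro hausdorff_pre_le_outer) simp
  finally show ?thesis .
qed

section \<open>Vitali coverings; Lebesgue measure as an upper bound for Hausdorff measure\<close>

lemma hausdorff_pre_Un:
  assumes "\<delta> > 0"
  shows "hausdorff_pre m \<delta> (A \<union> B) \<le> hausdorff_pre m \<delta> A + hausdorff_pre m \<delta> B"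
proof -
  let ?F = "\<lambda>i::nat. if i = 0 then A else if i = 1 then B else {}"
  have "(\<Union>i. ?F i) = A \<union> B" by (auto split: if_splits)
  moreover have "(\<Sum>i. hausdorff_pre m \<delta> (?F i)) = (\<Sum>i\<in>{0, 1::nat}. hausdorff_pre m \<delta> (?F i))"
    by (rule suminf_finite) (auto simp: hausdorff_pre_empty[OF assms])
  ultimately show ?thesis using hausdorff_pre_subadditive[of m \<delta> ?F] by simp
qed

text \<open>The definition admits only sequences of sets; a countable family is padded with empty
  sets, whose gauge is 0.\<close>

lemma hausdorff_pre_le_countable:
  assumes I: "countable I" and A: "A \<subseteq> (\<Union>i\<in>I. C i)" and \<delta>: "\<delta> > 0"
    and C: "\<And>i. i \<in> I \<Longrightarrow> bounded (C i) \<and> diameter (C i) \<le> \<delta>"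
  shows "hausdorff_pre m \<delta> A \<le> (\<integral>\<^sup>+i. hausdorff_gauge m (C i) \<partial>count_space I)"
proof -
  define J where "J = to_nat_on I ` I"
  define D where "D n = (if n \<in> J then C (from_nat_into I n) else {})" for n
  have "A \<subseteq> (\<Union>n. D n)"
  proof
    fix x assume "x \<in> A"
    then obtain i where "i \<in> I" "x \<in> C i" using A by blast
    then have "x \<in> D (to_nat_on I i)" using I by (simp add: D_def J_def)
    then show "x \<in> (\<Union>n. D n)" by blast
  qed
  moreover have "bounded (D n) \<and> diameter (D n) \<le> \<delta>" for n
    using C I \<delta> by (auto simp: D_def J_def)
  ultimately have "hausdorff_pre m \<delta> A \<le> (\<Sum>n. hausdorff_gauge m (D n))"
    unfolding hausdorff_pre_def by (intro INF_lower) auto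
  also have "\<dots> = (\<integral>\<^sup>+n. hausdorff_gauge m (D n) \<partial>count_space UNIV)"
    by (simp add: nn_integral_count_space_nat)
  also have "\<dots> = (\<integral>\<^sup>+n. hausdorff_gauge m (C (from_nat_into I n)) \<partial>count_space J)"
    by (subst nn_integral_count_space_indicator) (auto intro!: nn_integral_cong simp: D_def hausdorff_gauge_def indicator_def)
  also have "\<dots> = (\<integral>\<^sup>+i. hausdorff_gauge m (C (from_nat_into I (to_nat_on I i))) \<partial>count_space I)"
    using I by (subst nn_integral_bij_count_space[of "to_nat_on I" I J, symmetric]) (auto simp: J_def intro: inj_on_imp_bij_betw)
  also have "\<dots> = (\<integral>\<^sup>+i. hausdorff_gauge m (C i) \<partial>count_space I)"
    using I by (intro nn_integral_cong) simp
  finally show ?thesis .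
qed

lemma hausdorff_gauge_cball:
  "r > 0 \<Longrightarrow> hausdorff_gauge DIM('a) (cball (a::'a::euclidean_space) r) = emeasure lborel (cball a r)"
  by (simp add: hausdorff_gauge_def emeasure_cball)

lemma emeasure_cball_UN_le:
  fixes a :: "'i \<Rightarrow> 'a::euclidean_space"
  assumes "countable I" "pairwise (\<lambda>i j. disjnt (cball (a i) (r i)) (cball (a j) (r j))) I"
    and "\<And>i. i \<in> I \<Longrightarrow> cball (a i) (r i) \<subseteq> U" "U \<in> sets borel"
  shows "(\<integral>\<^sup>+i. emeasure lborel (cball (a i) (r i)) \<partial>count_space I) \<le> emeasure lborel U"
proof -
  have "(\<integral>\<^sup>+i. emeasure lborel (cball (a i) (r i)) \<partial>count_space I) = emeasure lborel (\<Union>i\<in>I. cball (a i) (r i))"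
    using assms by (intro emeasure_UN_countable[symmetric])
      (auto simp: disjoint_family_on_def pairwise_def disjnt_def)
  also have "\<dots> \<le> emeasure lborel U" using assms by (intro emeasure_mono) auto
  finally show ?thesis .
qed

text \<open>Handles the null remainder that Vitali's covering theorem leaves in
  \<open>hausdorff_le_lborel\<close>. The cruder covering lemma suffices for it: fivefold balls
  cover all of \<open>N\<close>, and \<open>e'\<close> compensates for their larger volume.\<close>

lemma hausdorff_pre_null:
  fixes N :: "'a::euclidean_space set"
  assumes N: "negligible N" and \<delta>: "\<delta> > 0"
  shows "hausdorff_pre DIM('a) \<delta> N = 0"
proof -
  have le: "hausdorff_pre DIM('a) \<delta> N \<le> 0 + ennreal e" if e: "e > 0" for e
  proof -
    define e' where "e' = e / 5 ^ DIM('a)"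
    have e': "e' > 0" using e by (simp add: e'_def)
    obtain U where U: "open U" "N \<subseteq> U" "emeasure lebesgue (U - N) < ennreal e'"
      using sets_lebesgue_outer_open[OF negligible_imp_sets[OF N] e'] by metis
    have "emeasure lebesgue U = emeasure lebesgue (U - N)"
      using N U by (intro emeasure_Diff_null_set[symmetric]) (auto simp: negligible_iff_null_sets)
    then have Ue: "emeasure lborel U \<le> ennreal e'" using U by (simp add: emeasure_completion)
    \<comment> \<open>Radii up to \<open>\<delta> / 10\<close> give the fivefold balls a diameter of
      at most \<open>\<delta>\<close>.\<close>
    define K where "K = {(x, r). x \<in> N \<and> 0 < r \<and> r \<le> \<delta> / 10 \<and> cball x r \<subseteq> U}"
    have "\<exists>r. (x, r) \<in> K" if x: "x \<in> N" for x
    proof -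
      obtain s where s: "s > 0" "cball x s \<subseteq> U" using U x open_contains_cball by blast
      then have "(x, min s (\<delta> / 10)) \<in> K" using x \<delta> unfolding K_def by auto
      then show ?thesis by blast
    qed
    then have cov: "N \<subseteq> (\<Union>i\<in>K. cball (fst i) (snd i))" by (force simp: K_def)
    have rad: "0 < snd i \<and> snd i \<le> \<delta> / 10" if "i \<in> K" for i using that by (auto simp: K_def)
    obtain C where C: "countable C" "C \<subseteq> K"
      "pairwise (\<lambda>i j. disjnt (cball (fst i) (snd i)) (cball (fst j) (snd j))) C"
      "N \<subseteq> (\<Union>i\<in>C. cball (fst i) (5 * snd i))"
      by (rule Vitali_covering_lemma_cballs[OF cov rad])
    have pos: "0 < snd i" "snd i \<le> \<delta> / 10" if "i \<in> C" for i using C(2) that by (auto simp: K_def)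
    have sub: "cball (fst i) (snd i) \<subseteq> U" if "i \<in> C" for i
      using subsetD[OF C(2) that] by (simp add: K_def case_prod_unfold)
    have "hausdorff_pre DIM('a) \<delta> N \<le> (\<integral>\<^sup>+i. hausdorff_gauge DIM('a) (cball (fst i) (5 * snd i)) \<partial>count_space C)"
    proof (rule hausdorff_pre_le_countable[OF C(1,4) \<delta>])
      fix i assume "i \<in> C"
      then show "bounded (cball (fst i) (5 * snd i)) \<and> diameter (cball (fst i) (5 * snd i)) \<le> \<delta>"
        using pos[of i] by simp
    qed
    also have "\<dots> = (\<integral>\<^sup>+i. ennreal (5 ^ DIM('a)) * emeasure lborel (cball (fst i) (snd i)) \<partial>count_space C)"
    proof (intro nn_integral_cong)
      fix i assume "i \<in> space (count_space C)"
      then have "0 < snd i" using pos by auto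
      then show "hausdorff_gauge DIM('a) (cball (fst i) (5 * snd i)) = ennreal (5 ^ DIM('a)) * emeasure lborel (cball (fst i) (snd i))"
        by (simp add: hausdorff_gauge_cball emeasure_cball ennreal_mult[symmetric] power_mult_distrib mult_ac del: ennreal_power)
    qed
    also have "\<dots> = ennreal (5 ^ DIM('a)) * (\<integral>\<^sup>+i. emeasure lborel (cball (fst i) (snd i)) \<partial>count_space C)"
      by (intro nn_integral_cmult) auto
    also have "\<dots> \<le> ennreal (5 ^ DIM('a)) * emeasure lborel U"
      using sub U by (intro mult_left_mono emeasure_cball_UN_le C(1,3)) auto
    also have "\<dots> \<le> ennreal (5 ^ DIM('a)) * ennreal e'" using Ue by (rule mult_left_mono) simp
    also have "ennreal (5 ^ DIM('a)) * ennreal e' = ennreal e"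
      using e by (simp add: ennreal_mult[symmetric] e'_def del: ennreal_power)
    finally show ?thesis by simp
  qed
  have "hausdorff_pre DIM('a) \<delta> N \<le> 0" by (rule ennreal_le_epsilon) (rule le)
  then show ?thesis by simp
qed

lemma hausdorff_outer_null:
  fixes N :: "'a::euclidean_space set"
  assumes "negligible N"
  shows "hausdorff_outer DIM('a) N = 0"
  unfolding hausdorff_outer_def using hausdorff_pre_null[OF assms] by simp

text \<open>For balls the gauge equals the volume. Small disjoint balls that exhaust
  \<open>A\<close> up to a null set and stay inside an open \<open>U\<close>, with
  \<open>U - A\<close> small, therefore form a cover whose cost exceeds the volume of
  \<open>A\<close> by at most \<open>e\<close>.\<close>

lemma hausdorff_le_lborel:
  fixes A :: "'a::euclidean_space set"
  assumes A: "A \<in> sets borel"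
  shows "hausdorff_outer DIM('a) A \<le> emeasure lborel A"
  unfolding hausdorff_outer_def
proof (rule SUP_least)
  fix \<delta> :: real assume "\<delta> \<in> {0<..}"
  then have \<delta>: "\<delta> > 0" by simp
  show "hausdorff_pre DIM('a) \<delta> A \<le> emeasure lborel A"
  proof (rule ennreal_le_epsilon)
    fix e :: real assume e: "e > 0"
    obtain U where U: "open U" "A \<subseteq> U" "emeasure lborel (U - A) < ennreal e"
      using outer_regular_lborel[OF A, of e] e by auto
    define K where "K = {(x, r). x \<in> A \<and> 0 < r \<and> r \<le> \<delta> / 2 \<and> cball x r \<subseteq> U}"
    have "\<exists>i. i \<in> K \<and> x \<in> cball (fst i) (snd i) \<and> snd i < d" if x: "x \<in> A" and d: "d > 0" for x d
    proof -
      obtain s where s: "s > 0" "cball x s \<subseteq> U" using U x open_contains_cball by blast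
      then have "(x, min s (min (\<delta> / 2) (d / 2))) \<in> K" using x d \<delta> unfolding K_def by auto
      moreover have "x \<in> cball x (min s (min (\<delta> / 2) (d / 2)))" using s d \<delta> by simp
      moreover have "min s (min (\<delta> / 2) (d / 2)) < d" using d by linarith
      ultimately show ?thesis by (intro exI[of _ "(x, min s (min (\<delta> / 2) (d / 2)))"]) simp
    qed
    note cov = this
    have rad: "0 < snd i" if "i \<in> K" for i using that by (auto simp: K_def)
    obtain C where C: "countable C" "C \<subseteq> K"
      "pairwise (\<lambda>i j. disjnt (cball (fst i) (snd i)) (cball (fst j) (snd j))) C"
      "negligible (A - (\<Union>i\<in>C. cball (fst i) (snd i)))"
      by (rule Vitali_covering_theorem_cballs[of K snd A fst, OF rad cov])
    have pos: "0 < snd i" "snd i \<le> \<delta> / 2" if "i \<in> C" for i using C(2) that by (auto simp: K_def)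
    have sub: "cball (fst i) (snd i) \<subseteq> U" if "i \<in> C" for i
      using subsetD[OF C(2) that] by (simp add: K_def case_prod_unfold)
    have "hausdorff_pre DIM('a) \<delta> A \<le> hausdorff_pre DIM('a) \<delta> ((\<Union>i\<in>C. cball (fst i) (snd i)) \<union> (A - (\<Union>i\<in>C. cball (fst i) (snd i))))"
      by (intro hausdorff_pre_mono) auto
    also have "\<dots> \<le> hausdorff_pre DIM('a) \<delta> (\<Union>i\<in>C. cball (fst i) (snd i))"
      using hausdorff_pre_Un[OF \<delta>, of "DIM('a)" "\<Union>i\<in>C. cball (fst i) (snd i)" "A - (\<Union>i\<in>C. cball (fst i) (snd i))"]
        hausdorff_pre_null[OF C(4) \<delta>] by simp
    also have "\<dots> \<le> (\<integral>\<^sup>+i. hausdorff_gauge DIM('a) (cball (fst i) (snd i)) \<partial>count_space C)"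
    proof (rule hausdorff_pre_le_countable[OF C(1) order_refl \<delta>])
      fix i assume "i \<in> C"
      then show "bounded (cball (fst i) (snd i)) \<and> diameter (cball (fst i) (snd i)) \<le> \<delta>"
        using pos[of i] by simp
    qed
    also have "\<dots> = (\<integral>\<^sup>+i. emeasure lborel (cball (fst i) (snd i)) \<partial>count_space C)"
      using pos by (intro nn_integral_cong hausdorff_gauge_cball) auto
    also have "\<dots> \<le> emeasure lborel U"
      using sub U by (intro emeasure_cball_UN_le C(1,3)) auto
    also have "\<dots> = emeasure lborel A + emeasure lborel (U - A)"
      using U A by (subst plus_emeasure) (auto simp: Un_absorb1)
    also have "\<dots> \<le> emeasure lborel A + ennreal e" using U by (intro add_left_mono) auto
    finally show "hausdorff_pre DIM('a) \<delta> A \<le> emeasure lborel A + ennreal e" .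
  qed
qed

theorem hausdorff_measure_eq_lborel: "hausdorff_measure DIM('a) = (lborel :: 'a::euclidean_space measure)"
  by (rule measure_eqI) (auto simp: emeasure_hausdorff_measure intro!: antisym lborel_le_hausdorff hausdorff_le_lborel)

lemma hausdorff_outer_eq_lborel:
  "A \<in> sets borel \<Longrightarrow> hausdorff_outer DIM('a) A = emeasure lborel (A :: 'a::euclidean_space set)"
  by (intro antisym lborel_le_hausdorff hausdorff_le_lborel)

section \<open>Lipschitz maps and density points\<close>

text \<open>Comparing two maps on a common parameter set avoids inverse maps: a cover of the image
  of \<open>h\<close> is pulled back to \<open>X\<close> and pushed forward by
  \<open>g\<close>.\<close>

lemma hausdorff_outer_lipschitz:
  fixes g :: "'x \<Rightarrow> 'c::metric_space" and h :: "'x \<Rightarrow> 'd::metric_space"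
  assumes L: "L > 0" and lip: "\<And>x y. x \<in> X \<Longrightarrow> y \<in> X \<Longrightarrow> dist (g x) (g y) \<le> L * dist (h x) (h y)"
  shows "hausdorff_outer m (g ` X) \<le> ennreal (L ^ m) * hausdorff_outer m (h ` X)"
proof -
  define c where "c = L ^ m"
  have c: "c > 0" using L by (simp add: c_def)
  have cancel: "ennreal (1 / c) * (ennreal c * s) = s" for s
    using c by (simp add: mult.assoc[symmetric] ennreal_mult[symmetric])
  have "hausdorff_pre m \<delta> (g ` X) \<le> ennreal c * hausdorff_outer m (h ` X)" if \<delta>: "\<delta> > 0" for \<delta>
  proof -
    \<comment> \<open>Dividing by \<open>c\<close> first leaves the infimum alone on the right,
      where each cover can be treated by itself.\<close>
    have "ennreal (1 / c) * hausdorff_pre m \<delta> (g ` X) \<le> hausdorff_pre m (\<delta> / L) (h ` X)"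
      unfolding hausdorff_pre_def[of m "\<delta> / L"]
    proof (rule INF_greatest, safe)
      fix C :: "nat \<Rightarrow> 'd set"
      assume C: "\<forall>i. bounded (C i) \<and> diameter (C i) \<le> \<delta> / L" and sub: "h ` X \<subseteq> (\<Union>i. C i)"
      define D where "D = (\<lambda>i. g ` (X \<inter> h -` C i))"
      have D: "bounded (D i) \<and> diameter (D i) \<le> L * diameter (C i)" for i
      proof -
        have 1: "dist x y \<le> L * diameter (C i)" if "x \<in> D i" "y \<in> D i" for x y
        proof -
          obtain u v where uv: "x = g u" "y = g v" "u \<in> X" "v \<in> X" "h u \<in> C i" "h v \<in> C i"
            using \<open>x \<in> D i\<close> \<open>y \<in> D i\<close> unfolding D_def by blast
          have "dist x y \<le> L * dist (h u) (h v)" using lip uv by simp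
          also have "\<dots> \<le> L * diameter (C i)"
            using C uv L by (intro mult_left_mono diameter_bounded_bound) auto
          finally show ?thesis .
        qed
        have "bounded (D i)" unfolding bounded_two_points using 1 by blast
        moreover have "diameter (D i) \<le> L * diameter (C i)"
        proof (cases "D i = {}")
          case True
          then show ?thesis using C L diameter_ge_0[of "C i"] by simp
        next
          case False
          then show ?thesis using 1 unfolding diameter_def[of "D i"] by (auto intro!: cSUP_least)
        qed
        ultimately show ?thesis by blast
      qed
      have Dd: "diameter (D i) \<le> \<delta>" for i
      proof -
        have "L * diameter (C i) \<le> L * (\<delta> / L)" using C L by (intro mult_left_mono) auto
        then show ?thesis using D[of i] L by simp
      qed
      have gD: "hausdorff_gauge m (D i) \<le> ennreal c * hausdorff_gauge m (C i)" for i
      proof (cases "D i = {}")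
        case False
        then have ne: "C i \<noteq> {}" unfolding D_def by blast
        have "(diameter (D i) / 2) ^ m \<le> (L * diameter (C i) / 2) ^ m"
          using D[of i] diameter_ge_0[of "D i"] by (intro power_mono) auto
        also have "\<dots> = c * (diameter (C i) / 2) ^ m"
          by (simp add: c_def power_mult_distrib[symmetric])
        finally have "unit_ball_vol (real m) * (diameter (D i) / 2) ^ m \<le> c * (unit_ball_vol (real m) * (diameter (C i) / 2) ^ m)"
          using mult_left_mono[of _ _ "unit_ball_vol (real m)"] by (simp add: mult.left_commute)
        moreover have "0 \<le> unit_ball_vol (real m) * (diameter (C i) / 2) ^ m"
          using C diameter_ge_0[of "C i"] by simp
        ultimately show ?thesis
          using False ne c by (simp add: hausdorff_gauge_def ennreal_mult[symmetric] ennreal_leI)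
      qed (simp add: hausdorff_gauge_def)
      have "g ` X \<subseteq> (\<Union>i. D i)" using sub unfolding D_def by blast
      then have "hausdorff_pre m \<delta> (g ` X) \<le> (\<Sum>i. hausdorff_gauge m (D i))"
        unfolding hausdorff_pre_def using D Dd by (intro INF_lower) auto
      also have "\<dots> \<le> (\<Sum>i. ennreal c * hausdorff_gauge m (C i))"
        by (intro suminf_le gD) auto
      also have "\<dots> = ennreal c * (\<Sum>i. hausdorff_gauge m (C i))" by (rule ennreal_suminf_cmult)
      finally show "ennreal (1 / c) * hausdorff_pre m \<delta> (g ` X) \<le> (\<Sum>i. hausdorff_gauge m (C i))"
        using mult_left_mono[of _ _ "ennreal (1 / c)"] cancel by fastforce
    qed
    also have "\<dots> \<le> hausdorff_outer m (h ` X)" using \<delta> L by (intro hausdorff_pre_le_outer) simp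
    finally have "ennreal c * (ennreal (1 / c) * hausdorff_pre m \<delta> (g ` X)) \<le> ennreal c * hausdorff_outer m (h ` X)"
      by (rule mult_left_mono) simp
    then show ?thesis using cancel[of "hausdorff_pre m \<delta> (g ` X)"] by (simp add: mult.left_commute)
  qed
  then show ?thesis unfolding hausdorff_outer_def[of m "g ` X"] c_def[symmetric] by (intro SUP_least) auto
qed

lemma hausdorff_outer_isometric:
  fixes g :: "'x \<Rightarrow> 'c::metric_space" and h :: "'x \<Rightarrow> 'd::metric_space"
  assumes "\<And>x y. x \<in> X \<Longrightarrow> y \<in> X \<Longrightarrow> dist (g x) (g y) = dist (h x) (h y)"
  shows "hausdorff_outer m (g ` X) = hausdorff_outer m (h ` X)"
  using hausdorff_outer_lipschitz[of 1 X g h m] hausdorff_outer_lipschitz[of 1 X h g m] assms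
  by (intro antisym) auto

text \<open>Isometries preserve Hausdorff measure, so pushing it forward along \<open>T\<close>
  gives its restriction to the range. In particular, integrals over a hyperplane move to a Euclidean
  space of one dimension less, where the measure is Lebesgue measure.\<close>

lemma nn_integral_hausdorff_isometry:
  fixes T :: "'c::metric_space \<Rightarrow> 'd::metric_space"
  assumes iso: "\<And>x y. dist (T x) (T y) = dist x y"
    and W: "range T \<in> sets borel" and f[measurable]: "f \<in> borel_measurable borel"
  shows "(\<integral>\<^sup>+u\<in>range T. f u \<partial>hausdorff_measure m) = (\<integral>\<^sup>+x. f (T x) \<partial>hausdorff_measure m)"
proof -
  have "continuous_on UNIV T"
    unfolding continuous_on_iff using iso by (metis)
  then have T[measurable]: "T \<in> borel_measurable borel"
    by (rule borel_measurable_continuous_onI)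
  have "distr (hausdorff_measure m) borel T = density (hausdorff_measure m) (indicator (range T))"
  proof (rule measure_eqI)
    fix A assume "A \<in> sets (distr (hausdorff_measure m) borel T)"
    then have A[measurable]: "A \<in> sets borel" by simp
    have TA: "T -` A \<in> sets borel" using measurable_sets[OF T A] by simp
    have "emeasure (distr (hausdorff_measure m) borel T) A = hausdorff_outer m (T -` A)"
      using TA by (subst emeasure_distr) (auto simp: emeasure_hausdorff_measure)
    also have "\<dots> = hausdorff_outer m (T ` (T -` A))"
      using hausdorff_outer_isometric[of "T -` A" T "\<lambda>x. x" m] iso by simp
    also have "T ` (T -` A) = range T \<inter> A" by blast
    also have "hausdorff_outer m (range T \<inter> A) = emeasure (hausdorff_measure m) (range T \<inter> A)"
      using W A by (simp add: emeasure_hausdorff_measure)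
    also have "\<dots> = emeasure (density (hausdorff_measure m) (indicator (range T))) A"
      using W A by (subst emeasure_density) (auto simp: indicator_inter_arith[symmetric] intro!: nn_integral_indicator[symmetric])
    finally show "emeasure (distr (hausdorff_measure m) borel T) A = emeasure (density (hausdorff_measure m) (indicator (range T))) A" .
  qed simp
  then have "(\<integral>\<^sup>+u. f u \<partial>distr (hausdorff_measure m) borel T) = (\<integral>\<^sup>+u. f u \<partial>density (hausdorff_measure m) (indicator (range T)))"
    by simp
  then show ?thesis
    using W by (subst (asm) nn_integral_distr, simp_all, subst (asm) nn_integral_density) (auto simp: mult.commute)
qed

section \<open>Lebesgue density points\<close>

lemma lebesgue_density_aux:
  fixes A :: "'b::euclidean_space set"
  assumes A: "A \<in> sets borel" and e: "e > (0::real)"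
    and S: "\<And>x d. x \<in> S \<Longrightarrow> d > 0 \<Longrightarrow>
      \<exists>r>0. r < d \<and> ennreal e * emeasure lborel (ball x r) \<le> emeasure lborel (ball x r - A)"
    and SA: "S \<subseteq> A \<inter> ball 0 R"
  shows "negligible S"
  unfolding negligible_outer_le
proof (intro allI impI)
  fix \<eta> :: real assume \<eta>: "\<eta> > 0"
  define A' where "A' = A \<inter> ball 0 R"
  have A': "A' \<in> sets borel" using A by (simp add: A'_def)
  obtain V where V: "open V" "A' \<subseteq> V" "emeasure lborel (V - A') < ennreal (\<eta> * e)"
    using outer_regular_lborel[OF A', of "\<eta> * e"] \<eta> e by auto
  define U where "U = V \<inter> ball 0 R"
  have U: "open U" "S \<subseteq> U" "U - A' \<subseteq> V - A'" using V SA unfolding U_def A'_def by auto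
  define K where "K = {(x, r). x \<in> S \<and> 0 < r \<and> ball x r \<subseteq> U \<and> ennreal e * emeasure lborel (ball x r) \<le> emeasure lborel (ball x r - A)}"
  have cov: "\<exists>i. i \<in> K \<and> x \<in> ball (fst i) (snd i) \<and> snd i < d" if x: "x \<in> S" and d: "d > 0" for x d
  proof -
    obtain s where s: "s > 0" "ball x s \<subseteq> U" using U x open_contains_ball by blast
    obtain r where r: "r > 0" "r < min s d" "ennreal e * emeasure lborel (ball x r) \<le> emeasure lborel (ball x r - A)"
      using S[OF x, of "min s d"] s d by auto
    have "ball x r \<subseteq> U" using s r by (meson min_less_iff_conj order_trans subset_ball less_imp_le)
    then have "(x, r) \<in> K" using r x unfolding K_def by simp
    then show ?thesis using r by (intro exI[of _ "(x, r)"]) simp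
  qed
  \<comment> \<open>These disjoint balls cover almost all of \<open>S\<close>, and at least the
    proportion \<open>e\<close> of each lies outside \<open>A\<close>. The outer parts fit into
    \<open>V - A'\<close>, whose volume is below \<open>\<eta> * e\<close>, so the balls have total
    volume at most \<open>\<eta>\<close>.\<close>
  obtain C where C: "countable C" "C \<subseteq> K"
      "pairwise (\<lambda>i j. disjnt (ball (fst i) (snd i)) (ball (fst j) (snd j))) C"
      "negligible (S - (\<Union>i\<in>C. ball (fst i) (snd i)))"
    by (rule Vitali_covering_theorem_balls[of S K fst snd, OF cov])
  define B where "B = (\<Union>i\<in>C. ball (fst i) (snd i))"
  have CK: "ball (fst i) (snd i) \<subseteq> U" "ennreal e * emeasure lborel (ball (fst i) (snd i)) \<le> emeasure lborel (ball (fst i) (snd i) - A)"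
    if "i \<in> C" for i using subsetD[OF C(2) that] by (simp_all add: K_def case_prod_unfold)
  have dj: "disjoint_family_on (\<lambda>i. ball (fst i) (snd i)) C" "disjoint_family_on (\<lambda>i. ball (fst i) (snd i) - A) C"
    using C(3) unfolding disjoint_family_on_def pairwise_def disjnt_def by blast+
  have "ennreal e * emeasure lborel B = ennreal e * (\<integral>\<^sup>+i. emeasure lborel (ball (fst i) (snd i)) \<partial>count_space C)"
    unfolding B_def using C(1) dj by (subst emeasure_UN_countable) auto
  also have "\<dots> = (\<integral>\<^sup>+i. ennreal e * emeasure lborel (ball (fst i) (snd i)) \<partial>count_space C)"
    by (rule nn_integral_cmult[symmetric]) simp
  also have "\<dots> \<le> (\<integral>\<^sup>+i. emeasure lborel (ball (fst i) (snd i) - A) \<partial>count_space C)"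
    using CK by (intro nn_integral_mono) auto
  also have "\<dots> = emeasure lborel (\<Union>i\<in>C. ball (fst i) (snd i) - A)"
    using C(1) dj A by (intro emeasure_UN_countable[symmetric]) auto
  also have "\<dots> \<le> emeasure lborel (V - A')"
  proof (rule emeasure_mono)
    show "(\<Union>i\<in>C. ball (fst i) (snd i) - A) \<subseteq> V - A'"
      using CK(1) U(3) unfolding U_def A'_def by blast
  qed (use V A' in auto)
  also have "\<dots> \<le> ennreal (\<eta> * e)" using V by simp
  finally have "ennreal (1 / e) * (ennreal e * emeasure lborel B) \<le> ennreal (1 / e) * ennreal (\<eta> * e)"
    by (rule mult_left_mono) simp
  then have Be: "emeasure lborel B \<le> ennreal \<eta>"
    using e \<eta> by (simp add: mult.assoc[symmetric] ennreal_mult[symmetric])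
  define T where "T = B \<union> (S - B)"
  have ob: "open B" unfolding B_def by auto
  have nl: "S - B \<in> null_sets lebesgue" using C(4) unfolding B_def negligible_iff_null_sets .
  have "emeasure lebesgue T = emeasure lebesgue B"
    unfolding T_def using ob nl by (intro emeasure_Un_null_set) auto
  then have Te: "emeasure lebesgue T \<le> ennreal \<eta>" using Be ob by simp
  have Ts: "T \<in> sets lebesgue" unfolding T_def using ob null_setsD2[OF nl] by (intro sets.Un) auto
  have "T \<in> lmeasurable" using Te Ts by (intro fmeasurableI) (auto intro: le_less_trans)
  moreover have "measure lebesgue T \<le> \<eta>" using Te \<eta> unfolding measure_def by (simp add: enn2real_leI)
  moreover have "S \<subseteq> T" unfolding T_def by auto
  ultimately show "\<exists>T. S \<subseteq> T \<and> T \<in> lmeasurable \<and> measure lebesgue T \<le> \<eta>" by blast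
qed

definition density_point :: "'b::euclidean_space set \<Rightarrow> 'b \<Rightarrow> bool" where
  "density_point A x \<longleftrightarrow> (\<forall>e>0. \<exists>d>0. \<forall>r. 0 < r \<longrightarrow> r < d \<longrightarrow>
     emeasure lborel (ball x r - A) \<le> ennreal e * emeasure lborel (ball x r))"

theorem lebesgue_density:
  fixes A :: "'b::euclidean_space set"
  assumes A: "A \<in> sets borel"
  shows "negligible {x \<in> A. \<not> density_point A x}"
proof -
  define S where "S = (\<lambda>(k::nat, R::nat). {x \<in> A \<inter> ball 0 (real R). \<forall>d>0. \<exists>r>0. r < d \<and>
     ennreal (1 / Suc k) * emeasure lborel (ball x r) \<le> emeasure lborel (ball x r - A)})"
  have "negligible (S p)" for p
  proof (cases p)
    case (Pair k R)
    show ?thesis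
      by (rule lebesgue_density_aux[OF A, of "1 / Suc k" _ "real R"]) (auto simp: Pair S_def)
  qed
  then have "negligible (\<Union>(range S))" by (intro negligible_countable_Union) auto
  moreover have "{x \<in> A. \<not> density_point A x} \<subseteq> \<Union>(range S)"
  proof
    fix x assume "x \<in> {x \<in> A. \<not> density_point A x}"
    then obtain e where x: "x \<in> A" and e: "e > 0" and ee: "\<And>d. d > 0 \<Longrightarrow> \<exists>r. 0 < r \<and> r < d \<and>
        \<not> emeasure lborel (ball x r - A) \<le> ennreal e * emeasure lborel (ball x r)"
      unfolding density_point_def by blast
    obtain k where k: "1 / real (Suc k) < e" using nat_approx_posE[OF e] by metis
    obtain R where R: "norm x < real R" using reals_Archimedean2 by blast
    have "\<exists>r>0. r < d \<and> ennreal (1 / Suc k) * emeasure lborel (ball x r) \<le> emeasure lborel (ball x r - A)" if d: "d > 0" for d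
    proof -
      obtain r where r: "0 < r" "r < d" "ennreal e * emeasure lborel (ball x r) < emeasure lborel (ball x r - A)"
        using ee[OF d] by (auto simp: not_le)
      have "ennreal (1 / Suc k) * emeasure lborel (ball x r) \<le> ennreal e * emeasure lborel (ball x r)"
        using k by (intro mult_right_mono ennreal_leI) auto
      then show ?thesis using r by (intro exI[of _ r]) auto
    qed
    then have "x \<in> S (k, R)" using x R unfolding S_def by (simp add: dist_norm)
    then show "x \<in> \<Union>(range S)" by blast
  qed
  ultimately show ?thesis using negligible_subset by blast
qed

text \<open>If \<open>A\<close> had no point near \<open>x + h\<close>, it would miss the ball of
  radius \<open>e1 * norm h\<close> there, which is the fixed proportion
  \<open>(e1 / 2) ^ DIM('b)\<close> of the ball of radius \<open>2 * norm h\<close> around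
  \<open>x\<close>; \<open>c\<close> is half of this proportion. Capping \<open>e\<close> at 1 keeps
  the small ball inside the large one.\<close>

lemma density_point_near:
  fixes A :: "'b::euclidean_space set"
  assumes A: "A \<in> sets borel" and x: "x \<in> A" "density_point A x" and e: "e > 0"
  obtains d where "d > 0" "\<And>h. norm h < d \<Longrightarrow> \<exists>y\<in>A. dist y (x + h) \<le> e * norm h"
proof -
  define e1 where "e1 = min e 1"
  have e1: "e1 > 0" "e1 \<le> 1" "e1 \<le> e" using e by (auto simp: e1_def)
  define c where "c = (e1 / 2) ^ DIM('b) / 2"
  have c: "c > 0" using e1 by (simp add: c_def)
  obtain d where d: "d > 0" and dd: "\<And>r. 0 < r \<Longrightarrow> r < d \<Longrightarrow> emeasure lborel (ball x r - A) \<le> ennreal c * emeasure lborel (ball x r)"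
    using x(2) c unfolding density_point_def by blast
  have "\<exists>y\<in>A. dist y (x + h) \<le> e * norm h" if h: "norm h < d / 2" for h
  proof (cases "h = 0")
    case True
    then show ?thesis using x by (intro bexI[of _ x]) auto
  next
    case False
    then have nh: "norm h > 0" by simp
    show ?thesis
    proof (rule ccontr)
      assume no: "\<not> ?thesis"
      have sub: "ball (x + h) (e1 * norm h) \<subseteq> ball x (2 * norm h) - A"
      proof
        fix y assume y: "y \<in> ball (x + h) (e1 * norm h)"
        have "e1 * norm h \<le> e * norm h" "e1 * norm h \<le> 1 * norm h" using e1 by (intro mult_right_mono; simp)+
        then have y1: "dist y (x + h) < e * norm h" "dist y (x + h) < norm h"
          using y by (auto simp: dist_commute)
        have "y \<notin> A" using no y1(1) by force
        moreover have "dist x y < 2 * norm h" using y1(2) dist_triangle[of x y "x + h"] dist_norm[of x "x + h"] by (simp add: dist_commute)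
        ultimately show "y \<in> ball x (2 * norm h) - A" by simp
      qed
      let ?w = "unit_ball_vol (DIM('b))"
      have "ennreal (?w * (e1 * norm h) ^ DIM('b)) = emeasure lborel (ball (x + h) (e1 * norm h))"
        using e1 nh by (simp add: emeasure_ball)
      also have "\<dots> \<le> emeasure lborel (ball x (2 * norm h) - A)"
        using sub A by (intro emeasure_mono) auto
      also have "\<dots> \<le> ennreal c * emeasure lborel (ball x (2 * norm h))" using dd[of "2 * norm h"] nh h by simp
      also have "\<dots> = ennreal (c * (?w * (2 * norm h) ^ DIM('b)))"
        using c nh by (simp add: emeasure_ball ennreal_mult)
      finally have "?w * (e1 * norm h) ^ DIM('b) \<le> c * (?w * (2 * norm h) ^ DIM('b))"
        using c nh by (subst (asm) ennreal_le_iff) auto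
      also have "\<dots> = ?w * (e1 * norm h) ^ DIM('b) / 2"
        by (simp add: c_def power_mult_distrib power_divide)
      finally have "?w * (e1 * norm h) ^ DIM('b) \<le> ?w * (e1 * norm h) ^ DIM('b) / 2" .
      moreover have "?w * (e1 * norm h) ^ DIM('b) > 0" using e1 nh by simp
      ultimately show False by linarith
    qed
  qed
  then show ?thesis using d by (intro that[of "d / 2"]) auto
qed

section \<open>Rademacher's theorem\<close>

text \<open>Differentiability up to the error \<open>e\<close>. With rational slopes countably many
  candidates suffice, as the measurability and density arguments require.\<close>

definition approx_slope :: "real \<Rightarrow> (real \<Rightarrow> real) \<Rightarrow> real \<Rightarrow> bool" where
  "approx_slope e g x \<longleftrightarrow> (\<exists>q\<in>\<rat>. \<exists>r>0. \<forall>h. \<bar>h\<bar> < r \<longrightarrow> \<bar>g (x + h) - g x - q * h\<bar> \<le> e * \<bar>h\<bar>)"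

lemma emeasure_lborel_lipschitz_image:
  fixes H :: "real \<Rightarrow> real"
  assumes "K-lipschitz_on UNIV H" "K > 0" "A \<in> sets borel" "H ` A \<in> sets borel"
  shows "emeasure lborel (H ` A) \<le> ennreal K * emeasure lborel A"
proof -
  have "hausdorff_outer DIM(real) (H ` A) \<le> ennreal (K ^ DIM(real)) * hausdorff_outer DIM(real) ((\<lambda>x. x) ` A)"
    by (rule hausdorff_outer_lipschitz) (use assms lipschitz_onD[OF assms(1)] in auto)
  then show ?thesis using assms(3,4)
    by (simp only: hausdorff_outer_eq_lborel image_ident) simp
qed

text \<open>
  The pullback of Lebesgue measure along an increasing bi-Lipschitz map \<open>H\<close> has a Radon--Nikodym
  density \<open>\<phi>\<close>; at a density point of \<open>{q \<le> \<phi> < q + e}\<close> the difference quotients of \<open>H\<close> are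
  eventually within \<open>2 e\<close> of \<open>q\<close>.
\<close>

lemma bilipschitz_approx_slope:
  fixes H :: "real \<Rightarrow> real"
  assumes lip: "K-lipschitz_on UNIV H" and K: "K > 0"
    and inc: "\<And>x y. x \<le> y \<Longrightarrow> y - x \<le> H y - H x" and e: "e > 0"
  shows "negligible {x. \<not> approx_slope e H x}"
proof -
  have cont: "continuous_on UNIV H" using lip by (rule lipschitz_on_continuous_on)
  have sm: "strict_mono H"
    by (rule strict_monoI) (use inc in \<open>smt (verit)\<close>)
  then have inj: "inj H" by (rule strict_mono_imp_inj_on)
  have surj: "surj H"
    unfolding surj_def
  proof
    fix y :: real
    have "H (-\<bar>y - H 0\<bar>) \<le> y" "y \<le> H \<bar>y - H 0\<bar>"
      using inc[of "-\<bar>y - H 0\<bar>" 0] inc[of 0 "\<bar>y - H 0\<bar>"] by linarith+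
    then have "\<exists>x\<ge>-\<bar>y - H 0\<bar>. x \<le> \<bar>y - H 0\<bar> \<and> H x = y"
      using cont by (intro IVT) (auto simp: continuous_on_eq_continuous_at)
    then show "\<exists>x. y = H x" by blast
  qed
  define G where "G = inv H"
  have GH: "G (H x) = x" and HG: "H (G y) = y" for x y
    using inj surj by (simp_all add: G_def surj_f_inv_f)
  have Glip: "1-lipschitz_on UNIV G"
  proof (rule lipschitz_onI)
    fix x y :: real
    have "\<bar>u - v\<bar> \<le> \<bar>H u - H v\<bar>" for u v using inc[of u v] inc[of v u] by linarith
    from this[of "G x" "G y"] show "dist (G x) (G y) \<le> 1 * dist x y" by (simp add: HG dist_real_def)
  qed simp
  have G[measurable]: "G \<in> borel_measurable borel"
    using lipschitz_on_continuous_on[OF Glip] by (rule borel_measurable_continuous_onI)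
  have img: "H ` A = G -` A" for A by (auto simp: GH) (metis HG image_eqI)
  define \<nu> where "\<nu> = distr lborel borel G"
  have \<nu>: "emeasure \<nu> A = emeasure lborel (H ` A)" if "A \<in> sets borel" for A
    unfolding \<nu>_def img using that by (subst emeasure_distr) auto
  have HA: "H ` A \<in> sets borel" if "A \<in> sets borel" for A
    using measurable_sets[OF G that] by (simp add: img)
  have le: "emeasure \<nu> A \<le> ennreal K * emeasure lborel A" if "A \<in> sets borel" for A
    unfolding \<nu>[OF that] using emeasure_lborel_lipschitz_image[OF lip K that HA[OF that]] .
  have "absolutely_continuous lborel \<nu>"
    unfolding absolutely_continuous_def null_sets_def using le by (force simp: \<nu>_def)
  then obtain \<phi> where \<phi>[measurable]: "\<phi> \<in> borel_measurable lborel" and dens: "density lborel \<phi> = \<nu>"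
    using sigma_finite_measure.Radon_Nikodym[OF sigma_finite_lborel] by (metis \<nu>_def sets_distr sets_lborel)
  have em: "emeasure \<nu> A = (\<integral>\<^sup>+x\<in>A. \<phi> x \<partial>lborel)" if "A \<in> sets borel" for A
    unfolding dens[symmetric] using that by (subst emeasure_density) auto
  define A where "A q = {x. ennreal q \<le> \<phi> x \<and> \<phi> x \<le> ennreal (q + e / 2)}" for q :: real
  have A[measurable]: "A q \<in> sets borel" for q
  proof -
    have "{x\<in>space lborel. ennreal q \<le> \<phi> x \<and> \<phi> x \<le> ennreal (q + e / 2)} \<in> sets lborel" by measurable
    then show ?thesis by (simp add: A_def)
  qed
  have good: "approx_slope e H x" if q: "q \<in> \<rat>" "q \<ge> 0" and x: "x \<in> A q" "density_point (A q) x" for q x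
  proof -
    \<comment> \<open>Near \<open>x\<close>, the part of an interval of length \<open>l\<close>
      outside \<open>A q\<close> has measure \<open>w \<le> 4 * \<eta> * l\<close>, because the ball
      of radius \<open>2 * l\<close> has length \<open>4 * l\<close>. It disturbs the increment of
      \<open>H\<close> by at most \<open>(K + q) * w\<close>, which this \<open>\<eta>\<close> keeps
      below \<open>e * l / 2\<close>.\<close>
    define \<eta> where "\<eta> = e / (8 * (K + q))"
    have Kq: "K + q > 0" using K q by linarith
    then have \<eta>: "\<eta> > 0" using e by (simp add: \<eta>_def)
    obtain d where d: "d > 0" and dd: "\<And>r. 0 < r \<Longrightarrow> r < d \<Longrightarrow>
        emeasure lborel (ball x r - A q) \<le> ennreal \<eta> * emeasure lborel (ball x r)"
      using x(2) \<eta> unfolding density_point_def by blast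
    \<comment> \<open>Intervals that start at \<open>x\<close> and intervals that end there are both
      needed, for increments of either sign.\<close>
    have main: "\<bar>H b - H a - q * (b - a)\<bar> \<le> e * (b - a)"
      if ab: "a < b" "a = x \<or> b = x" "b - a < d / 2" for a b
    proof -
      let ?I = "{a..b}"
      define w where "w = measure lborel (?I - A q)"
      have fin: "emeasure lborel (?I - A q) < \<infinity>"
        by (rule le_less_trans[OF emeasure_mono[of _ ?I]]) (auto simp: emeasure_lborel_Icc_eq)
      have ew: "emeasure lborel (?I - A q) = ennreal w"
        using fin unfolding w_def by (intro emeasure_eq_ennreal_measure) auto
      have w0: "w \<ge> 0" by (simp add: w_def)
      have "?I \<subseteq> ball x (2 * (b - a))" using ab by (auto simp: dist_real_def)
      then have "emeasure lborel (?I - A q) \<le> emeasure lborel (ball x (2 * (b - a)) - A q)"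
        by (intro emeasure_mono) auto
      also have "\<dots> \<le> ennreal \<eta> * emeasure lborel (ball x (2 * (b - a)))"
        using ab by (intro dd) auto
      also have "ball x (2 * (b - a)) = {x - 2 * (b - a)<..<x + 2 * (b - a)}"
        by (auto simp: dist_real_def)
      also have "ennreal \<eta> * emeasure lborel \<dots> = ennreal (\<eta> * (4 * (b - a)))"
        using \<eta> ab by (simp add: ennreal_mult)
      finally have w: "w \<le> \<eta> * (4 * (b - a))" using ew \<eta> ab by (simp add: ennreal_le_iff)
      have wba: "w \<le> b - a"
      proof -
        have "emeasure lborel (?I - A q) \<le> emeasure lborel ?I" by (intro emeasure_mono) auto
        then show ?thesis using ew ab by simp
      qed
      have eIA: "emeasure lborel (?I \<inter> A q) = ennreal (b - a - w)"
      proof -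
        have "emeasure lborel ?I = emeasure lborel (?I \<inter> A q) + emeasure lborel (?I - A q)"
          by (subst plus_emeasure) (auto intro!: arg_cong[where f = "emeasure lborel"])
        then have eq: "ennreal (b - a) = emeasure lborel (?I \<inter> A q) + ennreal w" using ab ew by simp
        have "emeasure lborel (?I \<inter> A q) \<le> emeasure lborel ?I" by (intro emeasure_mono) auto
        then have "emeasure lborel (?I \<inter> A q) < top" using ab by (simp add: le_less_trans)
        then obtain z where z: "z \<ge> 0" "emeasure lborel (?I \<inter> A q) = ennreal z" by (metis ennreal_cases less_irrefl)
        then show ?thesis using eq w0 wba ab by (simp add: ennreal_plus[symmetric] del: ennreal_plus)
      qed
      have "ennreal (H b - H a) = emeasure \<nu> ?I"
      proof -
        have "H ` ?I = {H a..H b}"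
        proof
          show "H ` ?I \<subseteq> {H a..H b}" using sm by (auto simp: strict_mono_less_eq)
          show "{H a..H b} \<subseteq> H ` ?I"
          proof
            fix y assume "y \<in> {H a..H b}"
            then have "H a \<le> H (G y)" "H (G y) \<le> H b" by (auto simp: HG)
            then have "G y \<in> ?I" using sm by (auto simp: strict_mono_less_eq)
            then show "y \<in> H ` ?I" using HG by (metis image_eqI)
          qed
        qed
        then show ?thesis using \<nu>[of ?I] inc[of a b] ab by simp
      qed
      also have "\<dots> = emeasure \<nu> (?I \<inter> A q) + emeasure \<nu> (?I - A q)"
        by (subst plus_emeasure) (auto simp: \<nu>_def intro!: arg_cong[where f = "emeasure _"])
      finally have sum: "ennreal (H b - H a) = emeasure \<nu> (?I \<inter> A q) + emeasure \<nu> (?I - A q)" .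
      have Hab: "H b - H a \<ge> 0" using inc[of a b] ab by linarith
      have int: "emeasure \<nu> (?I \<inter> A q) = (\<integral>\<^sup>+x\<in>?I \<inter> A q. \<phi> x \<partial>lborel)" by (intro em) auto
      have "emeasure \<nu> (?I \<inter> A q) \<le> (\<integral>\<^sup>+x. ennreal (q + e / 2) * indicator (?I \<inter> A q) x \<partial>lborel)"
        unfolding int by (intro nn_integral_mono) (auto simp: A_def indicator_def)
      also have "\<dots> = ennreal ((q + e / 2) * (b - a - w))"
        using q e wba by (simp add: nn_integral_cmult_indicator eIA ennreal_mult)
      finally have up: "emeasure \<nu> (?I \<inter> A q) \<le> ennreal ((q + e / 2) * (b - a - w))" .
      have "ennreal (q * (b - a - w)) = (\<integral>\<^sup>+x. ennreal q * indicator (?I \<inter> A q) x \<partial>lborel)"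
        using q e wba by (simp add: nn_integral_cmult_indicator eIA ennreal_mult)
      also have "\<dots> \<le> emeasure \<nu> (?I \<inter> A q)"
        unfolding int by (intro nn_integral_mono) (auto simp: A_def indicator_def)
      finally have low: "ennreal (q * (b - a - w)) \<le> emeasure \<nu> (?I \<inter> A q)" .
      have rest: "emeasure \<nu> (?I - A q) \<le> ennreal (K * w)"
        using le[of "?I - A q"] K w0 by (simp add: ew ennreal_mult)
      have "ennreal (H b - H a) \<le> ennreal ((q + e / 2) * (b - a - w)) + ennreal (K * w)"
        unfolding sum by (intro add_mono up rest)
      also have "\<dots> = ennreal ((q + e / 2) * (b - a - w) + K * w)"
        using q e wba w0 K by (intro ennreal_plus[symmetric]) auto
      finally have U: "H b - H a \<le> (q + e / 2) * (b - a - w) + K * w"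
        using q e wba w0 K by (subst (asm) ennreal_le_iff) (auto intro!: add_nonneg_nonneg mult_nonneg_nonneg)
      have "ennreal (q * (b - a - w)) \<le> ennreal (H b - H a)"
        unfolding sum using low by (simp add: add_increasing2)
      then have Lw: "q * (b - a - w) \<le> H b - H a" using Hab by simp
      have Kw: "(K + q) * w \<le> e / 2 * (b - a)"
      proof -
        have "(K + q) * w \<le> (K + q) * (\<eta> * (4 * (b - a)))" using w Kq by (intro mult_left_mono) auto
        also have "\<dots> = e / 2 * (b - a)" using Kq unfolding \<eta>_def by (simp add: field_simps)
        finally show ?thesis .
      qed
      have nn: "q * w \<ge> 0" "K * w \<ge> 0" "e / 2 * w \<ge> 0" "e / 2 * (b - a) \<ge> 0" using q w0 K e ab by auto
      have "(q + e / 2) * (b - a - w) + K * w = q * (b - a) + e / 2 * (b - a) - q * w - e / 2 * w + K * w"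
        by (simp add: field_simps)
      then have "H b - H a - q * (b - a) \<le> e * (b - a)"
        using U Kw nn unfolding distrib_right by linarith
      moreover have "q * (b - a) - (H b - H a) \<le> e * (b - a)"
        using Lw Kw nn unfolding distrib_right right_diff_distrib[of q "b - a" w] by linarith
      ultimately show ?thesis by linarith
    qed
    have "\<bar>H (x + h) - H x - q * h\<bar> \<le> e * \<bar>h\<bar>" if h: "\<bar>h\<bar> < d / 2" for h
    proof -
      consider "h = 0" | "h > 0" | "h < 0" by linarith
      then show ?thesis
      proof cases
        case 2
        then show ?thesis using main[of x "x + h"] h by simp
      next
        case 3
        then show ?thesis using main[of "x + h" x] h by (simp add: abs_minus_commute algebra_simps)
      qed simp
    qed
    then show ?thesis unfolding approx_slope_def using q d by (intro bexI[of _ q] exI[of _ "d / 2"]) auto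
  qed
  \<comment> \<open>If \<open>\<phi>\<close> were infinite on a set of positive measure,
    \<open>\<nu>\<close> would be infinite on a bounded part of it, against the bound of
    \<open>\<nu>\<close> by \<open>K\<close> times Lebesgue measure.\<close>
  have "{x. \<phi> x = \<infinity>} \<in> null_sets lborel"
    proof (rule ccontr)
      assume nn: "{x. \<phi> x = \<infinity>} \<notin> null_sets lborel"
      have mm: "{x. \<phi> x = \<infinity>} \<in> sets borel"
      proof -
        have "{x\<in>space lborel. \<phi> x = \<infinity>} \<in> sets lborel" by measurable
        then show ?thesis by simp
      qed
      have "\<exists>n::nat. {x. \<phi> x = \<infinity>} \<inter> ball 0 (real n) \<notin> null_sets lborel"
      proof (rule ccontr)
        assume "\<not> ?thesis"
        then have "(\<Union>n::nat. {x. \<phi> x = \<infinity>} \<inter> ball 0 (real n)) \<in> null_sets lborel" by (intro null_sets_UN) auto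
        also have "(\<Union>n::nat. {x. \<phi> x = \<infinity>} \<inter> ball 0 (real n)) = {x. \<phi> x = \<infinity>}"
          using reals_Archimedean2 by (auto simp: dist_real_def)
        finally show False using nn by simp
      qed
      then obtain n :: nat where n: "{x. \<phi> x = \<infinity>} \<inter> ball 0 (real n) \<notin> null_sets lborel" by blast
      let ?B = "{x. \<phi> x = \<infinity>} \<inter> ball 0 (real n)"
      have Bm: "?B \<in> sets borel" using mm by auto
      have "emeasure lborel ?B \<noteq> 0" using n Bm by (auto simp: null_sets_def)
      moreover have "emeasure \<nu> ?B = (\<integral>\<^sup>+x. \<infinity> * indicator ?B x \<partial>lborel)"
        unfolding em[OF Bm] by (intro nn_integral_cong) (auto simp: indicator_def)
      then have "emeasure \<nu> ?B = \<infinity> * emeasure lborel ?B"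
        using Bm by (simp add: nn_integral_cmult_indicator)
      ultimately have "emeasure \<nu> ?B = \<infinity>" by (simp add: ennreal_top_mult)
      moreover have "emeasure \<nu> ?B \<le> ennreal K * emeasure lborel ?B" by (rule le[OF Bm])
      moreover have "emeasure lborel ?B < \<infinity>" by (rule emeasure_bounded_finite) (auto intro: bounded_subset)
      ultimately show False by (simp add: ennreal_mult_less_top top_unique ennreal_mult_eq_top_iff)
    qed
  then have n1: "negligible {x. \<phi> x = \<infinity>}"
    by (simp add: negligible_iff_null_sets null_sets_completionI)
  define N where "N q = {x \<in> A q. \<not> density_point (A q) x}" for q
  have cov: "{x. \<not> approx_slope e H x} \<subseteq> {x. \<phi> x = \<infinity>} \<union> (\<Union>q\<in>{q\<in>\<rat>. q \<ge> 0}. N q)"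
  proof
    fix x assume x: "x \<in> {x. \<not> approx_slope e H x}"
    show "x \<in> {x. \<phi> x = \<infinity>} \<union> (\<Union>q\<in>{q\<in>\<rat>. q \<ge> 0}. N q)"
    proof (cases "\<phi> x = \<infinity>")
      case False
      then obtain y where y: "y \<ge> 0" "\<phi> x = ennreal y" by (metis ennreal_cases infinity_ennreal_def)
      obtain q where q: "q \<in> \<rat>" "q \<ge> 0" "q \<le> y" "y \<le> q + e / 2"
      proof (cases "y \<le> e / 2")
        case True
        then show ?thesis using that[of 0] y by simp
      next
        case False
        obtain q where "q \<in> \<rat>" "y - e / 2 < q" "q < y" using Rats_dense_in_real[of "y - e / 2" y] e by auto
        then show ?thesis using that[of q] False by simp
      qed
      then have "x \<in> A q" using y e by (simp add: A_def ennreal_leI del: ennreal_plus)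
      then have "x \<in> N q" using good[OF q(1,2)] x unfolding N_def by auto
      then show ?thesis using q by blast
    qed simp
  qed
  have "countable {q\<in>\<rat>. q \<ge> (0::real)}" using countable_rat by (rule countable_subset[rotated]) auto
  then have "negligible (\<Union>q\<in>{q\<in>\<rat>. q \<ge> 0}. N q)"
    using lebesgue_density[OF A] unfolding N_def by (intro negligible_countable_Union) auto
  then show ?thesis using n1 cov by (meson negligible_Un negligible_subset)
qed

text \<open>Adding \<open>real n * x\<close> with \<open>L + 1 \<le> real n\<close> makes the
  function grow at least as fast as the identity. As \<open>n\<close> is an integer, slopes remain
  rational when the term is removed again.\<close>

lemma lipschitz_approx_slope:
  fixes g :: "real \<Rightarrow> real"
  assumes lip: "L-lipschitz_on UNIV g" and e: "e > 0"
  shows "negligible {x. \<not> approx_slope e g x}"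
proof -
  have L0: "L \<ge> 0" using lip by (rule lipschitz_on_nonneg)
  obtain n :: nat where n: "L + 1 \<le> real n" using real_arch_simple by blast
  define H where "H x = g x + real n * x" for x
  have gl: "\<bar>g x - g y\<bar> \<le> L * \<bar>x - y\<bar>" for x y
    using lipschitz_onD[OF lip, of x y] by (simp add: dist_real_def)
  have "(L + n)-lipschitz_on UNIV H"
    unfolding H_def by (intro lipschitz_on_add lip) (auto intro!: lipschitz_onI simp: dist_real_def abs_mult right_diff_distrib[symmetric])
  moreover have "L + n > 0" using L0 n by linarith
  moreover have "y - x \<le> H y - H x" if "x \<le> y" for x y
  proof -
    have "(L + 1) * (y - x) \<le> real n * (y - x)" using n that by (intro mult_right_mono) auto
    moreover have "- (L * (y - x)) \<le> g y - g x" using gl[of y x] that by linarith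
    ultimately show ?thesis by (simp add: H_def algebra_simps)
  qed
  ultimately have neg: "negligible {x. \<not> approx_slope e H x}" using bilipschitz_approx_slope e by blast
  have "approx_slope e g x" if ap: "approx_slope e H x" for x
  proof -
    obtain q r where q: "q \<in> \<rat>" "r > 0" "\<And>h. \<bar>h\<bar> < r \<Longrightarrow> \<bar>H (x + h) - H x - q * h\<bar> \<le> e * \<bar>h\<bar>"
      using ap unfolding approx_slope_def by blast
    have "q - real n \<in> \<rat>" using q(1) by auto
    moreover have "H (x + h) - H x - q * h = g (x + h) - g x - (q - real n) * h" for h
      by (simp add: H_def algebra_simps)
    ultimately show ?thesis unfolding approx_slope_def using q(2,3) by (intro bexI[of _ "q - real n"] exI[of _ r]) auto
  qed
  then have "{x. \<not> approx_slope e g x} \<subseteq> {x. \<not> approx_slope e H x}" by blast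
  with neg show ?thesis by (rule negligible_subset)
qed

section \<open>Directional slopes in Euclidean space\<close>

lemma closed_difference_bound:
  fixes f :: "'b::real_normed_vector \<Rightarrow> 'c::real_normed_vector"
  assumes "continuous_on UNIV f"
  shows "closed {x. \<forall>h\<in>S. norm (f (x + h) - f x - l h) \<le> c h}"
proof -
  have c: "continuous_on UNIV (\<lambda>x. f (x + h))" for h
    by (rule continuous_on_compose2[OF assms]) (auto intro!: continuous_intros)
  have "closed (\<Inter>h\<in>S. {x. norm (f (x + h) - f x - l h) \<le> c h})"
    by (intro closed_INT ballI closed_Collect_le continuous_on_norm continuous_on_diff c assms continuous_on_const)
  also have "(\<Inter>h\<in>S. {x. norm (f (x + h) - f x - l h) \<le> c h}) = {x. \<forall>h\<in>S. norm (f (x + h) - f x - l h) \<le> c h}"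
    by auto
  finally show ?thesis .
qed

text \<open>Radii \<open>1 / Suc n\<close> replace arbitrary positive ones, which exhibits the good
  points as a countable union of closed sets.\<close>

lemma approx_slope_directional_iff:
  fixes f :: "'b::euclidean_space \<Rightarrow> real"
  shows "approx_slope e (\<lambda>t. f (x + t *\<^sub>R b)) 0 \<longleftrightarrow>
    (\<exists>q\<in>\<rat>. \<exists>n::nat. \<forall>h. \<bar>h\<bar> < 1 / Suc n \<longrightarrow> \<bar>f (x + h *\<^sub>R b) - f x - q * h\<bar> \<le> e * \<bar>h\<bar>)" (is "_ \<longleftrightarrow> ?R")
proof
  assume "approx_slope e (\<lambda>t. f (x + t *\<^sub>R b)) 0"
  then obtain q r where q: "q \<in> \<rat>" "r > 0" "\<And>h. \<bar>h\<bar> < r \<Longrightarrow> \<bar>f (x + h *\<^sub>R b) - f x - q * h\<bar> \<le> e * \<bar>h\<bar>"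
    unfolding approx_slope_def by auto
  obtain n where "1 / Suc n < r" using nat_approx_posE[OF q(2)] by metis
  then show ?R using q by (meson order.strict_trans)
next
  assume ?R
  then obtain q n where q: "q \<in> \<rat>" "\<And>h. \<bar>h\<bar> < 1 / Suc n \<Longrightarrow> \<bar>f (x + h *\<^sub>R b) - f x - q * h\<bar> \<le> e * \<bar>h\<bar>" by blast
  show "approx_slope e (\<lambda>t. f (x + t *\<^sub>R b)) 0"
    unfolding approx_slope_def by (rule bexI[OF _ q(1)], rule exI[of _ "1 / Suc n"]) (use q(2) in auto)
qed

text \<open>
  Averaging over the translates \<open>x + t *\<^sub>R b\<close> with \<open>0 \<le> t \<le> 1\<close> replaces Fubini's theorem in coordinates
  adapted to \<open>b\<close>.
\<close>

lemma lipschitz_directional_slope: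
  fixes f :: "'b::euclidean_space \<Rightarrow> real"
  assumes lip: "L-lipschitz_on UNIV f" and e: "e > 0"
  shows "negligible {x. \<not> approx_slope e (\<lambda>t. f (x + t *\<^sub>R b)) 0}"
proof -
  define B where "B = {x. \<not> approx_slope e (\<lambda>t. f (x + t *\<^sub>R b)) 0}"
  have cont: "continuous_on UNIV f" using lip by (rule lipschitz_on_continuous_on)
  have closed: "closed {x. \<forall>h. \<bar>h\<bar> < 1 / Suc n \<longrightarrow> \<bar>f (x + h *\<^sub>R b) - f x - q * h\<bar> \<le> e * \<bar>h\<bar>}" for q n
  proof -
    have c: "continuous_on UNIV (\<lambda>x. f (x + h *\<^sub>R b))" for h
      by (rule continuous_on_compose2[OF cont]) (auto intro!: continuous_intros)
    have "closed (\<Inter>h\<in>{h. \<bar>h\<bar> < 1 / Suc n}. {x. \<bar>f (x + h *\<^sub>R b) - f x - q * h\<bar> \<le> e * \<bar>h\<bar>})"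
      by (intro closed_INT ballI closed_Collect_le continuous_on_rabs continuous_on_diff c cont continuous_on_const)
    moreover have "(\<Inter>h\<in>{h. \<bar>h\<bar> < 1 / Suc n}. {x. \<bar>f (x + h *\<^sub>R b) - f x - q * h\<bar> \<le> e * \<bar>h\<bar>}) =
        {x. \<forall>h. \<bar>h\<bar> < 1 / Suc n \<longrightarrow> \<bar>f (x + h *\<^sub>R b) - f x - q * h\<bar> \<le> e * \<bar>h\<bar>}" by blast
    ultimately show ?thesis by simp
  qed
  have "- B = (\<Union>q\<in>\<rat>. \<Union>n::nat. {x. \<forall>h. \<bar>h\<bar> < 1 / Suc n \<longrightarrow> \<bar>f (x + h *\<^sub>R b) - f x - q * h\<bar> \<le> e * \<bar>h\<bar>})"
    unfolding B_def approx_slope_directional_iff by blast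
  also have "\<dots> \<in> sets borel"
    using closed by (intro sets.countable_UN' countable_rat) auto
  finally have B: "B \<in> sets borel" by (metis borel_comp double_complement)
  have "emeasure lborel B = (\<integral>\<^sup>+t\<in>{0..1::real}. emeasure lborel B \<partial>lborel)"
    by (simp add: nn_integral_cmult_indicator)
  also have "\<dots> = (\<integral>\<^sup>+t. (\<integral>\<^sup>+x. indicator B (x + t *\<^sub>R b) * indicator {0..1} t \<partial>lborel) \<partial>lborel)"
  proof (rule nn_integral_cong)
    fix t :: real
    have "emeasure lborel B = (\<integral>\<^sup>+x. indicator B x \<partial>distr lborel borel ((+) (t *\<^sub>R b)))"
      using B by (simp add: lborel_distr_plus)
    also have "\<dots> = (\<integral>\<^sup>+x. indicator B (x + t *\<^sub>R b) \<partial>lborel)"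
      using B by (subst nn_integral_distr) (auto simp: add.commute)
    finally show "emeasure lborel B * indicator {0..1} t = (\<integral>\<^sup>+x. indicator B (x + t *\<^sub>R b) * indicator {0..1} t \<partial>lborel)"
      using B by (subst nn_integral_multc) auto
  qed
  also have "\<dots> = (\<integral>\<^sup>+x. (\<integral>\<^sup>+t. indicator B (x + t *\<^sub>R b) * indicator {0..1} t \<partial>lborel) \<partial>lborel)"
  proof (rule lborel_pair.Fubini')
    have [measurable]: "B \<in> sets borel" by (rule B)
    have [measurable]: "(\<lambda>p::'b \<times> real. fst p + snd p *\<^sub>R b) \<in> borel_measurable (lborel \<Otimes>\<^sub>M lborel)"
      by measurable
    have "(\<lambda>p::'b \<times> real. indicator B (fst p + snd p *\<^sub>R b) * indicator {0..1} (snd p) :: ennreal) \<in> borel_measurable (lborel \<Otimes>\<^sub>M lborel)"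
      by measurable
    then show "(\<lambda>(x, t). indicator B (x + t *\<^sub>R b) * indicator {0..1::real} t :: ennreal) \<in> borel_measurable (lborel \<Otimes>\<^sub>M lborel)"
      by (simp add: case_prod_unfold)
  qed
  also have "\<dots> = (\<integral>\<^sup>+x. 0 \<partial>(lborel::'b measure))"
  proof (rule nn_integral_cong)
    fix x :: 'b
    define g where "g t = f (x + t *\<^sub>R b)" for t
    have "(L * norm b)-lipschitz_on UNIV g"
    proof (rule lipschitz_onI)
      fix s t :: real
      have "dist (g s) (g t) \<le> L * dist (x + s *\<^sub>R b) (x + t *\<^sub>R b)"
        unfolding g_def by (rule lipschitz_onD[OF lip]) auto
      also have "dist (x + s *\<^sub>R b) (x + t *\<^sub>R b) = norm b * dist s t"
        by (simp add: dist_norm scaleR_left_diff_distrib[symmetric])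
      finally show "dist (g s) (g t) \<le> L * norm b * dist s t" by simp
    qed (use lipschitz_on_nonneg[OF lip] in auto)
    from lipschitz_approx_slope[OF this e]
    have neg: "negligible {t. \<not> approx_slope e g t}" .
    have eq: "{t. \<not> approx_slope e g t} = (\<lambda>t. x + t *\<^sub>R b) -` B"
      unfolding B_def approx_slope_def g_def by (simp add: algebra_simps)
    have "(\<lambda>t. x + t *\<^sub>R b) \<in> borel_measurable borel" by measurable
    from measurable_sets[OF this B] have "(\<lambda>t. x + t *\<^sub>R b) -` B \<in> sets borel" by simp
    then have null: "(\<lambda>t. x + t *\<^sub>R b) -` B \<in> null_sets lborel"
      using neg unfolding eq negligible_iff_null_sets by (simp add: null_sets_completion_iff)
    have "AE t in lborel. indicator B (x + t *\<^sub>R b) * indicator {0..1} t = (0::ennreal)"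
      using AE_not_in[OF null] by eventually_elim (auto simp: indicator_def)
    then show "(\<integral>\<^sup>+t. indicator B (x + t *\<^sub>R b) * indicator {0..1} t \<partial>lborel) = (0::ennreal)"
      by (subst nn_integral_cong_AE) auto
  qed
  finally have "emeasure lborel B = 0" by simp
  then have "B \<in> null_sets lborel" using B by (auto simp: null_sets_def)
  then show ?thesis unfolding B_def by (simp add: negligible_iff_null_sets null_sets_completionI)
qed

section \<open>From directional slopes to differentiability\<close>

definition approx_diff :: "real \<Rightarrow> ('b::euclidean_space \<Rightarrow> real) \<Rightarrow> 'b \<Rightarrow> bool" where
  "approx_diff e f x \<longleftrightarrow> (\<exists>q. \<exists>r>0. \<forall>h. norm h < r \<longrightarrow> \<bar>f (x + h) - f x - q \<bullet> h\<bar> \<le> e * norm h)"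

text \<open>
  At a density point of the set where the directional increments along the basis are uniformly
  close to those of a fixed linear functional, every corner of the broken line from \<open>x\<close> to \<open>x + h\<close>
  parallel to the axes may be moved into that set.
\<close>

lemma density_point_approx_diff:
  fixes f :: "'b::euclidean_space \<Rightarrow> real"
  assumes lip: "L-lipschitz_on UNIV f" and e: "e > 0"
    and A: "A \<in> sets borel" "x \<in> A" "density_point A x" and r: "r > 0"
    and sl: "\<And>y b t. y \<in> A \<Longrightarrow> b \<in> Basis \<Longrightarrow> \<bar>t\<bar> < r \<Longrightarrow> \<bar>f (y + t *\<^sub>R b) - f y - (q \<bullet> b) * t\<bar> \<le> e * \<bar>t\<bar>"
  shows "approx_diff (real DIM('b) * ((1 + 2 * L) * e)) f x"
proof -
  have L0: "L \<ge> 0" using lip by (rule lipschitz_on_nonneg)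
  obtain d where d: "d > 0" "\<And>h. norm h < d \<Longrightarrow> \<exists>y\<in>A. dist y (x + h) \<le> e * norm h"
    using density_point_near[OF A e] by metis
  have "\<bar>f (x + h) - f x - q \<bullet> h\<bar> \<le> real DIM('b) * ((1 + 2 * L) * e) * norm h" if h: "norm h < min d r" for h
  proof -
    define P where "P S = (\<Sum>b\<in>S. (h \<bullet> b) *\<^sub>R b)" for S
    have nP: "norm (P S) \<le> norm h" if S: "S \<subseteq> Basis" for S
    proof (rule norm_le_componentwise)
      fix b :: 'b assume b: "b \<in> Basis"
      have "P S \<bullet> b = (\<Sum>c\<in>S. if c = b then h \<bullet> b else 0)"
        unfolding P_def inner_sum_left using S b by (intro sum.cong) (auto simp: inner_Basis subset_iff)
      then show "\<bar>P S \<bullet> b\<bar> \<le> \<bar>h \<bullet> b\<bar>" using finite_subset[OF S finite_Basis] by simp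
    qed
    \<comment> \<open>The corner \<open>x + P S\<close> is replaced by a nearby \<open>y\<close> in
      \<open>A\<close>. This costs \<open>L * (e * norm h)\<close> at each end of the segment along
      \<open>b\<close> and the slope error \<open>e * norm h\<close>, hence
      \<open>(1 + 2 * L) * e * norm h\<close> per coordinate.\<close>
    have step: "finite S \<Longrightarrow> S \<subseteq> Basis \<Longrightarrow> \<bar>f (x + P S) - f x - q \<bullet> P S\<bar> \<le> real (card S) * ((1 + 2 * L) * e * norm h)" for S
    proof (induction S rule: finite_induct)
      case empty
      then show ?case by (simp add: P_def)
    next
      case (insert b S)
      then have S: "S \<subseteq> Basis" and b: "b \<in> Basis" by auto
      have "norm (P S) < d" using nP[OF S] h by simp
      then obtain y where y: "y \<in> A" "dist y (x + P S) \<le> e * norm (P S)" using d by blast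
      have "e * norm (P S) \<le> e * norm h" using nP[OF S] e by (intro mult_left_mono) auto
      then have yd: "dist y (x + P S) \<le> e * norm h" using y by linarith
      define t where "t = h \<bullet> b"
      have t: "\<bar>t\<bar> \<le> norm h" unfolding t_def using Basis_le_norm[OF b] by simp
      have "L * dist y (x + P S) \<le> L * (e * norm h)" using yd L0 by (rule mult_left_mono)
      then have 1: "\<bar>f y - f (x + P S)\<bar> \<le> L * (e * norm h)"
        using lipschitz_onD[OF lip, of y "x + P S"] by (simp add: dist_real_def)
      have "dist (y + t *\<^sub>R b) (x + P S + t *\<^sub>R b) = dist y (x + P S)" by (simp add: dist_norm)
      then have 2: "\<bar>f (y + t *\<^sub>R b) - f (x + P S + t *\<^sub>R b)\<bar> \<le> L * (e * norm h)"
        using lipschitz_onD[OF lip, of "y + t *\<^sub>R b" "x + P S + t *\<^sub>R b"] \<open>L * dist y (x + P S) \<le> L * (e * norm h)\<close>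
        by (simp add: dist_real_def)
      have "e * \<bar>t\<bar> \<le> e * norm h" using t e by (intro mult_left_mono) auto
      then have 3: "\<bar>f (y + t *\<^sub>R b) - f y - (q \<bullet> b) * t\<bar> \<le> e * norm h"
        using sl[OF y(1) b, of t] t h by linarith
      have Pi: "P (insert b S) = P S + t *\<^sub>R b" using insert.hyps by (simp add: P_def t_def)
      have "\<bar>f (x + P S + t *\<^sub>R b) - f (x + P S) - (q \<bullet> b) * t\<bar> \<le> e * norm h + 2 * (L * (e * norm h))"
        using 1 2 3 by linarith
      moreover have "q \<bullet> P (insert b S) = q \<bullet> P S + (q \<bullet> b) * t" unfolding Pi by (simp add: inner_add_right)
      moreover have "\<bar>f (x + P S) - f x - q \<bullet> P S\<bar> \<le> real (card S) * ((1 + 2 * L) * e * norm h)"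
        using insert.IH S by simp
      moreover have "f (x + P (insert b S)) = f (x + P S + t *\<^sub>R b)" unfolding Pi by (simp add: add.assoc)
      ultimately have "\<bar>f (x + P (insert b S)) - f x - q \<bullet> P (insert b S)\<bar> \<le>
          real (card S) * ((1 + 2 * L) * e * norm h) + (e * norm h + 2 * (L * (e * norm h)))"
        by linarith
      also have "\<dots> = real (card (insert b S)) * ((1 + 2 * L) * e * norm h)"
        using insert.hyps by (simp add: algebra_simps)
      finally show ?case .
    qed
    have "P Basis = h" by (simp add: P_def euclidean_representation)
    then show ?thesis using step[of Basis] by (simp add: mult.assoc)
  qed
  then show ?thesis unfolding approx_diff_def using d r
    by (intro exI[of _ q] exI[of _ "min d r"]) auto
qed

lemma countable_rational_vectors: "countable {q::'b::euclidean_space. \<forall>b\<in>Basis. q \<bullet> b \<in> \<rat>}"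
proof -
  have "countable ((\<lambda>g. \<Sum>b\<in>Basis. g b *\<^sub>R b) ` (PiE (Basis::'b set) (\<lambda>_. \<rat>)))"
    by (intro countable_image countable_PiE) (auto simp: countable_rat)
  moreover have "{q::'b. \<forall>b\<in>Basis. q \<bullet> b \<in> \<rat>} \<subseteq> (\<lambda>g. \<Sum>b\<in>Basis. g b *\<^sub>R b) ` (PiE (Basis::'b set) (\<lambda>_. \<rat>))"
  proof
    fix q :: 'b assume q: "q \<in> {q. \<forall>b\<in>Basis. q \<bullet> b \<in> \<rat>}"
    then have "restrict (\<lambda>b. q \<bullet> b) Basis \<in> PiE Basis (\<lambda>_. \<rat>)" by auto
    moreover have "q = (\<Sum>b\<in>Basis. restrict (\<lambda>b. q \<bullet> b) Basis b *\<^sub>R b)" by (simp add: euclidean_representation)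
    ultimately show "q \<in> (\<lambda>g. \<Sum>b\<in>Basis. g b *\<^sub>R b) ` (PiE (Basis::'b set) (\<lambda>_. \<rat>))"
      unfolding image_iff by (intro bexI[of _ "restrict (\<lambda>b. q \<bullet> b) Basis"])
  qed
  ultimately show ?thesis by (rule countable_subset[rotated])
qed

text \<open>A point with approximate slopes along all basis vectors lies in some
  \<open>A (q, n)\<close> with rational \<open>q\<close>. There are countably many of these sets,
  and almost every point of each is a density point of it, where the directional slopes combine into
  a linear approximation. The tolerance \<open>e'\<close> divides out the constant of
  \<open>density_point_approx_diff\<close>.\<close>

lemma lipschitz_approx_diff:
  fixes f :: "'b::euclidean_space \<Rightarrow> real"
  assumes lip: "L-lipschitz_on UNIV f" and e: "e > 0"
  shows "negligible {x. \<not> approx_diff e f x}"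
proof -
  have L0: "L \<ge> 0" using lip by (rule lipschitz_on_nonneg)
  have cont: "continuous_on UNIV f" using lip by (rule lipschitz_on_continuous_on)
  define e' where "e' = e / (real DIM('b) * (1 + 2 * L))"
  have DL: "real DIM('b) * (1 + 2 * L) > 0" using L0 by (intro mult_pos_pos) auto
  have e': "e' > 0" "real DIM('b) * ((1 + 2 * L) * e') = e"
    using DL e L0 by (simp_all add: e'_def mult.assoc[symmetric])
  define A where "A = (\<lambda>(q::'b, n::nat). {x. \<forall>b\<in>Basis. \<forall>t. \<bar>t\<bar> < 1 / Suc n \<longrightarrow> \<bar>f (x + t *\<^sub>R b) - f x - (q \<bullet> b) * t\<bar> \<le> e' * \<bar>t\<bar>})"
  have "closed (A p)" for p
  proof (cases p)
    case (Pair q n)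
    have c: "continuous_on UNIV (\<lambda>x. f (x + h))" for h
      by (rule continuous_on_compose2[OF cont]) (auto intro!: continuous_intros)
    have "closed (\<Inter>b\<in>Basis. \<Inter>t\<in>{t. \<bar>t\<bar> < 1 / Suc n}. {x. \<bar>f (x + t *\<^sub>R b) - f x - (q \<bullet> b) * t\<bar> \<le> e' * \<bar>t\<bar>})"
      by (intro closed_INT ballI closed_Collect_le continuous_on_rabs continuous_on_diff c cont continuous_on_const)
    moreover have "(\<Inter>b\<in>Basis. \<Inter>t\<in>{t. \<bar>t\<bar> < 1 / Suc n}. {x. \<bar>f (x + t *\<^sub>R b) - f x - (q \<bullet> b) * t\<bar> \<le> e' * \<bar>t\<bar>}) = A p"
      unfolding A_def Pair by auto
    ultimately show ?thesis by simp
  qed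
  then have Ab: "A p \<in> sets borel" for p by (rule borel_closed)
  define I where "I = {q::'b. \<forall>b\<in>Basis. q \<bullet> b \<in> \<rat>} \<times> (UNIV :: nat set)"
  define N1 where "N1 = (\<Union>b\<in>(Basis::'b set). {x. \<not> approx_slope e' (\<lambda>t. f (x + t *\<^sub>R b)) 0})"
  define N2 where "N2 = (\<Union>p\<in>I. {x \<in> A p. \<not> density_point (A p) x})"
  have "negligible N1" unfolding N1_def
    by (intro negligible_Union) (auto intro: lipschitz_directional_slope[OF lip e'(1)])
  moreover have "negligible N2" unfolding N2_def I_def
    using lebesgue_density[OF Ab] countable_rational_vectors
    by (intro negligible_countable_Union) (auto intro!: countable_image countable_SIGMA)
  moreover have "{x. \<not> approx_diff e f x} \<subseteq> N1 \<union> N2"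
  proof
    fix x assume x: "x \<in> {x. \<not> approx_diff e f x}"
    show "x \<in> N1 \<union> N2"
    proof (cases "x \<in> N1")
      case False
      then have "\<forall>b\<in>Basis. \<exists>q\<in>\<rat>. \<exists>n::nat. \<forall>h. \<bar>h\<bar> < 1 / Suc n \<longrightarrow> \<bar>f (x + h *\<^sub>R b) - f x - q * h\<bar> \<le> e' * \<bar>h\<bar>"
        unfolding N1_def approx_slope_directional_iff by blast
      then obtain Q n where Q: "\<And>b. b \<in> Basis \<Longrightarrow> Q b \<in> \<rat>"
        "\<And>b h. b \<in> Basis \<Longrightarrow> \<bar>h\<bar> < 1 / Suc (n b) \<Longrightarrow> \<bar>f (x + h *\<^sub>R b) - f x - Q b * h\<bar> \<le> e' * \<bar>h\<bar>"
        by metis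
      define q where "q = (\<Sum>b\<in>Basis. Q b *\<^sub>R b)"
      have qb: "q \<bullet> b = Q b" if "b \<in> Basis" for b using that by (simp add: q_def)
      define m where "m = Max (n ` (Basis :: 'b set))"
      have m: "1 / real (Suc m) \<le> 1 / real (Suc (n b))" if "b \<in> Basis" for b
      proof -
        have "n b \<le> m" unfolding m_def using that by (intro Max_ge) auto
        then show ?thesis by (simp add: field_simps)
      qed
      have xA: "x \<in> A (q, m)" unfolding A_def using Q(2) m qb by (auto intro: less_le_trans)
      have "\<not> density_point (A (q, m)) x"
      proof
        assume "density_point (A (q, m)) x"
        then have "approx_diff (real DIM('b) * ((1 + 2 * L) * e')) f x"
          by (rule density_point_approx_diff[OF lip e'(1) Ab xA, where r = "1 / Suc m" and q = q]) (auto simp: A_def)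
        then show False using x e'(2) by simp
      qed
      moreover have "(q, m) \<in> I" unfolding I_def using qb Q(1) by auto
      ultimately show ?thesis unfolding N2_def using xA by blast
    qed simp
  qed
  ultimately show ?thesis by (meson negligible_Un negligible_subset)
qed

text \<open>Two gradients describing the same increments with tolerances \<open>1 / Suc k\<close>
  and \<open>1 / Suc l\<close> differ by at most the sum of these. So the gradients form a Cauchy
  sequence, and its limit is the derivative.\<close>

lemma approx_diff_differentiable:
  fixes f :: "'b::euclidean_space \<Rightarrow> real"
  assumes "\<And>k::nat. approx_diff (1 / Suc k) f x"
  shows "f differentiable (at x)"
proof -
  have "\<forall>k::nat. \<exists>q r. r > 0 \<and> (\<forall>h. norm h < r \<longrightarrow> \<bar>f (x + h) - f x - q \<bullet> h\<bar> \<le> 1 / Suc k * norm h)"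
    using assms unfolding approx_diff_def by blast
  then obtain q r where r: "\<And>k::nat. r k > 0"
    and q: "\<And>k h. norm h < r k \<Longrightarrow> \<bar>f (x + h) - f x - q k \<bullet> h\<bar> \<le> 1 / Suc k * norm h" by metis
  have qq: "norm (q k - q l) \<le> 1 / Suc k + 1 / Suc l" for k l
  proof (cases "q k = q l")
    case False
    define v where "v = q k - q l"
    have v: "norm v > 0" using False by (simp add: v_def)
    \<comment> \<open>The test vector \<open>s *\<^sub>R v\<close> points along the difference of
      the two gradients and is short enough for both radii.\<close>
    define s where "s = min (r k) (r l) / (2 * norm v)"
    have s: "s > 0" using r v by (simp add: s_def)
    have "norm (s *\<^sub>R v) = min (r k) (r l) / 2" using r[of k] r[of l] v by (simp add: s_def)
    then have "norm (s *\<^sub>R v) < r k" "norm (s *\<^sub>R v) < r l" using r[of k] r[of l] by linarith+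
    then have "\<bar>q k \<bullet> (s *\<^sub>R v) - q l \<bullet> (s *\<^sub>R v)\<bar> \<le> 1 / Suc k * norm (s *\<^sub>R v) + 1 / Suc l * norm (s *\<^sub>R v)"
      using q[of "s *\<^sub>R v" k] q[of "s *\<^sub>R v" l] by linarith
    also have "q k \<bullet> (s *\<^sub>R v) - q l \<bullet> (s *\<^sub>R v) = s * (norm v * norm v)"
    proof -
      have "v \<bullet> v = norm v * norm v" by (simp add: power2_norm_eq_inner[symmetric] power2_eq_square)
      then have "s * ((q k - q l) \<bullet> v) = s * (norm v * norm v)" by (simp add: v_def)
      then show ?thesis by (simp add: inner_diff_left right_diff_distrib)
    qed
    finally have "s * (norm v * norm v) \<le> (1 / Suc k + 1 / Suc l) * (s * norm v)"
      using s v by (simp add: abs_mult distrib_right)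
    then have "(s * norm v) * norm v \<le> (s * norm v) * (1 / Suc k + 1 / Suc l)" by (simp add: mult_ac)
    then show ?thesis using s v unfolding v_def[symmetric] by (simp add: mult_le_cancel_left_pos)
  qed simp
  have "Cauchy q"
  proof (rule metric_CauchyI)
    fix e :: real assume "e > 0"
    then obtain M where M: "1 / real (Suc M) < e / 2" using nat_approx_posE[of "e / 2"] by auto
    have "dist (q k) (q l) < e" if "k \<ge> M" "l \<ge> M" for k l
    proof -
      have "1 / real (Suc k) \<le> 1 / real (Suc M)" "1 / real (Suc l) \<le> 1 / real (Suc M)"
        using that by (auto simp: field_simps)
      then show ?thesis using qq[of k l] M unfolding dist_norm by linarith
    qed
    then show "\<exists>M. \<forall>k\<ge>M. \<forall>l\<ge>M. dist (q k) (q l) < e" by blast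
  qed
  then obtain q0 where q0: "q \<longlonglongrightarrow> q0" using Cauchy_convergent convergent_def by blast
  have "(f has_derivative (\<lambda>h. q0 \<bullet> h)) (at x)"
    unfolding has_derivative_at_alt
  proof (intro conjI allI impI)
    show "bounded_linear ((\<bullet>) q0)" by (rule bounded_linear_inner_right)
    fix e :: real assume e: "e > 0"
    have "\<forall>\<^sub>F k in sequentially. dist (q k) q0 < e / 2" using q0 e by (intro tendstoD) auto
    moreover have "\<forall>\<^sub>F k in sequentially. 1 / real (Suc k) < e / 2"
      by (rule order_tendstoD(2)[OF LIMSEQ_Suc[OF lim_const_over_n, of 1]]) (use e in auto)
    ultimately have "\<forall>\<^sub>F k in sequentially. dist (q k) q0 < e / 2 \<and> 1 / real (Suc k) < e / 2" by eventually_elim auto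
    then obtain k where k: "dist (q k) q0 < e / 2" "1 / real (Suc k) < e / 2"
      unfolding eventually_sequentially by blast
    have "norm (f y - f x - q0 \<bullet> (y - x)) \<le> e * norm (y - x)" if y: "norm (y - x) < r k" for y
    proof -
      have "\<bar>(q k - q0) \<bullet> (y - x)\<bar> \<le> norm (q k - q0) * norm (y - x)" by (rule Cauchy_Schwarz_ineq2)
      also have "\<dots> \<le> e / 2 * norm (y - x)" using k(1) by (intro mult_right_mono) (auto simp: dist_norm)
      finally have "\<bar>q k \<bullet> (y - x) - q0 \<bullet> (y - x)\<bar> \<le> e / 2 * norm (y - x)" by (simp add: inner_diff_left)
      moreover have "\<bar>f y - f x - q k \<bullet> (y - x)\<bar> \<le> e / 2 * norm (y - x)"
      proof -
        have "1 / real (Suc k) * norm (y - x) \<le> e / 2 * norm (y - x)" using k(2) by (intro mult_right_mono) auto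
        from order_trans[OF q[OF y] this] show ?thesis by simp
      qed
      moreover have "e / 2 * norm (y - x) + e / 2 * norm (y - x) = e * norm (y - x)" by simp
      ultimately show ?thesis unfolding real_norm_def by linarith
    qed
    then show "\<exists>d>0. \<forall>y. norm (y - x) < d \<longrightarrow> norm (f y - f x - q0 \<bullet> (y - x)) \<le> e * norm (y - x)"
      using r[of k] by blast
  qed
  then show ?thesis unfolding differentiable_def by blast
qed

theorem rademacher:
  fixes f :: "'b::euclidean_space \<Rightarrow> 'a::euclidean_space"
  assumes lip: "L-lipschitz_on UNIV f"
  shows "negligible {x. \<not> f differentiable (at x)}"
proof -
  have lipi: "L-lipschitz_on UNIV (\<lambda>x. f x \<bullet> i)" if i: "i \<in> Basis" for i
  proof (rule lipschitz_onI)
    fix x y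
    have "dist (f x \<bullet> i) (f y \<bullet> i) \<le> norm (f x - f y)"
      using Basis_le_norm[OF i, of "f x - f y"] by (simp add: dist_real_def inner_diff_left)
    also have "\<dots> \<le> L * dist x y" using lipschitz_onD[OF lip, of x y] by (simp add: dist_norm)
    finally show "dist (f x \<bullet> i) (f y \<bullet> i) \<le> L * dist x y" .
  qed (use lipschitz_on_nonneg[OF lip] in auto)
  define N where "N i = (\<Union>k::nat. {x. \<not> approx_diff (1 / Suc k) (\<lambda>x. f x \<bullet> i) x})" for i
  have "negligible (N i)" if "i \<in> Basis" for i
    unfolding N_def by (intro negligible_countable_Union) (auto intro: lipschitz_approx_diff[OF lipi[OF that]])
  then have "negligible (\<Union>i\<in>Basis. N i)" by (intro negligible_Union) auto
  moreover have "{x. \<not> f differentiable (at x)} \<subseteq> (\<Union>i\<in>Basis. N i)"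
  proof
    fix x assume x: "x \<in> {x. \<not> f differentiable (at x)}"
    show "x \<in> (\<Union>i\<in>Basis. N i)"
    proof (rule ccontr)
      assume "x \<notin> (\<Union>i\<in>Basis. N i)"
      then have "(\<lambda>x. f x \<bullet> i) differentiable (at x)" if "i \<in> Basis" for i
        using that unfolding N_def by (intro approx_diff_differentiable) blast
      then have "f differentiable (at x)"
        by (subst differentiable_componentwise_within) blast
      then show False using x by simp
    qed
  qed
  ultimately show ?thesis by (rule negligible_subset)
qed

section \<open>Decomposition of Lipschitz images into flat pieces\<close>

lemma norm_matrix_vector_le:
  fixes A :: "real^'m^'n"
  shows "norm (A *v h) \<le> real CARD('n) * norm A * norm h"
proof -
  have "norm (A *v h) \<le> (\<Sum>i\<in>UNIV. \<bar>(A *v h) $ i\<bar>)" by (rule norm_le_l1_cart)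
  also have "\<dots> \<le> (\<Sum>i\<in>(UNIV::'n set). norm A * norm h)"
  proof (rule sum_mono)
    fix i :: 'n
    have "(A *v h) $ i = (A $ i) \<bullet> h" by (simp add: matrix_vector_mult_def inner_vec_def)
    then have "\<bar>(A *v h) $ i\<bar> \<le> norm (A $ i) * norm h" using Cauchy_Schwarz_ineq2 by simp
    also have "\<dots> \<le> norm A * norm h" by (intro mult_right_mono Finite_Cartesian_Product.norm_nth_le) auto
    finally show "\<bar>(A *v h) $ i\<bar> \<le> norm A * norm h" .
  qed
  finally show ?thesis by (simp add: mult.assoc)
qed

text \<open>The bound concerns pairs of points instead of a derivative at each point; this is the
  form from which Lipschitz comparison yields areas.\<close>

definition linear_piece :: "(real^'m \<Rightarrow> real^'n) \<Rightarrow> real \<Rightarrow> (real^'m) set \<Rightarrow> real^'m^'n \<Rightarrow> bool" where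
  "linear_piece f e C Q \<longleftrightarrow> (\<forall>x\<in>C. \<forall>y\<in>C. norm (f y - f x - Q *v (y - x)) \<le> e * norm (y - x))"

text \<open>Only countably many matrices may occur, yet the tolerance \<open>\<rho>\<close> varies
  with the matrix and has no positive lower bound; hence a Lindelof subcover of the balls
  \<open>g A\<close> instead of a dense sequence. Half of \<open>\<rho> Q\<close> absorbs the
  passage from the derivative \<open>A\<close> to \<open>Q\<close>, where \<open>c\<close> is the
  factor of \<open>norm_matrix_vector_le\<close>, and the other half the remainder of the
  derivative.\<close>

lemma linear_decomposition:
  fixes f :: "real^'m \<Rightarrow> real^'n" and \<rho> :: "real^'m^'n \<Rightarrow> real"
  assumes cont: "continuous_on UNIV f" and \<rho>: "\<And>A. A \<in> M \<Longrightarrow> \<rho> A > 0"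
  obtains \<P> where "countable \<P>" "\<forall>C Q. (C, Q) \<in> \<P> \<longrightarrow> compact C \<and> Q \<in> M \<and> linear_piece f (\<rho> Q) C Q"
    "{x. \<exists>A\<in>M. (f has_derivative (\<lambda>h. A *v h)) (at x)} \<subseteq> \<Union>(fst ` \<P>)"
proof -
  define c where "c = real CARD('n)"
  have c: "c > 0" by (simp add: c_def)
  define g where "g A = ball A (\<rho> A / (2 * c))" for A
  obtain \<G> where \<G>: "\<G> \<subseteq> g ` M" "countable \<G>" "\<Union>\<G> = \<Union>(g ` M)"
    by (rule Lindelof[of "g ` M"]) (auto simp: g_def)
  then obtain M' where M': "M' \<subseteq> M" "countable M'" "\<G> = g ` M'"
    by (metis countable_subset_image)
  obtain D :: "(real^'m) set" where D: "countable D" "\<And>X. open X \<Longrightarrow> X \<noteq> {} \<Longrightarrow> \<exists>d\<in>D. d \<in> X"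
    using countable_dense_setE by metis
  define B where "B A j = {x. \<forall>h\<in>{h. norm h < 1 / real (Suc j)}. norm (f (x + h) - f x - A *v h) \<le> \<rho> A * norm h}" for A j
  \<comment> \<open>The radius \<open>1 / (4 * real (Suc j))\<close> makes any two points of a piece
    closer than \<open>1 / real (Suc j)\<close>, the range in which \<open>B\<close> controls
    increments.\<close>
  define P where "P = (\<lambda>(A, j, p). (B A j \<inter> cball p (1 / (4 * real (Suc j))), A))"
  have clB: "closed (B A j)" for A j
    unfolding B_def by (rule closed_difference_bound[OF cont])
  show ?thesis
  proof (rule that)
    show "countable (P ` (M' \<times> (UNIV::nat set) \<times> D))" using M'(2) D(1) by (intro countable_image countable_SIGMA) auto
  next
    show "\<forall>C Q. (C, Q) \<in> P ` (M' \<times> (UNIV::nat set) \<times> D) \<longrightarrow> compact C \<and> Q \<in> M \<and> linear_piece f (\<rho> Q) C Q"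
    proof (intro allI impI)
      fix C Q assume "(C, Q) \<in> P ` (M' \<times> (UNIV::nat set) \<times> D)"
      then obtain j p where Q: "Q \<in> M'" and C: "C = B Q j \<inter> cball p (1 / (4 * real (Suc j)))"
        unfolding P_def by auto
      have "compact C" unfolding C using clB by (intro closed_Int_compact) auto
      moreover have "linear_piece f (\<rho> Q) C Q"
        unfolding linear_piece_def
      proof (intro ballI)
        fix x y assume xy: "x \<in> C" "y \<in> C"
        have "dist x y \<le> 1 / (4 * real (Suc j)) + 1 / (4 * real (Suc j))"
          using xy unfolding C by (intro order_trans[OF dist_triangle2[of x y p] add_mono]) (auto simp: dist_commute)
        also have "\<dots> < 1 / real (Suc j)" by (simp add: field_simps)
        finally have "norm (y - x) < 1 / real (Suc j)" by (simp add: dist_norm norm_minus_commute)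
        then have "norm (f (x + (y - x)) - f x - Q *v (y - x)) \<le> \<rho> Q * norm (y - x)"
          using xy(1) unfolding C B_def by blast
        then show "norm (f y - f x - Q *v (y - x)) \<le> \<rho> Q * norm (y - x)" by simp
      qed
      ultimately show "compact C \<and> Q \<in> M \<and> linear_piece f (\<rho> Q) C Q" using Q M' by blast
    qed
  next
    show "{x. \<exists>A\<in>M. (f has_derivative (\<lambda>h. A *v h)) (at x)} \<subseteq> \<Union>(fst ` P ` (M' \<times> (UNIV::nat set) \<times> D))"
    proof
      fix x assume "x \<in> {x. \<exists>A\<in>M. (f has_derivative (\<lambda>h. A *v h)) (at x)}"
      then obtain A where A: "A \<in> M" "(f has_derivative (\<lambda>h. A *v h)) (at x)" by blast
      have "A \<in> g A" using \<rho>[OF A(1)] c by (simp add: g_def)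
      then have "A \<in> \<Union>(g ` M')" using A(1) \<G>(3) M'(3) by blast
      then obtain Q where Q: "Q \<in> M'" "dist Q A < \<rho> Q / (2 * c)" by (auto simp: g_def)
      have \<rho>Q: "\<rho> Q > 0" using Q M' \<rho> by blast
      obtain d where d: "d > 0" "\<And>y. norm (y - x) < d \<Longrightarrow> norm (f y - f x - A *v (y - x)) \<le> \<rho> Q / 2 * norm (y - x)"
        using A(2) \<rho>Q unfolding has_derivative_at_alt by (meson half_gt_zero)
      obtain j where j: "1 / real (Suc j) < d" using nat_approx_posE[OF d(1)] by metis
      have "x \<in> B Q j"
        unfolding B_def
      proof (intro CollectI ballI)
        fix h :: "real^'m" assume "h \<in> {h. norm h < 1 / real (Suc j)}"
        then have h: "norm h < d" using j by simp
        have "norm ((A - Q) *v h) \<le> c * norm (A - Q) * norm h" unfolding c_def by (rule norm_matrix_vector_le)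
        also have "c * norm (A - Q) \<le> \<rho> Q / 2"
          using Q(2) c by (simp add: dist_norm norm_minus_commute field_simps)
        finally have 1: "norm ((A - Q) *v h) \<le> \<rho> Q / 2 * norm h" by (simp add: mult_right_mono)
        have 2: "norm (f (x + h) - f x - A *v h) \<le> \<rho> Q / 2 * norm h" using d(2)[of "x + h"] h by simp
        have eq: "f (x + h) - f x - Q *v h = (f (x + h) - f x - A *v h) + (A - Q) *v h"
          by (simp add: matrix_vector_mult_diff_rdistrib)
        have "norm (f (x + h) - f x - Q *v h) \<le> norm (f (x + h) - f x - A *v h) + norm ((A - Q) *v h)"
          by (subst eq) (rule norm_triangle_ineq)
        then show "norm (f (x + h) - f x - Q *v h) \<le> \<rho> Q * norm h" using 1 2 by simp
      qed
      moreover obtain p where "p \<in> D" "p \<in> ball x (1 / (4 * real (Suc j)))"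
        using D(2)[of "ball x (1 / (4 * real (Suc j)))"] by auto
      ultimately have "x \<in> fst (P (Q, j, p))" by (simp add: P_def dist_commute)
      moreover have "(Q, j, p) \<in> M' \<times> UNIV \<times> D" using Q \<open>p \<in> D\<close> by simp
      ultimately show "x \<in> \<Union>(fst ` P ` (M' \<times> (UNIV::nat set) \<times> D))" by blast
    qed
  qed
qed

section \<open>Null images of the parameters with a singular derivative\<close>

lemma emeasure_linear_image:
  fixes T :: "real^'m::{finite,wellorder} \<Rightarrow> real^'m::_"
  assumes T: "linear T" "inj T" and A: "A \<in> sets borel" "bounded A"
  shows "T ` A \<in> sets borel" "emeasure lborel (T ` A) = ennreal \<bar>det (matrix T)\<bar> * emeasure lborel A"
proof -
  obtain g where g: "linear g" "g \<circ> T = id" using linear_injective_left_inverse[OF T] by blast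
  have "surj T" using T linear_injective_imp_surjective by blast
  have gT: "g (T x) = x" for x using g(2) by (simp add: fun_eq_iff)
  have "T ` A = g -` A" using \<open>surj T\<close> by (auto simp: gT) (metis gT image_eqI surjE)
  moreover have "g \<in> borel_measurable borel"
    using linear_continuous_on[OF g(1)[unfolded linear_conv_bounded_linear]] by (rule borel_measurable_continuous_onI)
  ultimately show TA: "T ` A \<in> sets borel" using measurable_sets[of g borel borel A] A by simp
  have Al: "A \<in> lmeasurable" using A by (intro bounded_set_imp_lmeasurable) auto
  have "emeasure lborel (T ` A) = emeasure lebesgue (T ` A)" using TA by simp
  also have "\<dots> = ennreal (measure lebesgue (T ` A))"
    using measurable_linear_image[OF T(1) Al] by (rule emeasure_eq_measure2)
  also have "\<dots> = ennreal \<bar>det (matrix T)\<bar> * ennreal (measure lebesgue A)"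
    unfolding measure_linear_image[OF T(1) Al] by (simp add: ennreal_mult)
  also have "ennreal (measure lebesgue A) = emeasure lebesgue A" using Al by (rule emeasure_eq_measure2[symmetric])
  also have "\<dots> = emeasure lborel A" using A by simp
  finally show "emeasure lborel (T ` A) = ennreal \<bar>det (matrix T)\<bar> * emeasure lborel A" .
qed

text \<open>
  A map that is close to a singular linear map with kernel vector \<open>k\<close> is 2-Lipschitz with respect to a
  linear bijection that nearly collapses \<open>k\<close> and hence has a small determinant.
\<close>

definition squeeze :: "real \<Rightarrow> 'b::real_inner \<Rightarrow> real \<Rightarrow> 'b \<Rightarrow> 'b" where
  "squeeze l k r x = l *\<^sub>R (x - (x \<bullet> k) *\<^sub>R k) + (r * (x \<bullet> k)) *\<^sub>R k"

lemma squeeze_linear: "linear (squeeze l k r)"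
  by (rule linearI) (simp_all add: squeeze_def inner_add_left scaleR_add_left algebra_simps)

lemma squeeze_norm_bounds:
  fixes k :: "'b::real_inner"
  assumes k: "norm k = 1" and l: "l \<ge> 0" and r: "r \<ge> 0"
  shows "l * norm (x - (x \<bullet> k) *\<^sub>R k) \<le> norm (squeeze l k r x)" "r * \<bar>x \<bullet> k\<bar> \<le> norm (squeeze l k r x)"
proof -
  define p where "p = l *\<^sub>R (x - (x \<bullet> k) *\<^sub>R k)"
  define q where "q = (r * (x \<bullet> k)) *\<^sub>R k"
  have kk: "k \<bullet> k = 1" using k by (simp add: dot_square_norm)
  have "p \<bullet> q = 0" by (simp add: p_def q_def inner_diff_left kk)
  then have eq: "(norm (p + q))\<^sup>2 = (norm p)\<^sup>2 + (norm q)\<^sup>2"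
    by (simp add: power2_norm_eq_inner inner_add_left inner_add_right inner_commute)
  have "(norm p)\<^sup>2 \<le> (norm (p + q))\<^sup>2" "(norm q)\<^sup>2 \<le> (norm (p + q))\<^sup>2" unfolding eq by auto
  then have "norm p \<le> norm (p + q)" "norm q \<le> norm (p + q)" by (auto intro: power2_le_imp_le)
  then show "l * norm (x - (x \<bullet> k) *\<^sub>R k) \<le> norm (squeeze l k r x)" "r * \<bar>x \<bullet> k\<bar> \<le> norm (squeeze l k r x)"
    using k l r by (simp_all add: p_def q_def squeeze_def abs_mult)
qed

text \<open>At \<open>r = 0\<close> the map annihilates \<open>k\<close>, so the determinant
  vanishes there; being a polynomial in \<open>r\<close>, it is continuous.\<close>

lemma det_squeeze_tendsto:
  fixes k :: "real^'m::{finite,wellorder}"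
  assumes k: "norm k = 1"
  shows "((\<lambda>r. det (matrix (squeeze l k r))) \<longlongrightarrow> 0) (at 0)"
proof -
  have kk: "k \<bullet> k = 1" using k by (simp add: dot_square_norm)
  have "squeeze l k 0 k = squeeze l k 0 0" by (simp add: squeeze_def kk)
  moreover have "k \<noteq> 0" using k by auto
  ultimately have "\<not> inj (squeeze l k 0)" by (metis injD)
  then have d0: "det (matrix (squeeze l k 0)) = 0" using det_nz_iff_inj[OF squeeze_linear] by blast
  have "((\<lambda>r. det (matrix (squeeze l k r))) \<longlongrightarrow> det (matrix (squeeze l k 0))) (at 0)"
    unfolding det_def matrix_def squeeze_def vec_lambda_beta by (intro tendsto_intros)
  then show ?thesis using d0 by simp
qed

lemma singular_piece:
  fixes Q :: "real^'m::{finite,wellorder}^'n"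
  assumes sing: "\<not> inj ((*v) Q)" and \<eta>: "\<eta> > 0"
  obtains e where "e > 0" "\<And>f C. linear_piece f e C Q \<Longrightarrow> C \<in> sets borel \<Longrightarrow> bounded C \<Longrightarrow>
    hausdorff_outer CARD('m) (f ` C) \<le> ennreal \<eta> * emeasure lborel C"
proof -
  obtain u where u: "u \<noteq> 0" "Q *v u = 0"
    using sing linear_injective_0[of "(*v) Q"] by (auto simp: matrix_vector_mul_linear)
  define k where "k = u /\<^sub>R norm u"
  have k: "norm k = 1" "Q *v k = 0" using u by (simp_all add: k_def matrix_vector_mult_scaleR)
  define L where "L = real CARD('n) * norm Q"
  have L: "L \<ge> 0" by (simp add: L_def)
  have "((\<lambda>r. 2 ^ CARD('m) * \<bar>det (matrix (squeeze (L + 1) k r))\<bar>) \<longlongrightarrow> 2 ^ CARD('m) * \<bar>0\<bar>) (at_right 0)"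
    by (intro tendsto_intros filterlim_mono[OF det_squeeze_tendsto[OF k(1)]]) (auto simp: at_le)
  then have "\<forall>\<^sub>F r in at_right 0. 2 ^ CARD('m) * \<bar>det (matrix (squeeze (L + 1) k r))\<bar> < \<eta>"
    using \<eta> by (intro order_tendstoD(2)) auto
  moreover have "\<forall>\<^sub>F r in at_right (0::real). 0 < r \<and> r < 1" by (auto simp: eventually_at_right_field intro: exI[of _ 1])
  ultimately have "\<forall>\<^sub>F r in at_right 0. 2 ^ CARD('m) * \<bar>det (matrix (squeeze (L + 1) k r))\<bar> < \<eta> \<and> 0 < r \<and> r < 1"
    by eventually_elim auto
  \<comment> \<open>The same \<open>e\<close> serves as the tolerance for \<open>f\<close> and as
    the factor of \<open>T\<close> along \<open>k\<close>.\<close>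
  then obtain e where e: "2 ^ CARD('m) * \<bar>det (matrix (squeeze (L + 1) k e))\<bar> < \<eta>" "0 < e" "e < 1"
    using eventually_happens'[OF trivial_limit_at_right_real] by blast
  define T where "T = squeeze (L + 1) k e"
  have linT: "linear T" unfolding T_def by (rule squeeze_linear)
  \<comment> \<open>\<open>Q\<close> does not see the component along \<open>k\<close>, so
    \<open>norm (Q *v v)\<close> is at most \<open>L * norm w\<close>. The factor
    \<open>L + 1\<close> of \<open>T\<close> on \<open>w\<close> covers this together with
    \<open>e * norm w\<close>; its factor \<open>e\<close> along \<open>k\<close> covers the rest of
    \<open>e * norm v\<close>.\<close>
  have low: "norm (Q *v v) + e * norm v \<le> 2 * norm (T v)" for v
  proof -
    define w where "w = v - (v \<bullet> k) *\<^sub>R k"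
    have "Q *v w = Q *v v" by (simp add: w_def matrix_vector_mult_diff_distrib matrix_vector_mult_scaleR k)
    then have 1: "norm (Q *v v) \<le> L * norm w" unfolding L_def using norm_matrix_vector_le[of Q w] by simp
    have "norm v \<le> norm w + \<bar>v \<bullet> k\<bar>" using norm_triangle_ineq[of w "(v \<bullet> k) *\<^sub>R k"] k by (simp add: w_def)
    then have "e * norm v \<le> e * (norm w + \<bar>v \<bullet> k\<bar>)" using e by (intro mult_left_mono) auto
    moreover have "e * norm w \<le> 1 * norm w" using e by (intro mult_right_mono) auto
    ultimately have "norm (Q *v v) + e * norm v \<le> (L + 1) * norm w + e * \<bar>v \<bullet> k\<bar>"
      using 1 by (simp add: algebra_simps)
    also have "\<dots> \<le> norm (T v) + norm (T v)"
      unfolding T_def w_def using squeeze_norm_bounds[OF k(1), of "L + 1" e v] L e by (intro add_mono) auto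
    finally show ?thesis by simp
  qed
  have injT: "inj T"
  proof -
    have "v = 0" if Tv: "T v = 0" for v
    proof -
      have "norm (Q *v v) + e * norm v \<le> 0" using low[of v] Tv by simp
      then have "e * norm v \<le> 0" by (meson add_increasing norm_ge_zero order_trans add_nonneg_nonneg le_add_same_cancel2 dual_order.trans)
      then show ?thesis using e by (simp add: mult_le_0_iff)
    qed
    then show ?thesis using linear_injective_0[OF linT] by blast
  qed
  show ?thesis
  proof (rule that)
    show "e > 0" by (rule e)
    fix f :: "(real,'m) vec \<Rightarrow> real^'n" and C
    assume lp: "linear_piece f e C Q" and C: "C \<in> sets borel" "bounded C"
    have "hausdorff_outer CARD('m) (f ` C) \<le> ennreal (2 ^ CARD('m)) * hausdorff_outer CARD('m) (T ` C)"
    proof (rule hausdorff_outer_lipschitz)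
      fix x y assume xy: "x \<in> C" "y \<in> C"
      have "norm (f x - f y - Q *v (x - y)) \<le> e * norm (x - y)" using lp xy unfolding linear_piece_def by blast
      then have "norm (f x - f y) \<le> norm (Q *v (x - y)) + e * norm (x - y)"
        using norm_triangle_sub[of "f x - f y" "Q *v (x - y)"] by linarith
      also have "\<dots> \<le> 2 * norm (T (x - y))" by (rule low)
      finally show "dist (f x) (f y) \<le> 2 * dist (T x) (T y)" by (simp add: dist_norm linear_diff[OF linT])
    qed simp
    also have "hausdorff_outer CARD('m) (T ` C) = emeasure lborel (T ` C)"
      using hausdorff_outer_eq_lborel[OF emeasure_linear_image(1)[OF linT injT C]] by simp
    also have "\<dots> = ennreal \<bar>det (matrix T)\<bar> * emeasure lborel C" by (rule emeasure_linear_image(2)[OF linT injT C])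
    also have "ennreal (2 ^ CARD('m)) * (ennreal \<bar>det (matrix T)\<bar> * emeasure lborel C) =
        ennreal (2 ^ CARD('m) * \<bar>det (matrix T)\<bar>) * emeasure lborel C"
      by (subst ennreal_mult) (auto simp: mult.assoc)
    also have "\<dots> \<le> ennreal \<eta> * emeasure lborel C"
      using e(1) unfolding T_def by (intro mult_right_mono ennreal_leI) auto
    finally show "hausdorff_outer CARD('m) (f ` C) \<le> ennreal \<eta> * emeasure lborel C" .
  qed
qed

lemma linear_piece_subset: "linear_piece f e C Q \<Longrightarrow> D \<subseteq> C \<Longrightarrow> linear_piece f e D Q"
  unfolding linear_piece_def by blast

text \<open>The area factor of a singular piece can be any \<open>\<eta> > 0\<close>. Inside a ball,
  disjoint pieces then have images of total area at most \<open>\<eta>\<close> times the volume of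
  the ball, and \<open>\<eta>\<close> is arbitrary.\<close>

lemma hausdorff_outer_singular_image:
  fixes f :: "real^'m::{finite,wellorder} \<Rightarrow> real^'n"
  assumes cont: "continuous_on UNIV f"
  shows "hausdorff_outer CARD('m) (f ` {x. \<exists>A. \<not> inj ((*v) A) \<and> (f has_derivative (\<lambda>h. A *v h)) (at x)}) = 0"
proof -
  define D where "D = {x. \<exists>A. \<not> inj ((*v) A) \<and> (f has_derivative (\<lambda>h. A *v h)) (at x)}"
  have loc: "hausdorff_outer CARD('m) (f ` (D \<inter> cball 0 R)) \<le> ennreal \<eta> * emeasure lborel (cball (0::(real,'m) vec) R)"
    if \<eta>: "\<eta> > 0" for \<eta> R
  proof -
    define M where "M = {A::((real,'m) vec,'n) vec. \<not> inj ((*v) A)}"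
    define good where "good e A \<longleftrightarrow> e > 0 \<and> (\<forall>f C. linear_piece f e C A \<longrightarrow> C \<in> sets borel \<longrightarrow> bounded C \<longrightarrow>
      hausdorff_outer CARD('m) (f ` C) \<le> ennreal \<eta> * emeasure lborel C)" for e and A :: "((real,'m) vec,'n) vec"
    have "\<forall>A. \<exists>e. A \<in> M \<longrightarrow> good e A"
    proof
      fix A :: "((real,'m) vec,'n) vec"
      show "\<exists>e. A \<in> M \<longrightarrow> good e A"
      proof (cases "inj ((*v) A)")
        case False
        show ?thesis
          by (rule singular_piece[OF False \<eta>]) (auto simp: good_def)
      qed (simp add: M_def)
    qed
    then obtain \<rho> where "\<forall>A. A \<in> M \<longrightarrow> good (\<rho> A) A" by (rule choice[THEN exE])
    then have \<rho>: "\<And>A. A \<in> M \<Longrightarrow> \<rho> A > 0"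
      "\<And>A f C. A \<in> M \<Longrightarrow> linear_piece f (\<rho> A) C A \<Longrightarrow> C \<in> sets borel \<Longrightarrow> bounded C \<Longrightarrow>
        hausdorff_outer CARD('m) (f ` C) \<le> ennreal \<eta> * emeasure lborel C"
      unfolding good_def by blast+
    obtain \<P> where P: "countable \<P>" "\<forall>C Q. (C, Q) \<in> \<P> \<longrightarrow> compact C \<and> Q \<in> M \<and> linear_piece f (\<rho> Q) C Q"
      "{x. \<exists>A\<in>M. (f has_derivative (\<lambda>h. A *v h)) (at x)} \<subseteq> \<Union>(fst ` \<P>)"
      by (rule linear_decomposition[where \<rho> = \<rho> and M = M, OF cont \<rho>(1)])
    show ?thesis
    proof (cases "\<P> = {}")
      case True
      then have "D = {}" using P(3) unfolding D_def M_def by auto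
      then show ?thesis by (simp add: hausdorff_outer_empty)
    next
      case False
      define p where "p = from_nat_into \<P>"
      have pP: "p n \<in> \<P>" for n using False unfolding p_def by (rule from_nat_into)
      have rp: "range p = \<P>" using False P(1) unfolding p_def by (rule range_from_nat_into)
      define E where "E n = fst (p n) \<inter> cball 0 R" for n
      have "E n \<in> sets borel" for n
        using P(2)[rule_format, of "fst (p n)" "snd (p n)"] pP[of n] unfolding E_def by (auto intro!: sets.Int borel_closed compact_imp_closed)
      then have dE: "disjointed E n \<in> sets borel" for n using sets.range_disjointed_sets[of E borel] by auto
      have sub: "D \<inter> cball 0 R \<subseteq> (\<Union>n. disjointed E n)"
      proof -
        have "D \<subseteq> \<Union>(fst ` \<P>)" using P(3) unfolding D_def M_def by auto
        then show ?thesis unfolding UN_disjointed_eq E_def rp[symmetric] by auto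
      qed
      have "hausdorff_outer CARD('m) (f ` (D \<inter> cball 0 R)) \<le> hausdorff_outer CARD('m) (\<Union>n. f ` disjointed E n)"
        using sub by (intro hausdorff_outer_mono) blast
      also have "\<dots> \<le> (\<Sum>n. hausdorff_outer CARD('m) (f ` disjointed E n))"
        by (rule hausdorff_outer_subadditive)
      also have "\<dots> \<le> (\<Sum>n. ennreal \<eta> * emeasure lborel (disjointed E n))"
      proof (intro suminf_le allI)
        fix n
        have 1: "snd (p n) \<in> M" "linear_piece f (\<rho> (snd (p n))) (fst (p n)) (snd (p n))"
          using P(2)[rule_format, of "fst (p n)" "snd (p n)"] pP[of n] by auto
        have 2: "disjointed E n \<subseteq> fst (p n)" "disjointed E n \<subseteq> cball 0 R"
          using disjointed_subset[of E n] unfolding E_def by auto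
        show "hausdorff_outer CARD('m) (f ` disjointed E n) \<le> ennreal \<eta> * emeasure lborel (disjointed E n)"
          by (rule \<rho>(2)[OF 1(1) linear_piece_subset[OF 1(2) 2(1)] dE bounded_subset[OF bounded_cball 2(2)]])
      qed auto
      also have "\<dots> = ennreal \<eta> * (\<Sum>n. emeasure lborel (disjointed E n))" by (rule ennreal_suminf_cmult)
      also have "(\<Sum>n. emeasure lborel (disjointed E n)) = emeasure lborel (\<Union>n. disjointed E n)"
        using dE by (intro suminf_emeasure disjoint_family_disjointed) auto
      also have "\<dots> \<le> emeasure lborel (cball (0::(real,'m) vec) R)"
        unfolding UN_disjointed_eq E_def by (intro emeasure_mono) auto
      finally show ?thesis by (simp add: mult_left_mono)
    qed
  qed
  have zero: "hausdorff_outer CARD('m) (f ` (D \<inter> cball 0 (real n))) = 0" for n :: nat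
  proof -
    define V where "V = measure lborel (cball (0::(real,'m) vec) (real n))"
    have V: "emeasure lborel (cball (0::(real,'m) vec) (real n)) = ennreal V"
      unfolding V_def using emeasure_lborel_cball_finite[of "0::(real,'m) vec" "real n"] by (intro emeasure_eq_ennreal_measure) auto
    have V0: "V \<ge> 0" by (simp add: V_def)
    have le: "hausdorff_outer CARD('m) (f ` (D \<inter> cball 0 (real n))) \<le> 0 + ennreal e" if e: "e > 0" for e
    proof -
      have "hausdorff_outer CARD('m) (f ` (D \<inter> cball 0 (real n))) \<le> ennreal (e / (V + 1)) * ennreal V"
        unfolding V[symmetric] using e V0 by (intro loc) simp
      also have "\<dots> = ennreal (e / (V + 1) * V)" using e V0 by (intro ennreal_mult[symmetric]) auto
      also have "\<dots> \<le> ennreal e" using e V0 by (intro ennreal_leI) (simp add: field_simps)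
      finally show ?thesis by simp
    qed
    have "hausdorff_outer CARD('m) (f ` (D \<inter> cball 0 (real n))) \<le> 0" by (rule ennreal_le_epsilon) (rule le)
    then show ?thesis by simp
  qed
  have "f ` D \<subseteq> (\<Union>n::nat. f ` (D \<inter> cball 0 (real n)))"
  proof
    fix y assume "y \<in> f ` D"
    then obtain x where x: "x \<in> D" "y = f x" by blast
    obtain n :: nat where "norm x \<le> real n" using real_arch_simple by blast
    then have "y \<in> f ` (D \<inter> cball 0 (real n))" using x by (intro image_eqI[of _ _ x]) auto
    then show "y \<in> (\<Union>n::nat. f ` (D \<inter> cball 0 (real n)))" by blast
  qed
  then have "hausdorff_outer CARD('m) (f ` D) \<le> hausdorff_outer CARD('m) (\<Union>n::nat. f ` (D \<inter> cball 0 (real n)))"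
    by (rule hausdorff_outer_mono)
  also have "\<dots> \<le> (\<Sum>n. hausdorff_outer CARD('m) (f ` (D \<inter> cball 0 (real n))))" by (rule hausdorff_outer_subadditive)
  also have "\<dots> = 0" by (simp add: zero)
  finally show ?thesis by (simp add: D_def)
qed

lemma hausdorff_outer_null_Un:
  "hausdorff_outer m A = 0 \<Longrightarrow> hausdorff_outer m B = 0 \<Longrightarrow> hausdorff_outer m (A \<union> B) = 0"
  using hausdorff_outer_Un[of m A B] by simp

lemma hausdorff_outer_null_subset: "hausdorff_outer m B = 0 \<Longrightarrow> A \<subseteq> B \<Longrightarrow> hausdorff_outer m A = 0"
  using hausdorff_outer_mono[of A B m] by simp

text \<open>The pieces miss only the points of non-differentiability, a null set that a Lipschitz
  map keeps null, and points with a singular derivative, whose image is null.\<close>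

lemma lipschitz_pieces:
  fixes f :: "real^'m::{finite,wellorder} \<Rightarrow> real^'n" and \<rho> :: "((real,'m) vec,'n) vec \<Rightarrow> real"
  assumes lip: "L-lipschitz_on UNIV f" and \<rho>: "\<And>A. inj ((*v) A) \<Longrightarrow> \<rho> A > 0"
  obtains \<P> where "countable \<P>" "\<forall>C Q. (C, Q) \<in> \<P> \<longrightarrow> compact C \<and> inj ((*v) Q) \<and> linear_piece f (\<rho> Q) C Q"
    "hausdorff_outer CARD('m) (f ` (UNIV - \<Union>(fst ` \<P>))) = 0"
proof -
  have cont: "continuous_on UNIV f" using lip by (rule lipschitz_on_continuous_on)
  define M where "M = {A::((real,'m) vec,'n) vec. inj ((*v) A)}"
  have \<rho>M: "\<rho> A > 0" if "A \<in> M" for A using \<rho> that by (simp add: M_def)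
  obtain \<P> where P: "countable \<P>" "\<forall>C Q. (C, Q) \<in> \<P> \<longrightarrow> compact C \<and> Q \<in> M \<and> linear_piece f (\<rho> Q) C Q"
      "{x. \<exists>A\<in>M. (f has_derivative (\<lambda>h. A *v h)) (at x)} \<subseteq> \<Union>(fst ` \<P>)"
    by (rule linear_decomposition[where \<rho> = \<rho> and M = M, OF cont \<rho>M])
  define N where "N = {x. \<not> f differentiable (at x)}"
  define D where "D = {x. \<exists>A. \<not> inj ((*v) A) \<and> (f has_derivative (\<lambda>h. A *v h)) (at x)}"
  have "hausdorff_outer CARD('m) (f ` N) = 0"
  proof -
    have "hausdorff_outer CARD('m) (f ` N) \<le> ennreal ((L + 1) ^ CARD('m)) * hausdorff_outer CARD('m) ((\<lambda>x. x) ` N)"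
    proof (rule hausdorff_outer_lipschitz)
      show "L + 1 > 0" using lipschitz_on_nonneg[OF lip] by linarith
      fix x y
      have "dist (f x) (f y) \<le> L * dist x y" using lipschitz_onD[OF lip] by simp
      also have "\<dots> \<le> (L + 1) * dist x y" by (intro mult_right_mono) auto
      finally show "dist (f x) (f y) \<le> (L + 1) * dist x y" .
    qed
    also have "hausdorff_outer CARD('m) ((\<lambda>x. x) ` N) = 0"
      using hausdorff_outer_null[OF rademacher[OF lip]] by (simp add: N_def)
    finally show ?thesis by simp
  qed
  moreover have "hausdorff_outer CARD('m) (f ` D) = 0"
    unfolding D_def by (rule hausdorff_outer_singular_image[OF cont])
  ultimately have z: "hausdorff_outer CARD('m) (f ` N \<union> f ` D) = 0" by (rule hausdorff_outer_null_Un)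
  have "UNIV - \<Union>(fst ` \<P>) \<subseteq> N \<union> D"
  proof
    fix x assume x: "x \<in> UNIV - \<Union>(fst ` \<P>)"
    show "x \<in> N \<union> D"
    proof (cases "f differentiable (at x)")
      case True
      then obtain f' where f': "(f has_derivative f') (at x)" unfolding differentiable_def by blast
      then have "f' = (\<lambda>h. matrix f' *v h)"
        using matrix_vector_mul(2)[OF has_derivative_linear[OF f']] by (simp add: fun_eq_iff)
      then have d: "(f has_derivative (\<lambda>h. matrix f' *v h)) (at x)" using f' by simp
      then have "matrix f' \<notin> M" using P(3) x by blast
      then show ?thesis using d unfolding D_def M_def by blast
    qed (simp add: N_def)
  qed
  then have "f ` (UNIV - \<Union>(fst ` \<P>)) \<subseteq> f ` N \<union> f ` D" by blast
  from hausdorff_outer_null_subset[OF z this] show ?thesis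
    using P(1,2) by (intro that[of \<P>]) (auto simp: M_def)
qed

section \<open>Counting intersections with lines\<close>

abbreviation (input) ecard :: "'x set \<Rightarrow> ennreal" where
  "ecard A \<equiv> emeasure (count_space UNIV) A"

lemma ecard_image: "inj_on f A \<Longrightarrow> ecard (f ` A) = ecard A"
  by (cases "finite A") (auto simp: emeasure_count_space_finite emeasure_count_space_infinite card_image finite_image_iff)

lemma ecard_image_le: "ecard (f ` A) \<le> ecard A"
  by (cases "finite A")
    (auto simp: emeasure_count_space_finite emeasure_count_space_infinite card_image_le)

text \<open>Turns a count into a series of indicator functions, the form needed for
  measurability.\<close>

lemma ecard_int: "ecard (A :: int set) = (\<Sum>n. indicator A (int_decode n))"
proof -
  have "ecard A = (\<integral>\<^sup>+i. indicator A i \<partial>count_space UNIV)" by (simp add: nn_integral_indicator)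
  also have "\<dots> = (\<integral>\<^sup>+n. indicator A (int_decode n) \<partial>count_space UNIV)"
    by (rule nn_integral_bij_count_space[symmetric]) (rule bij_int_decode)
  also have "\<dots> = (\<Sum>n. indicator A (int_decode n))" by (rule nn_integral_count_space_nat)
  finally show ?thesis .
qed

lemma ecard_geI:
  assumes "\<And>S. finite S \<Longrightarrow> S \<subseteq> T \<Longrightarrow> of_nat (card S) \<le> c"
  shows "ecard T \<le> c"
proof (cases "finite T")
  case True
  then show ?thesis using assms[of T] by (simp add: emeasure_count_space_finite)
next
  case False
  have "of_nat n \<le> c" for n :: nat
  proof -
    obtain S where "finite S" "card S = n" "S \<subseteq> T" using infinite_arbitrarily_large[OF False] by blast
    then show ?thesis using assms by blast
  qed
  then have "(SUP n. of_nat n :: ennreal) \<le> c" by (intro SUP_least) auto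
  then show ?thesis by (simp add: ennreal_SUP_of_nat_eq_top top_unique)
qed

lemma eventually_inj_on_floor:
  assumes "finite (S :: real set)"
  shows "\<forall>\<^sub>F k in sequentially. inj_on (\<lambda>t. \<lfloor>real (Suc k) * t\<rfloor>) S"
proof -
  have "\<forall>\<^sub>F k in sequentially. \<forall>s\<in>S. \<forall>t\<in>S. s < t \<longrightarrow> \<lfloor>real (Suc k) * s\<rfloor> < \<lfloor>real (Suc k) * t\<rfloor>"
  proof (intro eventually_ball_finite assms ballI)
    fix s t assume "s \<in> S" "t \<in> S"
    show "\<forall>\<^sub>F k in sequentially. s < t \<longrightarrow> \<lfloor>real (Suc k) * s\<rfloor> < \<lfloor>real (Suc k) * t\<rfloor>"
    proof (cases "s < t")
      case True
      obtain M where M: "1 / real (Suc M) < t - s" using nat_approx_posE[of "t - s"] True by auto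
      have "\<lfloor>real (Suc k) * s\<rfloor> < \<lfloor>real (Suc k) * t\<rfloor>" if "k \<ge> M" for k
      proof -
        have "1 \<le> real (Suc M) * (t - s)" using M by (simp add: field_simps)
        also have "\<dots> \<le> real (Suc k) * (t - s)" using that True by (intro mult_right_mono) auto
        finally have "real (Suc k) * s + 1 \<le> real (Suc k) * t" by (simp add: right_diff_distrib)
        then show ?thesis by linarith
      qed
      then show ?thesis unfolding eventually_sequentially by blast
    qed simp
  qed
  then show ?thesis
  proof eventually_elim
    case (elim k)
    show ?case
    proof (rule inj_onI)
      fix s t assume "s \<in> S" "t \<in> S" "\<lfloor>real (Suc k) * s\<rfloor> = \<lfloor>real (Suc k) * t\<rfloor>"
      then show "s = t" using elim by (metis less_irrefl linorder_neqE_linordered_idom)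
    qed
  qed
qed

text \<open>
  Counting cells of width \<open>1 / (k + 1)\<close> instead of points makes intersection numbers measurable, and
  by Fatou's lemma bounds the projected area, with multiplicity, by the area.
\<close>

lemma ecard_eq_liminf_floor:
  "ecard T = liminf (\<lambda>k. ecard ((\<lambda>t. \<lfloor>real (Suc k) * t\<rfloor>) ` T))"
proof (rule antisym)
  show "ecard T \<le> liminf (\<lambda>k. ecard ((\<lambda>t. \<lfloor>real (Suc k) * t\<rfloor>) ` T))"
  proof (rule ecard_geI)
    fix S assume S: "finite S" "S \<subseteq> T"
    show "of_nat (card S) \<le> liminf (\<lambda>k. ecard ((\<lambda>t. \<lfloor>real (Suc k) * t\<rfloor>) ` T))"
    proof (rule Liminf_bounded)
      show "\<forall>\<^sub>F k in sequentially. of_nat (card S) \<le> ecard ((\<lambda>t. \<lfloor>real (Suc k) * t\<rfloor>) ` T)"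
        using eventually_inj_on_floor[OF S(1)]
      proof eventually_elim
        case (elim k)
        have "of_nat (card S) = ecard ((\<lambda>t. \<lfloor>real (Suc k) * t\<rfloor>) ` S)"
          unfolding ecard_image[OF elim] using S by (simp add: emeasure_count_space_finite)
        also have "\<dots> \<le> ecard ((\<lambda>t. \<lfloor>real (Suc k) * t\<rfloor>) ` T)" using S by (intro emeasure_mono) auto
        finally show ?case .
      qed
    qed
  qed
next
  have "liminf (\<lambda>k. ecard ((\<lambda>t. \<lfloor>real (Suc k) * t\<rfloor>) ` T)) \<le> liminf (\<lambda>k::nat. ecard T)"
    by (intro Liminf_mono always_eventually allI ecard_image_le)
  then show "liminf (\<lambda>k. ecard ((\<lambda>t. \<lfloor>real (Suc k) * t\<rfloor>) ` T)) \<le> ecard T"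
    by (simp add: Liminf_const)
qed

section \<open>Countable unions of closed sets\<close>

definition F_sigma :: "'a::topological_space set \<Rightarrow> bool" where
  "F_sigma F \<longleftrightarrow> (\<exists>C :: nat \<Rightarrow> 'a set. (\<forall>i. closed (C i)) \<and> F = (\<Union>i. C i))"

lemma F_sigma_borel: "F_sigma F \<Longrightarrow> F \<in> sets borel"
  unfolding F_sigma_def by auto

lemma F_sigma_closed: "closed F \<Longrightarrow> F_sigma F"
  unfolding F_sigma_def by (intro exI[of _ "\<lambda>_. F"]) auto

lemma F_sigma_UN:
  assumes "\<And>i::nat. F_sigma (F i)"
  shows "F_sigma (\<Union>i. F i)"
proof -
  obtain C :: "nat \<Rightarrow> nat \<Rightarrow> 'a set" where C: "\<And>i j. closed (C i j)" "\<And>i. F i = (\<Union>j. C i j)"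
    using assms unfolding F_sigma_def by metis
  have "(\<Union>i. F i) = (\<Union>k. case prod_decode k of (i, j) \<Rightarrow> C i j)"
    unfolding C(2) by (auto simp: case_prod_unfold) (metis fst_conv prod_encode_inverse snd_conv)
  then show ?thesis unfolding F_sigma_def using C(1)
    by (intro exI[of _ "\<lambda>k. case prod_decode k of (i, j) \<Rightarrow> C i j"]) (auto split: prod.split)
qed

lemma F_sigma_Int:
  assumes "F_sigma F" "F_sigma G"
  shows "F_sigma (F \<inter> G)"
proof -
  obtain C D where C: "\<And>i::nat. closed (C i)" "F = (\<Union>i. C i)" and D: "\<And>i::nat. closed (D i)" "G = (\<Union>i. D i)"
    using assms unfolding F_sigma_def by blast
  have "F \<inter> G = (\<Union>i. \<Union>j. C i \<inter> D j)" unfolding C(2) D(2) by blast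
  also have "F_sigma \<dots>" by (intro F_sigma_UN F_sigma_closed closed_Int C D)
  finally show ?thesis .
qed

lemma F_sigma_vimage:
  assumes "F_sigma F" "continuous_on UNIV f"
  shows "F_sigma (f -` F)"
proof -
  obtain C where C: "\<And>i::nat. closed (C i)" "F = (\<Union>i. C i)" using assms unfolding F_sigma_def by blast
  have "f -` F = (\<Union>i. f -` C i)" unfolding C(2) by blast
  then show ?thesis unfolding F_sigma_def
    by (intro exI[of _ "\<lambda>i. f -` C i"] conjI allI closed_vimage[OF C(1) assms(2)])
qed

lemma F_sigma_open:
  fixes U :: "'a::metric_space set"
  assumes "open U"
  shows "F_sigma U"
proof (cases "U = UNIV")
  case True
  then show ?thesis by (simp add: F_sigma_closed)
next
  case False
  then have ne: "- U \<noteq> {}" by blast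
  have "U = (\<Union>i::nat. {x. 1 / real (Suc i) \<le> infdist x (- U)})"
  proof (intro set_eqI iffI)
    fix x assume "x \<in> U"
    then have "infdist x (- U) > 0" using assms ne infdist_pos_not_in_closed[of "- U" x] by (auto simp: closed_Compl)
    then obtain i where "1 / real (Suc i) < infdist x (- U)" using nat_approx_posE by metis
    then show "x \<in> (\<Union>i::nat. {x. 1 / real (Suc i) \<le> infdist x (- U)})" by (auto intro: less_imp_le)
  next
    fix x assume "x \<in> (\<Union>i::nat. {x. 1 / real (Suc i) \<le> infdist x (- U)})"
    then obtain i :: nat where "1 / real (Suc i) \<le> infdist x (- U)" by blast
    then have "infdist x (- U) \<noteq> 0" by (metis divide_pos_pos less_le_not_le of_nat_0_less_iff zero_less_Suc zero_less_one)
    then show "x \<in> U" by (metis ComplI infdist_zero)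
  qed
  moreover have "closed {x. 1 / real (Suc i) \<le> infdist x (- U)}" for i
    by (intro closed_Collect_le continuous_intros)
  ultimately show ?thesis unfolding F_sigma_def by (intro exI[of _ "\<lambda>i. {x. 1 / real (Suc i) \<le> infdist x (- U)}"]) simp
qed

lemma F_sigma_Diff_closed: "F_sigma (F :: 'a::metric_space set) \<Longrightarrow> closed C \<Longrightarrow> F_sigma (F - C)"
  by (simp add: Diff_eq F_sigma_Int F_sigma_open open_Compl)

section \<open>Intersection numbers with a line and their measurability\<close>

definition hits :: "'a::real_vector set \<Rightarrow> 'a \<Rightarrow> 'a \<Rightarrow> ennreal" where
  "hits F v x = ecard {t. x + t *\<^sub>R v \<in> F}"

lemma hits_line_points:
  assumes "v \<noteq> 0"
  shows "ecard (line_points (v, u) \<inter> F) = hits F v u"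
proof -
  have "line_points (v, u) \<inter> F = (\<lambda>t. u + t *\<^sub>R v) ` {t. u + t *\<^sub>R v \<in> F}"
    by (auto simp: line_points_def)
  moreover have "inj_on (\<lambda>t. u + t *\<^sub>R v) {t. u + t *\<^sub>R v \<in> F}" using assms by (auto simp: inj_on_def)
  ultimately show ?thesis unfolding hits_def by (metis ecard_image)
qed

lemma hits_shift: "hits F v (x + s *\<^sub>R v) = hits F v x"
proof -
  have "{t. x + t *\<^sub>R v \<in> F} = (+) s ` {t. x + s *\<^sub>R v + t *\<^sub>R v \<in> F}"
    by (auto simp: image_iff algebra_simps intro: exI[of _ "_ - s"])
      (metis add.commute add_diff_cancel_left' diff_add_cancel scaleR_left.add)
  then show ?thesis unfolding hits_def by (metis ecard_image inj_on_add)
qed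

text \<open>Intersection parameters have a convergent subsequence because the parameter interval is
  compact; on the whole line they could escape to infinity.\<close>

lemma closed_line_hits:
  fixes C :: "'a::euclidean_space set"
  assumes "closed C"
  shows "closed {(v, x). \<exists>t\<in>{a..b}. x + t *\<^sub>R v \<in> C}"
  unfolding closed_sequential_limits
proof (intro allI impI, elim conjE)
  fix p :: "nat \<Rightarrow> 'a \<times> 'a" and l
  assume p: "\<forall>n. p n \<in> {(v, x). \<exists>t\<in>{a..b}. x + t *\<^sub>R v \<in> C}" and lim: "p \<longlonglongrightarrow> l"
  have "\<forall>n. \<exists>t\<in>{a..b}. snd (p n) + t *\<^sub>R fst (p n) \<in> C" using p by (simp add: case_prod_unfold)
  then obtain t where t: "\<And>n. t n \<in> {a..b}" "\<And>n. snd (p n) + t n *\<^sub>R fst (p n) \<in> C" by metis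
  obtain s r where s: "s \<in> {a..b}" "strict_mono r" "(t \<circ> r) \<longlonglongrightarrow> s"
    using compact_imp_seq_compact[OF compact_Icc, of a b] t(1) unfolding seq_compact_def by blast
  have pr: "(p \<circ> r) \<longlonglongrightarrow> l" using LIMSEQ_subseq_LIMSEQ[OF lim s(2)] .
  define q where "q n = snd ((p \<circ> r) n) + (t \<circ> r) n *\<^sub>R fst ((p \<circ> r) n)" for n
  have "q \<longlonglongrightarrow> snd l + s *\<^sub>R fst l"
    unfolding q_def by (intro tendsto_intros pr s)
  moreover have "q n \<in> C" for n using t(2)[of "r n"] by (simp add: q_def)
  ultimately have "snd l + s *\<^sub>R fst l \<in> C" using assms closed_sequential_limits by metis
  then show "l \<in> {(v, x). \<exists>t\<in>{a..b}. x + t *\<^sub>R v \<in> C}" using s(1) by (auto simp: case_prod_unfold)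
qed

definition floor_cell :: "'a::real_vector set \<Rightarrow> nat \<Rightarrow> int \<Rightarrow> ('a \<times> 'a) set" where
  "floor_cell F k i = {(v, x). \<exists>t. x + t *\<^sub>R v \<in> F \<and> \<lfloor>real (Suc k) * t\<rfloor> = i}"

lemma floor_cell_borel:
  fixes F :: "'a::euclidean_space set"
  assumes "F_sigma F"
  shows "floor_cell F k i \<in> sets borel"
proof -
  obtain C where C: "\<And>j::nat. closed (C j)" "F = (\<Union>j. C j)" using assms unfolding F_sigma_def by blast
  \<comment> \<open>The half-open cell is the union of the closed intervals that end at
    \<open>b l\<close>, some of them possibly empty, and \<open>closed_line_hits\<close> applies to
    each.\<close>
  define b where "b l = real_of_int (i + 1) / real (Suc k) - 1 / real (Suc l)" for l :: nat
  have iff: "\<lfloor>real (Suc k) * t\<rfloor> = i \<longleftrightarrow> (\<exists>l. t \<in> {real_of_int i / real (Suc k)..b l})" for t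
  proof
    assume fl: "\<lfloor>real (Suc k) * t\<rfloor> = i"
    then have "real_of_int i \<le> real (Suc k) * t" "real (Suc k) * t < real_of_int i + 1" by linarith+
    then have 1: "real_of_int i / real (Suc k) \<le> t" "t < real_of_int (i + 1) / real (Suc k)"
      by (simp_all add: field_simps)
    then obtain l where "1 / real (Suc l) < real_of_int (i + 1) / real (Suc k) - t" using nat_approx_posE[of "real_of_int (i + 1) / real (Suc k) - t"] by auto
    then show "\<exists>l. t \<in> {real_of_int i / real (Suc k)..b l}" using 1 unfolding b_def by (intro exI[of _ l]) auto
  next
    assume "\<exists>l. t \<in> {real_of_int i / real (Suc k)..b l}"
    then obtain l where l: "real_of_int i / real (Suc k) \<le> t" "t \<le> b l" by auto
    have "b l < real_of_int (i + 1) / real (Suc k)" by (simp add: b_def)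
    then have "t < real_of_int (i + 1) / real (Suc k)" using l by linarith
    then have "real_of_int i \<le> real (Suc k) * t" "real (Suc k) * t < real_of_int i + 1"
      using l(1) by (simp_all add: field_simps)
    then show "\<lfloor>real (Suc k) * t\<rfloor> = i" by linarith
  qed
  have "floor_cell F k i = (\<Union>j. \<Union>l. {(v, x). \<exists>t\<in>{real_of_int i / real (Suc k)..b l}. x + t *\<^sub>R v \<in> C j})"
    unfolding floor_cell_def iff C(2) by blast
  also have "\<dots> \<in> sets borel"
    by (intro sets.countable_UN image_subsetI borel_closed closed_line_hits C(1))
  finally show ?thesis .
qed

lemma hits_eq_liminf:
  "hits F v x = liminf (\<lambda>k. \<Sum>n. indicator (floor_cell F k (int_decode n)) (v, x))"
proof -
  have "(\<lambda>t. \<lfloor>real (Suc k) * t\<rfloor>) ` {t. x + t *\<^sub>R v \<in> F} = {i. (v, x) \<in> floor_cell F k i}" for k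
    by (auto simp: floor_cell_def)
  then have "ecard ((\<lambda>t. \<lfloor>real (Suc k) * t\<rfloor>) ` {t. x + t *\<^sub>R v \<in> F}) = (\<Sum>n. indicator (floor_cell F k (int_decode n)) (v, x))" for k
    by (simp add: ecard_int indicator_def)
  then show ?thesis unfolding hits_def by (subst ecard_eq_liminf_floor) simp
qed

lemma borel_measurable_hits:
  fixes F :: "'a::euclidean_space set"
  assumes "F_sigma F"
  shows "(\<lambda>(v, x). hits F v x) \<in> borel_measurable (borel :: ('a \<times> 'a) measure)"
proof -
  have [measurable]: "floor_cell F k i \<in> sets borel" for k i by (rule floor_cell_borel[OF assms])
  have "(\<lambda>p. liminf (\<lambda>k. \<Sum>n. indicator (floor_cell F k (int_decode n)) p :: ennreal)) \<in> borel_measurable borel"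
    by measurable
  also have "(\<lambda>p. liminf (\<lambda>k. \<Sum>n. indicator (floor_cell F k (int_decode n)) p :: ennreal)) = (\<lambda>(v, x). hits F v x)"
    by (auto simp: fun_eq_iff hits_eq_liminf)
  finally show ?thesis .
qed

lemma borel_measurable_hits':
  fixes F :: "'a::euclidean_space set"
  assumes "F_sigma F"
  shows "hits F v \<in> borel_measurable borel"
proof -
  have "(\<lambda>x. (v, x)) \<in> borel \<rightarrow>\<^sub>M borel"
    by (intro borel_measurable_continuous_onI continuous_intros)
  from measurable_compose[OF this borel_measurable_hits[OF assms]] show ?thesis by simp
qed

section \<open>Isometric coordinates on hyperplanes and projections along a direction\<close>

lemma hyperplane_frame:
  fixes v :: "'a::euclidean_space"
  assumes dim: "DIM('a) = Suc DIM('b::euclidean_space)" and v: "norm v = 1"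
  obtains \<iota> :: "'b::euclidean_space \<Rightarrow> 'a" where "linear \<iota>" "\<And>y. norm (\<iota> y) = norm y" "range \<iota> = {u. v \<bullet> u = 0}"
proof -
  have "v \<noteq> 0" using v by auto
  then have d: "dim {u. v \<bullet> u = 0} = DIM('b)" using dim by (simp add: dim_hyperplane)
  obtain f :: "'b \<Rightarrow> 'a" where "linear f" "f ` UNIV = {u. v \<bullet> u = 0}" "\<And>x. x \<in> UNIV \<Longrightarrow> norm (f x) = norm x"
    by (rule isometry_subspaces[of "UNIV :: 'b set" "{u. v \<bullet> u = 0}"]) (auto simp: d subspace_hyperplane)
  then show ?thesis using that by blast
qed

lemma linear_norm_dist:
  assumes "linear \<iota>" "\<And>y. norm (\<iota> y) = norm y"
  shows "dist (\<iota> x) (\<iota> y) = dist x y"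
  by (metis assms dist_norm linear_diff)

definition frame_map :: "('b \<Rightarrow> 'a) \<Rightarrow> 'a \<Rightarrow> 'b \<times> real \<Rightarrow> 'a::euclidean_space" where
  "frame_map \<iota> v p = \<iota> (fst p) + snd p *\<^sub>R v"

lemma frame_map_isometry:
  fixes \<iota> :: "'b::euclidean_space \<Rightarrow> 'a::euclidean_space"
  assumes \<iota>: "linear \<iota>" "\<And>y. norm (\<iota> y) = norm y" "range \<iota> = {u. v \<bullet> u = 0}" and v: "norm v = 1"
  shows "linear (frame_map \<iota> v)" "norm (frame_map \<iota> v p) = norm p" "range (frame_map \<iota> v) = UNIV"
    "v \<bullet> frame_map \<iota> v p = snd p"
proof -
  have vv: "v \<bullet> v = 1" using v by (simp add: dot_square_norm)
  have orth: "v \<bullet> \<iota> y = 0" for y using \<iota>(3) by blast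
  show "linear (frame_map \<iota> v)"
    by (rule linearI) (simp_all add: frame_map_def linear_add[OF \<iota>(1)] linear_cmul[OF \<iota>(1)] algebra_simps)
  have "(norm (frame_map \<iota> v p))\<^sup>2 = (norm (\<iota> (fst p)))\<^sup>2 + (snd p)\<^sup>2"
    unfolding frame_map_def power2_norm_eq_inner
    by (simp add: inner_add_left inner_add_right orth inner_commute[of "\<iota> (fst p)" v] vv power2_eq_square)
  also have "\<dots> = (norm p)\<^sup>2" by (simp add: \<iota>(2) norm_prod_def)
  finally show "norm (frame_map \<iota> v p) = norm p" by (simp add: power2_eq_iff_nonneg)
  show "v \<bullet> frame_map \<iota> v p = snd p" by (simp add: frame_map_def inner_add_right orth vv)
  have "x \<in> range (frame_map \<iota> v)" for x
  proof -
    have "x - (v \<bullet> x) *\<^sub>R v \<in> range \<iota>" unfolding \<iota>(3) by (simp add: inner_diff_right vv)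
    then obtain y where "x - (v \<bullet> x) *\<^sub>R v = \<iota> y" by (rule rangeE)
    then have "\<iota> y + (v \<bullet> x) *\<^sub>R v = x" by (metis diff_add_cancel)
    then have "x = frame_map \<iota> v (y, v \<bullet> x)" by (simp add: frame_map_def)
    then show ?thesis by blast
  qed
  then show "range (frame_map \<iota> v) = UNIV" by blast
qed

definition perp :: "'a::real_inner \<Rightarrow> 'a \<Rightarrow> 'a" where
  "perp v x = x - (v \<bullet> x) *\<^sub>R v"

lemma perp_diff: "perp v x - perp v y = perp v (x - y)"
  by (simp add: perp_def inner_diff_right algebra_simps)

lemma norm_perp_sq:
  assumes "norm v = 1"
  shows "(norm (perp v x))\<^sup>2 = (norm x)\<^sup>2 - (v \<bullet> x)\<^sup>2"
proof -
  have vv: "v \<bullet> v = 1" using assms by (simp add: dot_square_norm)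
  show ?thesis
    unfolding perp_def power2_norm_eq_inner
    by (simp add: inner_diff_left inner_diff_right vv power2_eq_square inner_commute algebra_simps)
qed

lemma norm_perp_le:
  assumes "norm v = 1"
  shows "norm (perp v x) \<le> norm x"
proof -
  have "(norm (perp v x))\<^sup>2 \<le> (norm x)\<^sup>2" using norm_perp_sq[OF assms, of x] by simp
  then show ?thesis by (rule power2_le_imp_le) simp
qed

lemma perp_orthogonal: "norm v = 1 \<Longrightarrow> v \<bullet> perp v x = 0"
  by (simp add: perp_def inner_diff_right dot_square_norm)

lemma perp_add_scaleR: "norm v = 1 \<Longrightarrow> v \<bullet> u = 0 \<Longrightarrow> perp v (u + t *\<^sub>R v) = u"
  by (simp add: perp_def inner_add_right dot_square_norm)

text \<open>Thickening the hyperplane to a slab of width 1 trades a domain that turns with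
  \<open>v\<close> for Lebesgue measure on the whole space. Measurability in \<open>v\<close> then
  follows as for any integral with a parameter. The type \<open>'b\<close> supplies coordinates on
  the hyperplane.\<close>

lemma nn_integral_hyperplane_slab:
  fixes v :: "'a::euclidean_space" and g :: "'a \<Rightarrow> ennreal"
  assumes dim: "DIM('a) = Suc DIM('b::euclidean_space)" and v: "norm v = 1"
    and g[measurable]: "g \<in> borel_measurable borel"
  shows "(\<integral>\<^sup>+u\<in>{u. v \<bullet> u = 0}. g u \<partial>hausdorff_measure (DIM('a) - 1)) =
    (\<integral>\<^sup>+x. g (perp v x) * indicator {0..1} (v \<bullet> x) \<partial>lborel)"
proof -
  obtain \<iota> :: "'b \<Rightarrow> 'a" where \<iota>: "linear \<iota>" "\<And>y. norm (\<iota> y) = norm y" "range \<iota> = {u. v \<bullet> u = 0}"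
    using hyperplane_frame[OF dim v] by blast
  let ?T = "frame_map \<iota> v"
  note T = frame_map_isometry[OF \<iota> v]
  have m: "DIM('a) - 1 = DIM('b)" "DIM('a) = DIM('b \<times> real)" using dim by simp_all
  have [measurable]: "\<iota> \<in> borel_measurable borel"
    using \<iota>(1) linear_continuous_on linear_conv_bounded_linear by (blast intro: borel_measurable_continuous_onI)
  have [measurable]: "(\<lambda>x. perp v x) \<in> borel_measurable borel" unfolding perp_def by measurable
  have f: "(\<lambda>x. g (perp v x) * indicator {0..1} (v \<bullet> x)) \<in> borel_measurable borel" by measurable
  have "(\<integral>\<^sup>+x. g (perp v x) * indicator {0..1} (v \<bullet> x) \<partial>lborel) =
      (\<integral>\<^sup>+x\<in>range ?T. g (perp v x) * indicator {0..1} (v \<bullet> x) \<partial>hausdorff_measure DIM('a))"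
    unfolding T(3) by (simp add: hausdorff_measure_eq_lborel)
  also have "\<dots> = (\<integral>\<^sup>+p. g (perp v (?T p)) * indicator {0..1} (v \<bullet> ?T p) \<partial>hausdorff_measure DIM('a))"
    by (rule nn_integral_hausdorff_isometry[OF linear_norm_dist[OF T(1,2)] _ f]) (simp add: T(3))
  also have "\<dots> = (\<integral>\<^sup>+p. g (\<iota> (fst p)) * indicator {0..1} (snd p) \<partial>(lborel :: ('b \<times> real) measure))"
  proof -
    have "perp v (?T p) = \<iota> (fst p)" for p
      using T(4)[of p] by (simp add: perp_def) (simp add: frame_map_def)
    then show ?thesis unfolding m(2) hausdorff_measure_eq_lborel T(4) by simp
  qed
  also have "\<dots> = (\<integral>\<^sup>+p. g (\<iota> (fst p)) * indicator {0..1} (snd p :: real) \<partial>(lborel \<Otimes>\<^sub>M lborel))"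
    by (simp add: lborel_prod)
  also have "\<dots> = (\<integral>\<^sup>+y. (\<integral>\<^sup>+t. g (\<iota> y) * indicator {0..1} (t::real) \<partial>lborel) \<partial>lborel)"
    by (subst lborel.nn_integral_fst[symmetric]) auto
  also have "\<dots> = (\<integral>\<^sup>+y. g (\<iota> y) \<partial>lborel)"
    by (intro nn_integral_cong) (simp add: nn_integral_cmult_indicator)
  also have "\<dots> = (\<integral>\<^sup>+y. g (\<iota> y) \<partial>hausdorff_measure DIM('b))" by (simp add: hausdorff_measure_eq_lborel)
  also have "\<dots> = (\<integral>\<^sup>+u\<in>range \<iota>. g u \<partial>hausdorff_measure DIM('b))"
    by (rule nn_integral_hausdorff_isometry[OF linear_norm_dist[OF \<iota>(1,2)] _ g, symmetric])
      (simp add: \<iota>(3) closed_hyperplane)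
  finally show ?thesis unfolding m(1) \<iota>(3) ..
qed

section \<open>Shadows: projected area counted with multiplicity\<close>

definition shadow :: "'a::euclidean_space set \<Rightarrow> 'a \<Rightarrow> ennreal" where
  "shadow F v = (\<integral>\<^sup>+u\<in>{u. v \<bullet> u = 0}. hits F v u \<partial>hausdorff_measure (DIM('a) - 1))"

definition line_count :: "'a::euclidean_space set \<Rightarrow> ennreal" where
  "line_count F = (\<integral>\<^sup>+v\<in>sphere 0 1. shadow F v \<partial>hausdorff_measure (DIM('a) - 1))"

lemma lines_nn_integral_eq_line_count:
  fixes F :: "'a::euclidean_space set"
  shows "lines_nn_integral (\<lambda>l. emeasure (count_space UNIV) (line_points l \<inter> F)) = line_count F"
  unfolding lines_nn_integral_def line_count_def
proof (rule nn_integral_cong)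
  fix v :: 'a
  show "(\<integral>\<^sup>+u\<in>{u. (v, u) \<in> oriented_lines}. ecard (line_points (v, u) \<inter> F) \<partial>hausdorff_measure (DIM('a) - 1)) * indicator (sphere 0 1) v
    = shadow F v * indicator (sphere 0 1) v"
  proof (cases "v \<in> sphere 0 1")
    case True
    then have "v \<noteq> 0" "{u. (v, u) \<in> oriented_lines} = {u. v \<bullet> u = 0}" by (auto simp: oriented_lines_def)
    then show ?thesis by (simp add: shadow_def hits_line_points)
  qed simp
qed

lemma hyperplane_borel: "{u. v \<bullet> u = 0} \<in> sets borel" for v :: "'a::euclidean_space"
  by (intro borel_closed closed_hyperplane)

lemma hits_perp: "hits F v (perp v x) = hits F v x"
  using hits_shift[of F v x "- (v \<bullet> x)"] by (simp add: perp_def)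

lemma borel_measurable_shadow:
  fixes F :: "'a::euclidean_space set"
  assumes dim: "DIM('a) = Suc DIM('b::euclidean_space)" and F: "F_sigma F"
  shows "(\<lambda>v. shadow F v * indicator (sphere 0 1) v) \<in> borel_measurable borel"
proof -
  have [measurable]: "(\<lambda>(v, x). hits F v x) \<in> borel_measurable (borel \<Otimes>\<^sub>M borel)"
    using borel_measurable_hits[OF F] by (simp add: borel_prod)
  have [measurable]: "sphere (0::'a) 1 \<in> sets borel" by (intro borel_closed closed_sphere)
  have "(\<lambda>v. \<integral>\<^sup>+x. hits F v x * indicator {0..1} (v \<bullet> x) \<partial>lborel) \<in> borel_measurable borel"
    by measurable
  then have "(\<lambda>v. (\<integral>\<^sup>+x. hits F v x * indicator {0..1} (v \<bullet> x) \<partial>lborel) * indicator (sphere 0 1) v) \<in> borel_measurable borel"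
    by measurable
  also have "(\<lambda>v. (\<integral>\<^sup>+x. hits F v x * indicator {0..1} (v \<bullet> x) \<partial>lborel) * indicator (sphere 0 1) v) =
     (\<lambda>v. shadow F v * indicator (sphere 0 1) v)"
  proof
    fix v :: 'a
    show "(\<integral>\<^sup>+x. hits F v x * indicator {0..1} (v \<bullet> x) \<partial>lborel) * indicator (sphere 0 1) v = shadow F v * indicator (sphere 0 1) v"
    proof (cases "v \<in> sphere 0 1")
      case True
      then have "norm v = 1" by simp
      from nn_integral_hyperplane_slab[OF dim this borel_measurable_hits'[OF F]] show ?thesis
        by (simp add: shadow_def hits_perp)
    qed simp
  qed
  finally show ?thesis .
qed

lemma hits_UN:
  assumes "disjoint_family F"
  shows "hits (\<Union>i::nat. F i) v x = (\<Sum>i. hits (F i) v x)"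
proof -
  have "(\<Sum>i. hits (F i) v x) = ecard (\<Union>i. {t. x + t *\<^sub>R v \<in> F i})"
    unfolding hits_def using assms by (intro suminf_emeasure) (auto simp: disjoint_family_on_def)
  also have "(\<Union>i. {t. x + t *\<^sub>R v \<in> F i}) = {t. x + t *\<^sub>R v \<in> (\<Union>i. F i)}" by blast
  finally show ?thesis by (simp add: hits_def)
qed

lemma shadow_UN:
  fixes F :: "nat \<Rightarrow> 'a::euclidean_space set"
  assumes "disjoint_family F" "\<And>i. F_sigma (F i)"
  shows "shadow (\<Union>i. F i) v = (\<Sum>i. shadow (F i) v)"
proof -
  have [measurable]: "hits (F i) v \<in> borel_measurable borel" for i by (rule borel_measurable_hits'[OF assms(2)])
  have [measurable]: "{u. v \<bullet> u = 0} \<in> sets borel" by (rule hyperplane_borel)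
  show ?thesis unfolding shadow_def hits_UN[OF assms(1)]
    by (subst nn_integral_suminf[symmetric]) (auto simp: ennreal_suminf_multc)
qed

lemma line_count_UN:
  fixes F :: "nat \<Rightarrow> 'a::euclidean_space set"
  assumes dim: "DIM('a) = Suc DIM('b::euclidean_space)"
    and "disjoint_family F" "\<And>i. F_sigma (F i)"
  shows "line_count (\<Union>i. F i) = (\<Sum>i. line_count (F i))"
proof -
  have [measurable]: "(\<lambda>v. shadow (F i) v * indicator (sphere 0 1) v) \<in> borel_measurable borel" for i
    by (rule borel_measurable_shadow[OF dim assms(3)])
  show ?thesis unfolding line_count_def shadow_UN[OF assms(2,3)]
    by (subst nn_integral_suminf[symmetric]) (auto simp: ennreal_suminf_multc)
qed

lemma hausdorff_outer_perp_le:
  assumes "norm v = 1"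
  shows "hausdorff_outer m (perp v ` A) \<le> hausdorff_outer m A"
  using hausdorff_outer_lipschitz[of 1 A "perp v" "\<lambda>x. x" m] norm_perp_le[OF assms]
  by (simp add: dist_norm perp_diff)

text \<open>For fixed \<open>k\<close> the slabs \<open>A k n\<close> of \<open>F\<close> are
  disjoint, and the projection, being 1-Lipschitz, does not increase their areas. So the count of
  cells integrates to at most the area of \<open>F\<close>, and Fatou's lemma passes to the count of
  points.\<close>

lemma shadow_le_hausdorff:
  fixes F :: "'a::euclidean_space set"
  assumes v: "norm v = 1" and F: "F_sigma F"
  shows "shadow F v \<le> hausdorff_outer (DIM('a) - 1) F"
proof -
  let ?H = "hausdorff_measure (DIM('a) - 1) :: 'a measure"
  let ?W = "{u. v \<bullet> u = 0}"
  have W[measurable]: "?W \<in> sets borel" by (rule hyperplane_borel)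
  define A where "A k n = {x\<in>F. \<lfloor>real (Suc k) * (v \<bullet> x)\<rfloor> = int_decode n}" for k n
  have Fb: "F \<in> sets borel" by (rule F_sigma_borel[OF F])
  have Ab: "A k n \<in> sets borel" for k n
  proof -
    have "{x\<in>space borel. x \<in> F \<and> \<lfloor>real (Suc k) * (v \<bullet> x)\<rfloor> = int_decode n} \<in> sets borel"
      using Fb by measurable
    then show ?thesis by (simp add: A_def)
  qed
  define X where "X k n = {u. (v, u) \<in> floor_cell F k (int_decode n)} \<inter> ?W" for k n
  have Xb: "X k n \<in> sets borel" for k n
  proof -
    have "(\<lambda>x. (v, x)) \<in> borel \<rightarrow>\<^sub>M borel"
      by (intro borel_measurable_continuous_onI continuous_intros)
    from measurable_sets[OF this floor_cell_borel[OF F, of k "int_decode n"]]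
    show ?thesis unfolding X_def using W by (auto simp: vimage_def)
  qed
  have vv: "v \<bullet> v = 1" using v by (simp add: dot_square_norm)
  have Xsub: "X k n \<subseteq> perp v ` A k n" for k n
  proof
    fix u assume "u \<in> X k n"
    then obtain t where t: "u + t *\<^sub>R v \<in> F" "\<lfloor>real (Suc k) * t\<rfloor> = int_decode n" "v \<bullet> u = 0"
      by (auto simp: X_def floor_cell_def)
    have "v \<bullet> (u + t *\<^sub>R v) = t" using t(3) vv by (simp add: inner_add_right)
    then have "u + t *\<^sub>R v \<in> A k n" using t unfolding A_def by simp
    then show "u \<in> perp v ` A k n" using perp_add_scaleR[OF v t(3), of t] by (metis image_eqI)
  qed
  have le: "(\<integral>\<^sup>+u. (\<Sum>n. indicator (X k n) u) \<partial>?H) \<le> hausdorff_outer (DIM('a) - 1) F" for k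
  proof -
    have "(\<integral>\<^sup>+u. (\<Sum>n. indicator (X k n) u) \<partial>?H) = (\<Sum>n. emeasure ?H (X k n))"
      using Xb by (subst nn_integral_suminf) auto
    also have "\<dots> = (\<Sum>n. hausdorff_outer (DIM('a) - 1) (X k n))"
      using Xb by (simp add: emeasure_hausdorff_measure)
    also have "\<dots> \<le> (\<Sum>n. hausdorff_outer (DIM('a) - 1) (A k n))"
      by (intro suminf_le allI order_trans[OF hausdorff_outer_mono[OF Xsub] hausdorff_outer_perp_le[OF v]]) auto
    also have "\<dots> = (\<Sum>n. emeasure ?H (A k n))" using Ab by (simp add: emeasure_hausdorff_measure)
    also have "\<dots> = emeasure ?H (\<Union>n. A k n)"
    proof (rule suminf_emeasure)
      show "disjoint_family (A k)"
        using inj_int_decode by (auto simp: disjoint_family_on_def A_def inj_eq)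
    qed (use Ab in auto)
    also have "\<dots> \<le> emeasure ?H F" using Fb by (intro emeasure_mono) (auto simp: A_def)
    finally show ?thesis using Fb by (simp add: emeasure_hausdorff_measure)
  qed
  have "shadow F v = (\<integral>\<^sup>+u. liminf (\<lambda>k. \<Sum>n. indicator (X k n) u) \<partial>?H)"
    unfolding shadow_def
  proof (rule nn_integral_cong)
    fix u
    show "hits F v u * indicator ?W u = liminf (\<lambda>k. \<Sum>n. indicator (X k n) u)"
    proof (cases "u \<in> ?W")
      case True
      then have "indicator (X k n) u = (indicator (floor_cell F k (int_decode n)) (v, u) :: ennreal)" for k n
        by (simp add: X_def indicator_def)
      then show ?thesis using True by (simp add: hits_eq_liminf)
    next
      case False
      then have "indicator (X k n) u = (0 :: ennreal)" for k n by (simp add: X_def)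
      then show ?thesis using False by (simp add: Liminf_const)
    qed
  qed
  also have "\<dots> \<le> liminf (\<lambda>k. \<integral>\<^sup>+u. (\<Sum>n. indicator (X k n) u) \<partial>?H)"
    using Xb by (intro nn_integral_liminf) auto
  also have "\<dots> \<le> liminf (\<lambda>k::nat. hausdorff_outer (DIM('a) - 1) F)"
    by (intro Liminf_mono always_eventually allI le)
  finally show ?thesis by (simp add: Liminf_const)
qed

lemma shadow_eq_hausdorff_perp:
  fixes F :: "'a::euclidean_space set"
  assumes v: "norm v = 1" and F: "F_sigma F" and inj: "inj_on (perp v) F"
  shows "shadow F v = hausdorff_outer (DIM('a) - 1) (perp v ` F)"
proof -
  let ?W = "{u. v \<bullet> u = 0}"
  have hit: "hits F v u = indicator (perp v ` F) u" if u: "v \<bullet> u = 0" for u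
  proof (cases "u \<in> perp v ` F")
    case True
    then obtain x where x: "x \<in> F" "u = perp v x" by blast
    have "{t. u + t *\<^sub>R v \<in> F} = {v \<bullet> x}"
    proof (intro set_eqI iffI)
      fix t assume "t \<in> {t. u + t *\<^sub>R v \<in> F}"
      then have "u + t *\<^sub>R v = x" using inj_onD[OF inj, of "u + t *\<^sub>R v" x] x perp_add_scaleR[OF v u] by simp
      then have "x = perp v x + t *\<^sub>R v" using x by simp
      then have "v \<bullet> x = v \<bullet> perp v x + t * (v \<bullet> v)" by (metis inner_add_right inner_scaleR_right)
      then show "t \<in> {v \<bullet> x}" using v by (simp add: perp_orthogonal dot_square_norm)
    qed (use x in \<open>auto simp: perp_def\<close>)
    then show ?thesis using True by (simp add: hits_def emeasure_count_space_finite)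
  next
    case False
    then have "{t. u + t *\<^sub>R v \<in> F} = {}" using perp_add_scaleR[OF v u] by (metis (mono_tags, lifting) empty_Collect_eq image_eqI)
    then show ?thesis using False by (simp add: hits_def)
  qed
  have PW: "perp v ` F \<subseteq> ?W" using perp_orthogonal[OF v] by auto
  \<comment> \<open>Projections of Borel sets need not be Borel. This one is, being the part of the
    hyperplane where the measurable function \<open>hits F v\<close> does not vanish.\<close>
  have "perp v ` F = {u\<in>space borel. hits F v u \<noteq> 0} \<inter> ?W"
    using PW hit by (auto simp: indicator_def split: if_splits)
  moreover have "{u\<in>space borel. hits F v u \<noteq> 0} \<in> sets borel"
    using borel_measurable_hits'[OF F, of v] by measurable
  ultimately have PB: "perp v ` F \<in> sets borel" using hyperplane_borel[of v] by auto
  have "shadow F v = (\<integral>\<^sup>+u. indicator (perp v ` F) u \<partial>hausdorff_measure (DIM('a) - 1))"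
    unfolding shadow_def using hit PW by (intro nn_integral_cong) (auto simp: indicator_def)
  also have "\<dots> = hausdorff_outer (DIM('a) - 1) (perp v ` F)"
    using PB by (simp add: emeasure_hausdorff_measure)
  finally show ?thesis .
qed

text \<open>The counts can differ only on the projection of \<open>E - F\<close>, which is null
  because projections do not increase area.\<close>

lemma shadow_null_diff:
  fixes E F :: "'a::euclidean_space set"
  assumes v: "norm v = 1" and E: "F_sigma E" and F: "F_sigma F" "F \<subseteq> E"
    and null: "hausdorff_outer (DIM('a) - 1) (E - F) = 0"
  shows "shadow E v = shadow F v"
proof -
  let ?H = "hausdorff_measure (DIM('a) - 1) :: 'a measure"
  define D where "D = {u\<in>space borel. hits E v u \<noteq> hits F v u} \<inter> {u. v \<bullet> u = 0}"
  have [measurable]: "hits E v \<in> borel_measurable borel" "hits F v \<in> borel_measurable borel"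
    using borel_measurable_hits' E F by auto
  have "{u\<in>space borel. hits E v u \<noteq> hits F v u} \<in> sets borel" by measurable
  then have Db: "D \<in> sets borel" unfolding D_def using hyperplane_borel by blast
  have "D \<subseteq> perp v ` (E - F)"
  proof
    fix u assume u: "u \<in> D"
    then have u0: "v \<bullet> u = 0" and ne: "hits E v u \<noteq> hits F v u" by (auto simp: D_def)
    have "\<exists>t. u + t *\<^sub>R v \<in> E - F"
    proof (rule ccontr)
      assume "\<not> ?thesis"
      then have "{t. u + t *\<^sub>R v \<in> E} = {t. u + t *\<^sub>R v \<in> F}" using F(2) by blast
      then show False using ne by (simp add: hits_def)
    qed
    then obtain t where "u + t *\<^sub>R v \<in> E - F" by blast
    then show "u \<in> perp v ` (E - F)" using perp_add_scaleR[OF v u0, of t] by (metis image_eqI)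
  qed
  then have "hausdorff_outer (DIM('a) - 1) D \<le> hausdorff_outer (DIM('a) - 1) (E - F)"
    using hausdorff_outer_mono hausdorff_outer_perp_le[OF v] order_trans by blast
  then have "D \<in> null_sets ?H" using Db null by (simp add: null_sets_def emeasure_hausdorff_measure)
  then have "AE u in ?H. u \<notin> D" by (rule AE_not_in)
  then have "AE u in ?H. hits E v u * indicator {u. v \<bullet> u = 0} u = hits F v u * indicator {u. v \<bullet> u = 0} u"
    by eventually_elim (auto simp: D_def indicator_def)
  then show ?thesis unfolding shadow_def by (rule nn_integral_cong_AE)
qed

lemma line_count_null_diff:
  fixes E F :: "'a::euclidean_space set"
  assumes "F_sigma E" "F_sigma F" "F \<subseteq> E" "hausdorff_outer (DIM('a) - 1) (E - F) = 0"
  shows "line_count E = line_count F"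
  unfolding line_count_def
  by (intro nn_integral_cong) (auto simp: indicator_def shadow_null_diff[OF _ assms])

lemma line_count_isometry:
  fixes R :: "'a::euclidean_space \<Rightarrow> 'a" and F :: "'a set"
  assumes dim: "DIM('a) = Suc DIM('b::euclidean_space)"
    and R: "linear R" "\<And>x. norm (R x) = norm x" "surj R" and F: "F_sigma F"
  shows "line_count (R -` F) = line_count F"
proof -
  let ?m = "DIM('a) - 1"
  have dR: "dist (R x) (R y) = dist x y" for x y by (rule linear_norm_dist[OF R(1,2)])
  have ip: "R x \<bullet> R y = x \<bullet> y" for x y
    using R(1,2) orthogonal_transformation[of R] by (simp add: orthogonal_transformation_def[symmetric] orthogonal_transformation_def)
  have hit: "hits F (R v) (R u) = hits (R -` F) v u" for v u
    by (simp add: hits_def linear_add[OF R(1), symmetric] linear_cmul[OF R(1), symmetric])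
  have sh: "shadow F (R v) = shadow (R -` F) v" for v
  proof -
    let ?f = "\<lambda>u. hits F (R v) u * indicator {u. R v \<bullet> u = 0} u"
    have [measurable]: "{u. R v \<bullet> u = 0} \<in> sets borel" by (rule hyperplane_borel)
    have [measurable]: "hits F (R v) \<in> borel_measurable borel" by (rule borel_measurable_hits'[OF F])
    have "(\<integral>\<^sup>+u\<in>range R. ?f u \<partial>hausdorff_measure ?m) = (\<integral>\<^sup>+u. ?f (R u) \<partial>hausdorff_measure ?m)"
      by (rule nn_integral_hausdorff_isometry[OF dR]) (simp add: R(3), measurable)
    then show ?thesis unfolding shadow_def R(3) hit by (simp add: ip indicator_def)
  qed
  let ?g = "\<lambda>v. shadow F v * indicator (sphere 0 1) v"
  have "(\<integral>\<^sup>+v\<in>range R. ?g v \<partial>hausdorff_measure ?m) = (\<integral>\<^sup>+v. ?g (R v) \<partial>hausdorff_measure ?m)"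
    by (rule nn_integral_hausdorff_isometry[OF dR _ borel_measurable_shadow[OF dim F]]) (simp add: R(3))
  then show ?thesis unfolding line_count_def R(3) sh by (simp add: R(2) indicator_def)
qed

section \<open>Flat pieces\<close>

text \<open>A vector \<open>z\<close> orthogonal to \<open>\<nu>\<close> sees only the component of
  \<open>v\<close> orthogonal to \<open>\<nu>\<close>, whose squared length is
  \<open>1 - (v \<bullet> \<nu>)\<^sup>2\<close>. At most this fraction of the squared length of
  \<open>z\<close> is lost.\<close>

lemma norm_perp_ge:
  assumes v: "norm v = 1" and \<nu>: "norm \<nu> = 1" and z: "\<nu> \<bullet> z = 0"
  shows "\<bar>v \<bullet> \<nu>\<bar> * norm z \<le> norm (perp v z)"
proof -
  have "v \<bullet> z = perp \<nu> v \<bullet> z" using z by (simp add: perp_def inner_diff_left)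
  then have "(v \<bullet> z)\<^sup>2 \<le> (norm (perp \<nu> v))\<^sup>2 * (norm z)\<^sup>2"
    using Cauchy_Schwarz_ineq[of "perp \<nu> v" z] by (simp add: power2_norm_eq_inner)
  also have "(norm (perp \<nu> v))\<^sup>2 = 1 - (v \<bullet> \<nu>)\<^sup>2" using norm_perp_sq[OF \<nu>, of v] v by (simp add: inner_commute)
  finally have "(v \<bullet> \<nu>)\<^sup>2 * (norm z)\<^sup>2 \<le> (norm (perp v z))\<^sup>2"
    using norm_perp_sq[OF v, of z] by (simp add: left_diff_distrib)
  then have "(\<bar>v \<bullet> \<nu>\<bar> * norm z)\<^sup>2 \<le> (norm (perp v z))\<^sup>2" by (simp add: power_mult_distrib)
  then show ?thesis by (rule power2_le_imp_le) simp
qed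

lemma linear_perp: "linear (perp v)"
  by (rule linearI) (simp_all add: perp_def inner_add_right algebra_simps)

lemma F_sigma_image:
  fixes f :: "'a::heine_borel \<Rightarrow> 'b::metric_space"
  assumes "F_sigma C" "C \<subseteq> K" "compact K" "continuous_on UNIV f"
  shows "F_sigma (f ` C)"
proof -
  obtain D where D: "\<And>i::nat. closed (D i)" "C = (\<Union>i. D i)" using assms(1) unfolding F_sigma_def by blast
  have "f ` C = (\<Union>i. f ` (D i \<inter> K))" using assms(2) D(2) by blast
  moreover have "closed (f ` (D i \<inter> K))" for i
    using closed_Int_compact[OF D(1) assms(3)] assms(4)
    by (intro compact_imp_closed compact_continuous_image continuous_on_subset[OF assms(4)]) auto
  ultimately show ?thesis
    unfolding F_sigma_def by (intro exI[of _ "\<lambda>i. f ` (D i \<inter> K)"] conjI allI)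
qed

definition frame :: "('b::euclidean_space \<Rightarrow> 'a::euclidean_space) \<Rightarrow> 'a \<Rightarrow> bool" where
  "frame \<iota> \<nu> \<longleftrightarrow> linear \<iota> \<and> (\<forall>y. norm (\<iota> y) = norm y) \<and> range \<iota> = {u. \<nu> \<bullet> u = 0} \<and> norm \<nu> = 1"

text \<open>A reference set of area 1: the shadow of its copy in a hyperplane is the area factor of
  the projection, and the line integral of that copy is the constant to be found.\<close>

definition unit_cube :: "'b::euclidean_space set" where
  "unit_cube = cbox 0 One"

lemma unit_cube: "compact unit_cube" "unit_cube \<in> sets borel" "bounded unit_cube" "emeasure lborel unit_cube = 1"
  unfolding unit_cube_def by (auto simp: bounded_cbox emeasure_lborel_cbox_eq)

definition band :: "real \<Rightarrow> 'a::euclidean_space \<Rightarrow> 'a set" where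
  "band \<delta> \<nu> = {v \<in> sphere 0 1. \<bar>v \<bullet> \<nu>\<bar> < \<delta>}"

lemma band_borel: "band \<delta> \<nu> \<in> sets borel"
proof -
  have "band \<delta> \<nu> = sphere 0 1 \<inter> {v. \<bar>v \<bullet> \<nu>\<bar> < \<delta>}" by (auto simp: band_def)
  also have "\<dots> \<in> sets borel"
    by (intro sets.Int borel_closed borel_open closed_sphere open_Collect_less continuous_intros)
  finally show ?thesis .
qed

lemma frame_image_F_sigma:
  "frame \<iota> \<nu> \<Longrightarrow> F_sigma (\<iota> ` unit_cube)"
  unfolding frame_def
  by (intro F_sigma_closed compact_imp_closed compact_continuous_image unit_cube linear_continuous_on)
    (simp add: linear_conv_bounded_linear)

lemma frame_hausdorff_image:
  assumes "frame \<iota> \<nu>"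
  shows "hausdorff_outer m (\<iota> ` A) = hausdorff_outer m A"
  using hausdorff_outer_isometric[of A \<iota> "\<lambda>x. x" m] linear_norm_dist[of \<iota>] assms
  unfolding frame_def by simp

text \<open>Between two hyperplanes the projection is linear and scales all areas by one
  determinant. It is never evaluated: the case of the unit cube identifies it with the shadow of the
  cube.\<close>

lemma hausdorff_perp_frame_image:
  fixes \<iota> :: "real^'m::{finite,wellorder} \<Rightarrow> 'a::euclidean_space"
  assumes dim: "DIM('a) = Suc CARD('m)" and fr: "frame \<iota> \<nu>" and v: "norm v = 1" "v \<bullet> \<nu> \<noteq> 0"
    and A: "A \<in> sets borel" "bounded A"
  shows "hausdorff_outer CARD('m) (perp v ` \<iota> ` A) = shadow (\<iota> ` unit_cube) v * emeasure lborel A"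
proof -
  have \<iota>: "linear \<iota>" "\<And>y. norm (\<iota> y) = norm y" "range \<iota> = {u. \<nu> \<bullet> u = 0}" and \<nu>: "norm \<nu> = 1"
    using fr unfolding frame_def by blast+
  have "v \<noteq> 0" using v by auto
  have d: "dim {u. v \<bullet> u = 0} = dim (UNIV :: (real, 'm) vec set)" using dim \<open>v \<noteq> 0\<close> by (simp add: dim_hyperplane)
  obtain j :: "(real, 'm) vec \<Rightarrow> 'a" and g where j: "linear j" "linear g" "\<And>x. norm (j x) = norm x"
      "\<And>u. v \<bullet> u = 0 \<Longrightarrow> j (g u) = u"
    using isometries_subspaces[OF subspace_UNIV subspace_hyperplane d[symmetric]] by (metis (mono_tags, lifting) UNIV_I mem_Collect_eq)
  define T where "T = g \<circ> perp v \<circ> \<iota>"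
  have linT: "linear T" unfolding T_def by (intro linear_compose \<iota>(1) linear_perp j(2))
  have jT: "j (T y) = perp v (\<iota> y)" for y unfolding T_def comp_def by (rule j(4)) (rule perp_orthogonal[OF v(1)])
  have orth: "\<nu> \<bullet> \<iota> y = 0" for y using \<iota>(3) by blast
  have ker: "y = 0" if "perp v (\<iota> y) = 0" for y
  proof -
    have "\<bar>v \<bullet> \<nu>\<bar> * norm (\<iota> y) \<le> 0" using norm_perp_ge[OF v(1) \<nu> orth[of y]] that by simp
    then show ?thesis using v(2) \<iota>(2) by (simp add: mult_le_0_iff)
  qed
  have injT: "inj T"
  proof -
    have "y = 0" if "T y = 0" for y using ker[of y] jT[of y] that linear_0[OF j(1)] by simp
    then show ?thesis using linear_injective_0[OF linT] by blast
  qed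
  have main: "hausdorff_outer CARD('m) (perp v ` \<iota> ` B) = ennreal \<bar>det (matrix T)\<bar> * emeasure lborel B"
    if B: "B \<in> sets borel" "bounded B" for B
  proof -
    have "perp v ` \<iota> ` B = j ` (T ` B)" by (simp add: image_image jT)
    then have "hausdorff_outer CARD('m) (perp v ` \<iota> ` B) = hausdorff_outer CARD('m) (T ` B)"
      using hausdorff_outer_isometric[of "T ` B" j "\<lambda>x. x"] linear_norm_dist[OF j(1,3)] by simp
    also have "\<dots> = emeasure lborel (T ` B)"
      using hausdorff_outer_eq_lborel[OF emeasure_linear_image(1)[OF linT injT B]] by simp
    also have "\<dots> = ennreal \<bar>det (matrix T)\<bar> * emeasure lborel B" by (rule emeasure_linear_image(2)[OF linT injT B])
    finally show ?thesis .
  qed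
  have "inj_on (perp v) (\<iota> ` unit_cube)"
  proof (rule inj_onI, elim imageE)
    fix x y a b assume "perp v x = perp v y" "x = \<iota> a" "y = \<iota> b"
    then have "perp v (\<iota> (a - b)) = 0" by (simp add: linear_diff[OF \<iota>(1)] perp_diff[symmetric])
    then have "a - b = 0" by (rule ker)
    then show "x = y" using \<open>x = \<iota> a\<close> \<open>y = \<iota> b\<close> by simp
  qed
  then have "shadow (\<iota> ` unit_cube) v = ennreal \<bar>det (matrix T)\<bar>"
    using shadow_eq_hausdorff_perp[OF v(1) frame_image_F_sigma[OF fr]] main[OF unit_cube(2,3)] dim
    by (simp add: unit_cube(4))
  then show ?thesis using main[OF A] by simp
qed

lemma hausdorff_outer_almost_isometric:
  fixes g :: "'x \<Rightarrow> 'c::real_normed_vector" and h :: "'x \<Rightarrow> 'c"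
  assumes e: "0 \<le> e" "e < 1"
    and gh: "\<And>x y. x \<in> X \<Longrightarrow> y \<in> X \<Longrightarrow> norm ((g x - g y) - (h x - h y)) \<le> e * norm (h x - h y)"
  shows "hausdorff_outer m (g ` X) \<le> ennreal ((1 + e) ^ m) * hausdorff_outer m (h ` X)"
    and "ennreal ((1 - e) ^ m) * hausdorff_outer m (h ` X) \<le> hausdorff_outer m (g ` X)"
proof -
  show "hausdorff_outer m (g ` X) \<le> ennreal ((1 + e) ^ m) * hausdorff_outer m (h ` X)"
  proof (rule hausdorff_outer_lipschitz)
    fix x y assume xy: "x \<in> X" "y \<in> X"
    show "dist (g x) (g y) \<le> (1 + e) * dist (h x) (h y)"
      using gh[OF xy] norm_triangle_sub[of "g x - g y" "h x - h y"] by (simp add: dist_norm distrib_right)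
  qed (use e in auto)
  have "hausdorff_outer m (h ` X) \<le> ennreal ((1 / (1 - e)) ^ m) * hausdorff_outer m (g ` X)"
  proof (rule hausdorff_outer_lipschitz)
    fix x y assume xy: "x \<in> X" "y \<in> X"
    have "(1 - e) * norm (h x - h y) \<le> norm (g x - g y)"
      using gh[OF xy] norm_triangle_sub[of "h x - h y" "g x - g y"] by (simp add: norm_minus_commute left_diff_distrib)
    then show "dist (h x) (h y) \<le> 1 / (1 - e) * dist (g x) (g y)"
      using e by (simp add: dist_norm field_simps)
  qed (use e in auto)
  then have "ennreal ((1 - e) ^ m) * hausdorff_outer m (h ` X) \<le>
      ennreal ((1 - e) ^ m) * (ennreal ((1 / (1 - e)) ^ m) * hausdorff_outer m (g ` X))"
    by (rule mult_left_mono) simp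
  also have "\<dots> = hausdorff_outer m (g ` X)"
    using e by (simp add: mult.assoc[symmetric] ennreal_mult[symmetric] power_mult_distrib[symmetric])
  finally show "ennreal ((1 - e) ^ m) * hausdorff_outer m (h ` X) \<le> hausdorff_outer m (g ` X)" .
qed

text \<open>
  Projecting along \<open>v\<close> with \<open>\<delta> \<le> \<bar>v \<bullet> \<nu>\<bar>\<close> divides distances by at most \<open>1 / \<delta>\<close>, so flatness
  \<open>\<delta>\<^sup>2\<close> of the piece leaves a relative error \<open>\<delta>\<close> after the projection.
\<close>

locale flat_piece =
  fixes \<iota> :: "real^'m::{finite,wellorder} \<Rightarrow> 'a::euclidean_space" and \<nu> :: 'a
    and f q :: "real^'m::_ \<Rightarrow> 'a" and C :: "(real^'m::_) set" and \<delta> :: real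
  assumes dim: "DIM('a) = Suc CARD('m)" and fr: "frame \<iota> \<nu>"
    and q: "linear q" "inj q" "range q \<subseteq> {u. \<nu> \<bullet> u = 0}"
    and \<delta>: "0 < \<delta>" "\<delta> < 1"
    and C: "bounded C" "F_sigma (f ` C)" "F_sigma (q ` C)"
    and flat: "\<And>x y. x \<in> C \<Longrightarrow> y \<in> C \<Longrightarrow> norm (f x - f y - (q x - q y)) \<le> \<delta>\<^sup>2 * norm (q x - q y)"
begin

abbreviation "g \<equiv> hausdorff_outer CARD('m) (q ` C)"
abbreviation "F \<equiv> f ` C"

lemma \<nu>: "norm \<nu> = 1" using fr unfolding frame_def by blast

lemma delta_sq: "0 \<le> \<delta>\<^sup>2" "\<delta>\<^sup>2 < 1"
proof -
  have "\<delta> * \<delta> < 1 * 1" by (rule mult_strict_mono) (use \<delta> in auto)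
  then show "0 \<le> \<delta>\<^sup>2" "\<delta>\<^sup>2 < 1" by (auto simp: power2_eq_square)
qed

lemma hausdorff_bounds: "hausdorff_outer CARD('m) F \<le> ennreal ((1 + \<delta>\<^sup>2) ^ CARD('m)) * g" "ennreal ((1 - \<delta>\<^sup>2) ^ CARD('m)) * g \<le> hausdorff_outer CARD('m) F"
  using hausdorff_outer_almost_isometric[OF delta_sq, of C f q] flat by auto

lemma perp_lower:
  assumes v: "norm v = 1" "\<delta> \<le> \<bar>v \<bullet> \<nu>\<bar>"
  shows "\<delta> * norm (q x - q y) \<le> norm (perp v (q x) - perp v (q y))"
proof -
  have "q (x - y) \<in> range q" by blast
  then have "\<nu> \<bullet> (q x - q y) = 0" using q(3) by (auto simp: linear_diff[OF q(1)])
  from norm_perp_ge[OF v(1) \<nu> this] have "\<bar>v \<bullet> \<nu>\<bar> * norm (q x - q y) \<le> norm (perp v (q x) - perp v (q y))"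
    by (simp add: perp_diff)
  moreover have "\<delta> * norm (q x - q y) \<le> \<bar>v \<bullet> \<nu>\<bar> * norm (q x - q y)" using v by (intro mult_right_mono) auto
  ultimately show ?thesis by linarith
qed

lemma perp_flat:
  assumes v: "norm v = 1" "\<delta> \<le> \<bar>v \<bullet> \<nu>\<bar>" and xy: "x \<in> C" "y \<in> C"
  shows "norm ((perp v (f x) - perp v (f y)) - (perp v (q x) - perp v (q y))) \<le> \<delta> * norm (perp v (q x) - perp v (q y))"
proof -
  have "(perp v (f x) - perp v (f y)) - (perp v (q x) - perp v (q y)) = perp v (f x - f y - (q x - q y))"
    by (simp add: perp_diff)
  then have "norm ((perp v (f x) - perp v (f y)) - (perp v (q x) - perp v (q y))) \<le> norm (f x - f y - (q x - q y))"
    using norm_perp_le[OF v(1)] by simp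
  also have "\<dots> \<le> \<delta> * (\<delta> * norm (q x - q y))" using flat[OF xy] by (simp add: power2_eq_square)
  also have "\<dots> \<le> \<delta> * norm (perp v (q x) - perp v (q y))"
    using perp_lower[OF v] \<delta> by (intro mult_left_mono) auto
  finally show ?thesis .
qed

lemma inj_perp:
  assumes v: "norm v = 1" "\<delta> \<le> \<bar>v \<bullet> \<nu>\<bar>"
  shows "inj_on (perp v) F"
proof (rule inj_onI, elim imageE)
  fix a b x y assume ab: "perp v a = perp v b" "a = f x" "b = f y" and xy: "x \<in> C" "y \<in> C"
  define w where "w = norm (perp v (q x) - perp v (q y))"
  have "w \<le> \<delta> * w" using perp_flat[OF v xy] ab unfolding w_def by (simp add: norm_minus_commute)
  then have "(1 - \<delta>) * w \<le> 0" by (simp add: algebra_simps)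
  moreover have "w \<ge> 0" by (simp add: w_def)
  ultimately have "w = 0" using \<delta> by (simp add: mult_le_0_iff)
  then have "\<delta> * norm (q x - q y) \<le> 0" using perp_lower[OF v, of x y] by (simp add: w_def)
  then have "q x = q y" using \<delta> by (simp add: mult_le_0_iff)
  then show "a = b" using q(2) ab by (simp add: inj_eq)
qed

lemma perp_q_image:
  assumes v: "norm v = 1" "\<delta> \<le> \<bar>v \<bullet> \<nu>\<bar>"
  shows "hausdorff_outer CARD('m) (perp v ` q ` C) = shadow (\<iota> ` unit_cube) v * g"
proof -
  have \<iota>: "linear \<iota>" "\<And>y. norm (\<iota> y) = norm y" "range \<iota> = {u. \<nu> \<bullet> u = 0}" using fr unfolding frame_def by blast+
  define A where "A = \<iota> -` (q ` C)"
  have "q ` C \<subseteq> range \<iota>" using q(3) \<iota>(3) by auto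
  then have iA: "\<iota> ` A = q ` C" unfolding A_def image_vimage_eq by (rule Int_absorb2)
  have "bounded (q ` C)" using bounded_linear_image[OF C(1)] q(1) by (simp add: linear_conv_bounded_linear)
  then obtain K where "\<forall>u\<in>q ` C. norm u \<le> K" unfolding bounded_iff by blast
  then have "norm y \<le> K" if "y \<in> A" for y using that \<iota>(2)[of y] unfolding A_def by (metis vimageE)
  then have bA: "bounded A" unfolding bounded_iff by blast
  have "F_sigma A" unfolding A_def using C(3) \<iota>(1)
    by (intro F_sigma_vimage linear_continuous_on) (auto simp: linear_conv_bounded_linear)
  then have Ab: "A \<in> sets borel" by (rule F_sigma_borel)
  have "v \<bullet> \<nu> \<noteq> 0" using v \<delta> by auto
  from hausdorff_perp_frame_image[OF dim fr v(1) this Ab bA]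
  have "hausdorff_outer CARD('m) (perp v ` q ` C) = shadow (\<iota> ` unit_cube) v * emeasure lborel A" by (simp add: iA)
  also have "emeasure lborel A = hausdorff_outer CARD('m) A" using hausdorff_outer_eq_lborel[OF Ab] by simp
  also have "\<dots> = g" using frame_hausdorff_image[OF fr, of "CARD('m)" A] iA by simp
  finally show ?thesis .
qed

lemma shadow_bounds:
  assumes v: "norm v = 1" "\<delta> \<le> \<bar>v \<bullet> \<nu>\<bar>"
  shows "shadow F v \<le> ennreal ((1 + \<delta>) ^ CARD('m)) * (shadow (\<iota> ` unit_cube) v * g)"
    and "ennreal ((1 - \<delta>) ^ CARD('m)) * (shadow (\<iota> ` unit_cube) v * g) \<le> shadow F v"
proof -
  have m: "DIM('a) - 1 = CARD('m)" using dim by simp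
  have eq: "shadow F v = hausdorff_outer CARD('m) (perp v ` F)"
    using shadow_eq_hausdorff_perp[OF v(1) C(2) inj_perp[OF v]] m by simp
  note ai = hausdorff_outer_almost_isometric[of \<delta> C "\<lambda>x. perp v (f x)" "\<lambda>x. perp v (q x)" "CARD('m)", OF less_imp_le[OF \<delta>(1)] \<delta>(2) perp_flat[OF v]]
  show "shadow F v \<le> ennreal ((1 + \<delta>) ^ CARD('m)) * (shadow (\<iota> ` unit_cube) v * g)"
    using ai(1) unfolding eq perp_q_image[OF v, symmetric] by (simp add: image_image)
  show "ennreal ((1 - \<delta>) ^ CARD('m)) * (shadow (\<iota> ` unit_cube) v * g) \<le> shadow F v"
    using ai(2) unfolding eq perp_q_image[OF v, symmetric] by (simp add: image_image)
qed

text \<open>Directions outside the band are covered by \<open>shadow_bounds\<close>; inside it the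
  crude \<open>shadow_le_hausdorff\<close> leaves the band area as an error term. The factor on the
  left takes the place of a division when \<open>g\<close> is replaced by the area of
  \<open>F\<close>.\<close>

lemma line_count_upper:
  "ennreal ((1 - \<delta>\<^sup>2) ^ CARD('m)) * line_count F \<le>
    (ennreal ((1 + \<delta>) ^ CARD('m)) * line_count (\<iota> ` unit_cube) + hausdorff_outer CARD('m) (band \<delta> \<nu>)) * hausdorff_outer CARD('m) F"
proof -
  have m: "DIM('a) - 1 = CARD('m)" using dim by simp
  have dimb: "DIM('a) = Suc DIM((real, 'm) vec)" using dim by simp
  let ?H = "hausdorff_measure CARD('m) :: 'a measure"
  let ?S = "sphere 0 1 :: 'a set"
  let ?a = "\<lambda>v. shadow (\<iota> ` unit_cube) v * indicator ?S v"
  have am[measurable]: "?a \<in> borel_measurable borel" by (rule borel_measurable_shadow[OF dimb frame_image_F_sigma[OF fr]])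
  have bm[measurable]: "band \<delta> \<nu> \<in> sets borel" by (rule band_borel)
  have "line_count F \<le> (\<integral>\<^sup>+v. (ennreal ((1 + \<delta>) ^ CARD('m)) * g) * ?a v + hausdorff_outer CARD('m) F * indicator (band \<delta> \<nu>) v \<partial>?H)"
    unfolding line_count_def m
  proof (rule nn_integral_mono)
    fix v
    show "shadow F v * indicator ?S v \<le> (ennreal ((1 + \<delta>) ^ CARD('m)) * g) * ?a v + hausdorff_outer CARD('m) F * indicator (band \<delta> \<nu>) v"
    proof (cases "v \<in> ?S")
      case True
      then have v: "norm v = 1" by simp
      show ?thesis
      proof (cases "\<delta> \<le> \<bar>v \<bullet> \<nu>\<bar>")
        case True
        from shadow_bounds(1)[OF v True] show ?thesis
          using \<open>v \<in> ?S\<close> by (simp add: mult_ac add_increasing2)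
      next
        case False
        then have "v \<in> band \<delta> \<nu>" using \<open>v \<in> ?S\<close> by (auto simp: band_def)
        then show ?thesis using shadow_le_hausdorff[OF v C(2)] \<open>v \<in> ?S\<close> m by (simp add: add_increasing)
      qed
    qed simp
  qed
  also have "\<dots> = (ennreal ((1 + \<delta>) ^ CARD('m)) * g) * line_count (\<iota> ` unit_cube) + hausdorff_outer CARD('m) F * hausdorff_outer CARD('m) (band \<delta> \<nu>)"
    unfolding line_count_def m
    by (subst nn_integral_add) (simp_all add: nn_integral_cmult nn_integral_cmult_indicator emeasure_hausdorff_measure bm)
  finally have le: "line_count F \<le> (ennreal ((1 + \<delta>) ^ CARD('m)) * g) * line_count (\<iota> ` unit_cube) + hausdorff_outer CARD('m) F * hausdorff_outer CARD('m) (band \<delta> \<nu>)" .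
  let ?k = "ennreal ((1 - \<delta>\<^sup>2) ^ CARD('m))"
  have k1: "?k \<le> 1" using delta_sq by (simp add: power_le_one)
  have "?k * line_count F \<le> ?k * ((ennreal ((1 + \<delta>) ^ CARD('m)) * g) * line_count (\<iota> ` unit_cube) + hausdorff_outer CARD('m) F * hausdorff_outer CARD('m) (band \<delta> \<nu>))"
    using le by (rule mult_left_mono) simp
  also have "\<dots> = ennreal ((1 + \<delta>) ^ CARD('m)) * line_count (\<iota> ` unit_cube) * (?k * g) + ?k * (hausdorff_outer CARD('m) F * hausdorff_outer CARD('m) (band \<delta> \<nu>))"
    by (simp add: distrib_left mult_ac)
  also have "\<dots> \<le> ennreal ((1 + \<delta>) ^ CARD('m)) * line_count (\<iota> ` unit_cube) * hausdorff_outer CARD('m) F + 1 * (hausdorff_outer CARD('m) F * hausdorff_outer CARD('m) (band \<delta> \<nu>))"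
    by (intro add_mono mult_left_mono mult_right_mono hausdorff_bounds(2) k1) auto
  also have "\<dots> = (ennreal ((1 + \<delta>) ^ CARD('m)) * line_count (\<iota> ` unit_cube) + hausdorff_outer CARD('m) (band \<delta> \<nu>)) * hausdorff_outer CARD('m) F"
    by (simp add: distrib_right distrib_left mult_ac)
  finally show ?thesis .
qed

text \<open>Inside the band the model integrand is at most \<open>g\<close>, because the shadow of
  the unit cube is at most its area 1. The band thus enters as a term added on the right, which
  avoids subtraction in \<open>ennreal\<close>.\<close>

lemma line_count_lower:
  "ennreal ((1 - \<delta>) ^ CARD('m) * (1 - \<delta>\<^sup>2) ^ CARD('m)) * line_count (\<iota> ` unit_cube) * hausdorff_outer CARD('m) F \<le>
    ennreal ((1 + \<delta>\<^sup>2) ^ CARD('m)) * (line_count F + hausdorff_outer CARD('m) (band \<delta> \<nu>) * hausdorff_outer CARD('m) F)"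
proof -
  have m: "DIM('a) - 1 = CARD('m)" using dim by simp
  have dimb: "DIM('a) = Suc DIM((real, 'm) vec)" using dim by simp
  let ?H = "hausdorff_measure CARD('m) :: 'a measure"
  let ?S = "sphere 0 1 :: 'a set"
  let ?a = "\<lambda>v. shadow (\<iota> ` unit_cube) v * indicator ?S v"
  let ?d = "ennreal ((1 - \<delta>) ^ CARD('m))"
  have am[measurable]: "?a \<in> borel_measurable borel" by (rule borel_measurable_shadow[OF dimb frame_image_F_sigma[OF fr]])
  have fm[measurable]: "(\<lambda>v. shadow F v * indicator ?S v) \<in> borel_measurable borel" by (rule borel_measurable_shadow[OF dimb C(2)])
  have bm[measurable]: "band \<delta> \<nu> \<in> sets borel" by (rule band_borel)
  have d1: "?d \<le> 1" using \<delta> by (simp add: power_le_one)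
  have "?d * g * line_count (\<iota> ` unit_cube) = (\<integral>\<^sup>+v. ?d * g * ?a v \<partial>?H)"
    unfolding line_count_def m by (subst nn_integral_cmult) auto
  also have "\<dots> \<le> (\<integral>\<^sup>+v. shadow F v * indicator ?S v + g * indicator (band \<delta> \<nu>) v \<partial>?H)"
  proof (rule nn_integral_mono)
    fix v
    show "?d * g * ?a v \<le> shadow F v * indicator ?S v + g * indicator (band \<delta> \<nu>) v"
    proof (cases "v \<in> ?S")
      case True
      then have v: "norm v = 1" by simp
      show ?thesis
      proof (cases "\<delta> \<le> \<bar>v \<bullet> \<nu>\<bar>")
        case True
        from shadow_bounds(2)[OF v True] show ?thesis
          using \<open>v \<in> ?S\<close> by (simp add: mult_ac add_increasing2)
      next
        case False
        then have b: "v \<in> band \<delta> \<nu>" using \<open>v \<in> ?S\<close> by (auto simp: band_def)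
        have "shadow (\<iota> ` unit_cube) v \<le> hausdorff_outer CARD('m) (\<iota> ` unit_cube)"
          using shadow_le_hausdorff[OF v frame_image_F_sigma[OF fr]] m by simp
        also have "\<dots> = emeasure lborel (unit_cube :: (real, 'm) vec set)"
          using frame_hausdorff_image[OF fr]
            hausdorff_outer_eq_lborel[where 'a = "(real, 'm) vec", OF unit_cube(2)] by simp
        finally have a1: "shadow (\<iota> ` unit_cube) v \<le> 1" by (simp add: unit_cube(4))
        have "?d * g * shadow (\<iota> ` unit_cube) v \<le> 1 * g * 1"
          by (intro mult_mono d1 a1) auto
        then show ?thesis using b \<open>v \<in> ?S\<close> by (simp add: add_increasing)
      qed
    qed simp
  qed
  also have "\<dots> = line_count F + g * hausdorff_outer CARD('m) (band \<delta> \<nu>)"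
    unfolding line_count_def m
    by (subst nn_integral_add) (simp_all add: nn_integral_cmult_indicator emeasure_hausdorff_measure bm)
  finally have le: "?d * g * line_count (\<iota> ` unit_cube) \<le> line_count F + g * hausdorff_outer CARD('m) (band \<delta> \<nu>)" .
  let ?k = "ennreal ((1 - \<delta>\<^sup>2) ^ CARD('m))"
  let ?l = "ennreal ((1 + \<delta>\<^sup>2) ^ CARD('m))"
  have k1: "?k \<le> 1" using delta_sq by (simp add: power_le_one)
  have "ennreal ((1 - \<delta>) ^ CARD('m) * (1 - \<delta>\<^sup>2) ^ CARD('m)) = ?d * ?k"
    using \<delta> delta_sq by (intro ennreal_mult) auto
  then have "ennreal ((1 - \<delta>) ^ CARD('m) * (1 - \<delta>\<^sup>2) ^ CARD('m)) * line_count (\<iota> ` unit_cube) * hausdorff_outer CARD('m) F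
     = ?d * ?k * line_count (\<iota> ` unit_cube) * hausdorff_outer CARD('m) F" by simp
  also have "\<dots> \<le> ?d * ?k * line_count (\<iota> ` unit_cube) * (?l * g)"
    by (intro mult_left_mono hausdorff_bounds(1)) auto
  also have "\<dots> = ?l * (?k * (?d * g * line_count (\<iota> ` unit_cube)))" by (simp add: mult_ac)
  also have "\<dots> \<le> ?l * (?k * (line_count F + g * hausdorff_outer CARD('m) (band \<delta> \<nu>)))"
    by (intro mult_left_mono le) auto
  also have "\<dots> = ?l * (?k * line_count F + hausdorff_outer CARD('m) (band \<delta> \<nu>) * (?k * g))"
    by (simp add: distrib_left mult_ac)
  also have "\<dots> \<le> ?l * (1 * line_count F + hausdorff_outer CARD('m) (band \<delta> \<nu>) * hausdorff_outer CARD('m) F)"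
    by (intro mult_left_mono add_mono mult_right_mono k1 hausdorff_bounds(2)) auto
  finally show ?thesis by simp
qed

end

section \<open>Rectifiable sets\<close>

lemma frame_exists:
  fixes \<nu> :: "'a::euclidean_space"
  assumes "DIM('a) = Suc DIM('b::euclidean_space)" "norm \<nu> = 1"
  obtains \<iota> :: "'b::euclidean_space \<Rightarrow> 'a" where "frame \<iota> \<nu>"
  using hyperplane_frame[OF assms] assms(2) unfolding frame_def by metis

text \<open>The linear isometry \<open>R\<close> carries the coordinates and the normal of one
  hyperplane to those of the other, and both quantities are invariant under it.\<close>

lemma frames_congruent:
  fixes \<iota> \<iota>' :: "'b::euclidean_space \<Rightarrow> 'a::euclidean_space"
  assumes dim: "DIM('a) = Suc DIM('b)" and fr: "frame \<iota> \<nu>" "frame \<iota>' \<nu>'"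
  shows "line_count (\<iota> ` unit_cube) = line_count (\<iota>' ` unit_cube)"
    "hausdorff_outer k (band \<delta> \<nu>) = hausdorff_outer k (band \<delta> \<nu>')"
proof -
  let ?T = "frame_map \<iota> \<nu>" and ?T' = "frame_map \<iota>' \<nu>'"
  have \<iota>: "linear \<iota>" "\<And>y. norm (\<iota> y) = norm y" "range \<iota> = {u. \<nu> \<bullet> u = 0}" "norm \<nu> = 1"
    using fr(1) unfolding frame_def by blast+
  have \<iota>': "linear \<iota>'" "\<And>y. norm (\<iota>' y) = norm y" "range \<iota>' = {u. \<nu>' \<bullet> u = 0}" "norm \<nu>' = 1"
    using fr(2) unfolding frame_def by blast+
  note T = frame_map_isometry[OF \<iota>] and T' = frame_map_isometry[OF \<iota>']
  have "inj ?T"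
  proof -
    have "p = 0" if "?T p = 0" for p using T(2)[of p] that by simp
    then show ?thesis using linear_injective_0[OF T(1)] by blast
  qed
  then obtain G where G: "linear G" "G \<circ> ?T = id" using linear_injective_left_inverse[OF T(1)] by blast
  have GT: "G (?T p) = p" for p using G(2) by (rule pointfree_idE)
  have TG: "?T (G x) = x" for x
  proof -
    have "x \<in> range ?T" using T(3) by simp
    then obtain p where "x = ?T p" by blast
    then show ?thesis by (simp add: GT)
  qed
  define R where "R = ?T' \<circ> G"
  have RT: "R (?T p) = ?T' p" for p by (simp add: R_def GT)
  have linR: "linear R" unfolding R_def by (intro linear_compose G(1) T'(1))
  have normR: "norm (R x) = norm x" for x using RT[of "G x"] T(2)[of "G x"] T'(2)[of "G x"] by (simp add: TG)
  have surjR: "surj R"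
  proof -
    have "y \<in> range R" for y
    proof -
      have "y \<in> range ?T'" using T'(3) by simp
      then obtain p where "y = ?T' p" by blast
      then have "y = R (?T p)" by (simp add: RT)
      then show ?thesis by blast
    qed
    then show ?thesis by blast
  qed
  have R\<nu>: "R \<nu> = \<nu>'" using RT[of "(0, 1)"] by (simp add: frame_map_def linear_0[OF \<iota>(1)] linear_0[OF \<iota>'(1)])
  have R\<iota>: "R (\<iota> y) = \<iota>' y" for y using RT[of "(y, 0)"] by (simp add: frame_map_def)
  have dR: "dist (R x) (R y) = dist x y" for x y by (rule linear_norm_dist[OF linR normR])
  have injR: "x = y" if "R x = R y" for x y using dR[of x y] that by simp
  have "R -` (\<iota>' ` unit_cube) = \<iota> ` unit_cube"
    by (auto simp: R\<iota>) (metis R\<iota> injR image_eqI)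
  then show "line_count (\<iota> ` unit_cube) = line_count (\<iota>' ` unit_cube)"
    using line_count_isometry[OF dim linR normR surjR frame_image_F_sigma[OF fr(2)]] by simp
  have "orthogonal_transformation R" using linR normR by (simp add: orthogonal_transformation)
  then have ip: "R x \<bullet> R y = x \<bullet> y" for x y by (simp add: orthogonal_transformation_def)
  have "R ` band \<delta> \<nu> = band \<delta> \<nu>'"
  proof (intro set_eqI iffI)
    fix w assume "w \<in> band \<delta> \<nu>'"
    moreover obtain v where "w = R v" using surjR by blast
    ultimately show "w \<in> R ` band \<delta> \<nu>" by (auto simp: band_def normR R\<nu>[symmetric] ip)
  qed (auto simp: band_def normR R\<nu>[symmetric] ip)
  then show "hausdorff_outer k (band \<delta> \<nu>) = hausdorff_outer k (band \<delta> \<nu>')"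
    using hausdorff_outer_isometric[of "band \<delta> \<nu>" R "\<lambda>x. x" k] dR by simp
qed

section \<open>Exhausting a covered set by flat pieces\<close>

lemma hausdorff_outer_null_UN:
  assumes I: "countable I" and A: "\<And>i. i \<in> I \<Longrightarrow> hausdorff_outer m (A i) = 0"
  shows "hausdorff_outer m (\<Union>i\<in>I. A i) = 0"
proof (cases "I = {}")
  case False
  have "(\<Union>i\<in>I. A i) = (\<Union>n. A (from_nat_into I n))" using range_from_nat_into[OF False I] by (metis image_image)
  then have "hausdorff_outer m (\<Union>i\<in>I. A i) \<le> (\<Sum>n. hausdorff_outer m (A (from_nat_into I n)))"
    by (simp only: hausdorff_outer_subadditive)
  also have "\<dots> = 0" using A from_nat_into[OF False] by simp
  finally show ?thesis by simp
qed (simp add: hausdorff_outer_empty)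

lemma lipschitz_image_finite:
  fixes f :: "'b::euclidean_space \<Rightarrow> 'c::metric_space"
  assumes "L-lipschitz_on UNIV f" "bounded C"
  shows "hausdorff_outer DIM('b) (f ` C) < top"
proof -
  obtain K where K: "C \<subseteq> cball 0 K" using assms(2) unfolding bounded_iff by (auto simp: subset_iff)
  have "hausdorff_outer DIM('b) (f ` C) \<le> ennreal ((L + 1) ^ DIM('b)) * hausdorff_outer DIM('b) ((\<lambda>x. x) ` C)"
  proof (rule hausdorff_outer_lipschitz)
    show "L + 1 > 0" using lipschitz_on_nonneg[OF assms(1)] by linarith
    fix x y
    have "dist (f x) (f y) \<le> L * dist x y" using lipschitz_onD[OF assms(1)] by simp
    also have "\<dots> \<le> (L + 1) * dist x y" by (intro mult_right_mono) auto
    finally show "dist (f x) (f y) \<le> (L + 1) * dist x y" .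
  qed
  also have "\<dots> \<le> ennreal ((L + 1) ^ DIM('b)) * hausdorff_outer DIM('b) (cball 0 K :: 'b set)"
    using K by (intro mult_left_mono) (auto intro: hausdorff_outer_mono)
  also have "\<dots> < top"
    using emeasure_lborel_cball_finite[of "0::'b" K] by (simp add: hausdorff_outer_eq_lborel ennreal_mult_less_top)
  finally show ?thesis .
qed

text \<open>The error is relative to distances in the image of \<open>Q\<close>, as in
  \<open>flat_piece\<close>, and not to distances of parameters. The map belongs to the triple so
  that pieces of different parametrisations fit into one family.\<close>

definition good_piece :: "real \<Rightarrow> ((real^'m \<Rightarrow> real^'n) \<times> (real^'m) set \<times> (real^'m^'n)) \<Rightarrow> bool" where
  "good_piece e t \<longleftrightarrow> (case t of (f, C, Q) \<Rightarrow> (\<exists>L. L-lipschitz_on UNIV f) \<and> compact C \<and> inj ((*v) Q) \<and>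
     (\<forall>x\<in>C. \<forall>y\<in>C. norm (f x - f y - (Q *v x - Q *v y)) \<le> e * norm (Q *v x - Q *v y)))"

text \<open>An injective \<open>Q\<close> stretches every vector by at least a factor
  \<open>lm Q > 0\<close>, so the tolerance \<open>e * lm Q\<close> relative to parameters becomes
  \<open>e\<close> relative to the image. Here the variable tolerance of
  \<open>lipschitz_pieces\<close> is put to use.\<close>

lemma lipschitz_good_pieces:
  fixes f :: "real^'m::{finite,wellorder} \<Rightarrow> real^'n"
  assumes lip: "L-lipschitz_on UNIV f" and e: "e > 0"
  obtains \<T> where "countable \<T>" "\<forall>t\<in>\<T>. good_piece e t \<and> fst t = f"
    "hausdorff_outer CARD('m) (range f - (\<Union>t\<in>\<T>. fst t ` fst (snd t))) = 0"
proof -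
  define low where "low (Q :: ((real,'m) vec,'n) vec) B \<longleftrightarrow> B > 0 \<and> (\<forall>x. B * norm x \<le> norm (Q *v x))" for Q B
  define lm where "lm Q = (SOME B. low Q B)" for Q
  have lmQ: "low Q (lm Q)" if "inj ((*v) Q)" for Q
  proof -
    have "\<exists>B. low Q B"
      by (rule linear_inj_bounded_below_pos[OF matrix_vector_mul_linear that]) (auto simp: low_def)
    then show ?thesis unfolding lm_def by (rule someI_ex)
  qed
  have pos: "e * lm Q > 0" if "inj ((*v) Q)" for Q using lmQ[OF that] e by (simp add: low_def)
  obtain \<P> where P: "countable \<P>" "\<forall>C Q. (C, Q) \<in> \<P> \<longrightarrow> compact C \<and> inj ((*v) Q) \<and> linear_piece f (e * lm Q) C Q"
    "hausdorff_outer CARD('m) (f ` (UNIV - \<Union>(fst ` \<P>))) = 0"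
    by (rule lipschitz_pieces[where \<rho> = "\<lambda>Q. e * lm Q", OF lip pos])
  show ?thesis
  proof (rule that)
    show "countable (Pair f ` \<P>)" using P(1) by simp
    show "\<forall>t\<in>Pair f ` \<P>. good_piece e t \<and> fst t = f"
    proof
      fix t assume "t \<in> Pair f ` \<P>"
      then obtain C Q where t: "t = (f, C, Q)" "(C, Q) \<in> \<P>" by auto
      then have CQ: "compact C" "inj ((*v) Q)" "linear_piece f (e * lm Q) C Q" using P(2) by auto
      have "norm (f x - f y - (Q *v x - Q *v y)) \<le> e * norm (Q *v x - Q *v y)" if xy: "x \<in> C" "y \<in> C" for x y
      proof -
        have "norm (f x - f y - Q *v (x - y)) \<le> e * lm Q * norm (x - y)"
          using CQ(3) xy unfolding linear_piece_def by blast
        also have "\<dots> \<le> e * norm (Q *v (x - y))"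
          using lmQ[OF CQ(2)] e unfolding low_def by (simp add: mult.assoc)
        finally show ?thesis by (simp add: matrix_vector_mult_diff_distrib)
      qed
      then show "good_piece e t \<and> fst t = f" using CQ lip unfolding good_piece_def t by auto
    qed
    have "range f - (\<Union>t\<in>Pair f ` \<P>. fst t ` fst (snd t)) \<subseteq> f ` (UNIV - \<Union>(fst ` \<P>))" by force
    then show "hausdorff_outer CARD('m) (range f - (\<Union>t\<in>Pair f ` \<P>. fst t ` fst (snd t))) = 0"
      by (rule hausdorff_outer_null_subset[OF P(3)])
  qed
qed

text \<open>The hyperplane that contains the range of \<open>Q\<close> changes from piece to piece;
  \<open>frames_congruent\<close> restates the estimates for one fixed frame, so that they can be
  summed with common constants. Restricting the parameters to \<open>C'\<close> gives them for every
  \<open>F_sigma\<close> part of the image.\<close>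

lemma good_piece_estimates:
  fixes f :: "real^'m::{finite,wellorder} \<Rightarrow> real^'n" and F :: "(real^'n) set"
  assumes dim: "CARD('n) = Suc CARD('m)" and fr: "frame (\<iota> :: real^'m::_ \<Rightarrow> real^'n) \<nu>"
    and \<delta>: "0 < \<delta>" "\<delta> < 1" and gp: "good_piece (\<delta>\<^sup>2) (f, C, Q)"
    and F: "F_sigma F" "F \<subseteq> f ` C"
  shows "ennreal ((1 - \<delta>\<^sup>2) ^ CARD('m)) * line_count F \<le>
    (ennreal ((1 + \<delta>) ^ CARD('m)) * line_count (\<iota> ` unit_cube) + hausdorff_outer CARD('m) (band \<delta> \<nu>)) * hausdorff_outer CARD('m) F"
    and "ennreal ((1 - \<delta>) ^ CARD('m) * (1 - \<delta>\<^sup>2) ^ CARD('m)) * line_count (\<iota> ` unit_cube) * hausdorff_outer CARD('m) F \<le>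
    ennreal ((1 + \<delta>\<^sup>2) ^ CARD('m)) * (line_count F + hausdorff_outer CARD('m) (band \<delta> \<nu>) * hausdorff_outer CARD('m) F)"
    and "hausdorff_outer CARD('m) F < top"
proof -
  have dim': "DIM(real^'n) = Suc CARD('m)" using dim by simp
  have dim'': "DIM(real^'n) = Suc DIM((real,'m) vec)" using dim by simp
  obtain L where lip: "L-lipschitz_on UNIV f" and C: "compact C" and Q: "inj ((*v) Q)"
    and flat: "\<And>x y. x \<in> C \<Longrightarrow> y \<in> C \<Longrightarrow> norm (f x - f y - (Q *v x - Q *v y)) \<le> \<delta>\<^sup>2 * norm (Q *v x - Q *v y)"
    using gp unfolding good_piece_def by auto
  have cont: "continuous_on UNIV f" using lip by (rule lipschitz_on_continuous_on)
  have contQ: "continuous_on UNIV ((*v) Q)"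
    by (intro linear_continuous_on) (simp add: matrix_vector_mul_bounded_linear)
  have linQ: "linear ((*v) Q)" by (rule matrix_vector_mul_linear)
  have "dim (range ((*v) Q)) \<le> dim (UNIV :: (real,'m) vec set)" by (rule dim_image_le[OF linQ])
  then have "dim (range ((*v) Q)) < DIM(real^'n)" using dim by simp
  then obtain a where a: "a \<noteq> 0" "span (range ((*v) Q)) \<subseteq> {x. a \<bullet> x = 0}" using lowdim_subset_hyperplane by blast
  define \<nu>' where "\<nu>' = a /\<^sub>R norm a"
  have \<nu>': "norm \<nu>' = 1" using a(1) by (simp add: \<nu>'_def)
  have rQ: "range ((*v) Q) \<subseteq> {u. \<nu>' \<bullet> u = 0}"
  proof
    fix u assume "u \<in> range ((*v) Q)"
    then have "u \<in> span (range ((*v) Q))" by (rule span_base)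
    then have "a \<bullet> u = 0" using a(2) by blast
    then show "u \<in> {u. \<nu>' \<bullet> u = 0}" by (simp add: \<nu>'_def)
  qed
  obtain \<iota>' :: "(real,'m) vec \<Rightarrow> real^'n" where fr': "frame \<iota>' \<nu>'" by (rule frame_exists[OF dim'' \<nu>'])
  define C' where "C' = C \<inter> f -` F"
  have C': "C' \<subseteq> C" "f ` C' = F" using F(2) unfolding C'_def by auto
  have FC': "F_sigma C'" unfolding C'_def
    by (intro F_sigma_Int F_sigma_closed compact_imp_closed C F_sigma_vimage F(1) cont)
  have fp: "flat_piece \<iota>' \<nu>' f ((*v) Q) C' \<delta>"
  proof (rule flat_piece.intro)
    show "F_sigma ((*v) Q ` C')" by (rule F_sigma_image[OF FC' C'(1) C contQ])
    show "bounded C'" using C'(1) compact_imp_bounded[OF C] bounded_subset by blast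
    show "F_sigma (f ` C')" using C'(2) F(1) by simp
    fix x y assume "x \<in> C'" "y \<in> C'"
    then show "norm (f x - f y - (Q *v x - Q *v y)) \<le> \<delta>\<^sup>2 * norm (Q *v x - Q *v y)" using C'(1) flat by blast
  next
    show "linear ((*v) Q)" by (rule linQ)
    show "inj ((*v) Q)" by (rule Q)
    show "range ((*v) Q) \<subseteq> {u. \<nu>' \<bullet> u = 0}" by (rule rQ)
    show "DIM((real, 'n) vec) = Suc CARD('m)" by (rule dim')
    show "frame \<iota>' \<nu>'" by (rule fr')
    show "0 < \<delta>" "\<delta> < 1" by (rule \<delta>)+
  qed
  note eq = frames_congruent[OF dim'' fr fr']
  show "ennreal ((1 - \<delta>\<^sup>2) ^ CARD('m)) * line_count F \<le>
    (ennreal ((1 + \<delta>) ^ CARD('m)) * line_count (\<iota> ` unit_cube) + hausdorff_outer CARD('m) (band \<delta> \<nu>)) * hausdorff_outer CARD('m) F"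
    using flat_piece.line_count_upper[OF fp] unfolding eq C'(2) .
  show "ennreal ((1 - \<delta>) ^ CARD('m) * (1 - \<delta>\<^sup>2) ^ CARD('m)) * line_count (\<iota> ` unit_cube) * hausdorff_outer CARD('m) F \<le>
    ennreal ((1 + \<delta>\<^sup>2) ^ CARD('m)) * (line_count F + hausdorff_outer CARD('m) (band \<delta> \<nu>) * hausdorff_outer CARD('m) F)"
    using flat_piece.line_count_lower[OF fp] unfolding eq C'(2) .
  have "hausdorff_outer CARD('m) F \<le> hausdorff_outer CARD('m) (f ` C)" by (rule hausdorff_outer_mono[OF F(2)])
  also have "\<dots> < top" using lipschitz_image_finite[OF lip compact_imp_bounded[OF C]] by simp
  finally show "hausdorff_outer CARD('m) F < top" .
qed

text \<open>The first argument fixes the parameter type. In contrast to \<open>rectifiable\<close>,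
  the maps are defined on a full Euclidean space, the setting of Rademacher's theorem.\<close>

definition lipschitz_covered :: "(real^'m::finite) itself \<Rightarrow> (real^'n) set \<Rightarrow> bool" where
  "lipschitz_covered _ E \<longleftrightarrow> (\<exists>\<F> :: (real^'m \<Rightarrow> real^'n) set. countable \<F> \<and> (\<forall>f\<in>\<F>. \<exists>L. L-lipschitz_on UNIV f) \<and>
     hausdorff_outer CARD('m) (E - (\<Union>f\<in>\<F>. range f)) = 0)"

lemma covered_pieces:
  fixes E :: "(real^'n) set"
  assumes dim: "CARD('n) = Suc CARD('m::{finite,wellorder})" and E: "closed E"
    and cov: "lipschitz_covered TYPE(real^'m::{finite,wellorder}) E" and e: "e > 0"
  obtains F :: "nat \<Rightarrow> (real^'n) set" where "disjoint_family F" "\<And>k. F_sigma (F k)"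
    "\<And>k. \<exists>(f :: real^'m::{finite,wellorder} \<Rightarrow> real^'n) C Q. good_piece e (f, C, Q) \<and> F k \<subseteq> f ` C"
    "line_count E = (\<Sum>k. line_count (F k))"
    "hausdorff_outer CARD('m) E = (\<Sum>k. hausdorff_outer CARD('m) (F k))"
proof -
  have dim'': "DIM(real^'n) = Suc DIM((real,'m) vec)" using dim by simp
  have m: "DIM(real^'n) - 1 = CARD('m)" using dim by simp
  obtain \<F> :: "((real,'m) vec \<Rightarrow> real^'n) set" where \<F>: "countable \<F>" "\<forall>f\<in>\<F>. \<exists>L. L-lipschitz_on UNIV f"
    "hausdorff_outer CARD('m) (E - (\<Union>f\<in>\<F>. range f)) = 0"
    using cov unfolding lipschitz_covered_def by blast
  define ok where "ok f \<T> \<longleftrightarrow> countable \<T> \<and> (\<forall>t\<in>\<T>. good_piece e t \<and> fst t = f) \<and>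
    hausdorff_outer CARD('m) (range f - (\<Union>t\<in>\<T>. fst t ` fst (snd t))) = 0"
    for f :: "(real,'m) vec \<Rightarrow> real^'n" and \<T>
  have "\<forall>f\<in>\<F>. \<exists>\<T>. ok f \<T>"
  proof
    fix f assume "f \<in> \<F>"
    then obtain L where L: "L-lipschitz_on UNIV f" using \<F>(2) by blast
    obtain \<T> where "countable \<T>" "\<forall>t\<in>\<T>. good_piece e t \<and> fst t = f"
      "hausdorff_outer CARD('m) (range f - (\<Union>t\<in>\<T>. fst t ` fst (snd t))) = 0"
      by (rule lipschitz_good_pieces[OF L e])
    then have "ok f \<T>" unfolding ok_def by (intro conjI)
    then show "\<exists>\<T>. ok f \<T>" by (rule exI)
  qed
  then obtain \<T> where \<T>: "\<forall>f\<in>\<F>. ok f (\<T> f)" by (rule bchoice[THEN exE])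
  obtain \<iota> :: "(real,'m) vec \<Rightarrow> real^'n" where \<iota>: "frame \<iota> (axis undefined 1)"
    by (rule frame_exists[OF dim'', of "axis undefined 1"]) (simp_all add: norm_axis_1)
  define Q0 where "Q0 = matrix \<iota>"
  have l\<iota>: "linear \<iota>" "\<And>y. norm (\<iota> y) = norm y" using \<iota> unfolding frame_def by blast+
  have "y = 0" if "\<iota> y = 0" for y using l\<iota>(2)[of y] that by simp
  then have "inj \<iota>" using linear_injective_0[OF l\<iota>(1)] by blast
  then have Q0: "inj ((*v) Q0)" unfolding Q0_def using matrix_vector_mul(2)[OF l\<iota>(1)] by simp
  \<comment> \<open>An empty piece keeps the family \<open>\<S>\<close> nonempty, as its enumeration
    by \<open>from_nat_into\<close> requires; its matrix can be any injective one.\<close>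
  define dummy where "dummy = (\<lambda>_ :: (real,'m) vec. 0 :: real^'n, {} :: (real,'m) vec set, Q0)"
  have "0-lipschitz_on UNIV (\<lambda>_ :: (real,'m) vec. 0 :: real^'n)" by (rule lipschitz_onI) auto
  then have gd: "good_piece e dummy" unfolding good_piece_def dummy_def using Q0 by auto
  define \<S> where "\<S> = insert dummy (\<Union>f\<in>\<F>. \<T> f)"
  have \<S>: "countable \<S>" "\<S> \<noteq> {}" unfolding \<S>_def using \<F>(1) \<T> by (auto simp: ok_def)
  have gS: "good_piece e t" if "t \<in> \<S>" for t using that gd \<T> unfolding \<S>_def ok_def by auto
  define t where "t = from_nat_into \<S>"
  have tS: "t k \<in> \<S>" for k unfolding t_def by (rule from_nat_into[OF \<S>(2)])
  have rt: "range t = \<S>" unfolding t_def by (rule range_from_nat_into[OF \<S>(2,1)])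
  define W where "W k = fst (t k) ` fst (snd (t k))" for k
  have cW: "closed (W k)" for k
  proof -
    obtain L where L: "L-lipschitz_on UNIV (fst (t k))" and c: "compact (fst (snd (t k)))"
      using gS[OF tS[of k]] unfolding good_piece_def by (auto simp: case_prod_unfold)
    show ?thesis unfolding W_def
      by (intro compact_imp_closed compact_continuous_image c continuous_on_subset[OF lipschitz_on_continuous_on[OF L]]) auto
  qed
  define F where "F k = E \<inter> disjointed W k" for k
  have dF: "disjoint_family F"
    using disjoint_family_disjointed[of W] unfolding F_def disjoint_family_on_def by blast
  have FF: "F_sigma (F k)" for k
  proof -
    have "F k = (E \<inter> W k) - (\<Union>i\<in>{0..<k}. W i)" unfolding F_def disjointed_def by blast
    also have "F_sigma \<dots>" using cW E
      by (intro F_sigma_Diff_closed F_sigma_closed closed_Int closed_UN) auto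
    finally show ?thesis .
  qed
  have UF: "(\<Union>k. F k) = E \<inter> (\<Union>k. W k)" unfolding F_def using UN_disjointed_eq[of W] by blast
  have null: "hausdorff_outer CARD('m) (E - (\<Union>k. F k)) = 0"
  proof -
    have "hausdorff_outer CARD('m) (\<Union>f\<in>\<F>. range f - (\<Union>t\<in>\<T> f. fst t ` fst (snd t))) = 0"
      using \<T> by (intro hausdorff_outer_null_UN[OF \<F>(1)]) (auto simp: ok_def)
    from hausdorff_outer_null_Un[OF \<F>(3) this]
    show ?thesis
    proof (rule hausdorff_outer_null_subset)
      have "(\<Union>t\<in>\<T> f. fst t ` fst (snd t)) \<subseteq> (\<Union>k. W k)" if "f \<in> \<F>" for f
      proof -
        have "(\<Union>k. W k) = (\<Union>t\<in>\<S>. fst t ` fst (snd t))" unfolding W_def rt[symmetric] by blast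
        then show ?thesis using that unfolding \<S>_def by blast
      qed
      then show "E - (\<Union>k. F k) \<subseteq> (E - (\<Union>f\<in>\<F>. range f)) \<union> (\<Union>f\<in>\<F>. range f - (\<Union>t\<in>\<T> f. fst t ` fst (snd t)))"
        unfolding UF by blast
    qed
  qed
  have FE: "(\<Union>k. F k) \<subseteq> E" unfolding F_def by blast
  show ?thesis
  proof (rule that[OF dF FF])
    fix k
    obtain f C Q where tk: "t k = (f, C, Q)" by (cases "t k") auto
    have "F k \<subseteq> f ` C" using disjointed_subset[of W k] unfolding F_def W_def tk by auto
    then show "\<exists>(f :: (real,'m) vec \<Rightarrow> real^'n) C Q. good_piece e (f, C, Q) \<and> F k \<subseteq> f ` C" using gS[OF tS[of k]] tk by metis
  next
    have "line_count E = line_count (\<Union>k. F k)"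
      by (rule line_count_null_diff[OF F_sigma_closed[OF E] F_sigma_UN[of F, OF FF] FE]) (unfold m, rule null)
    also have "\<dots> = (\<Sum>k. line_count (F k))" by (rule line_count_UN[OF dim'' dF FF])
    finally show "line_count E = (\<Sum>k. line_count (F k))" .
    have Fb: "F k \<in> sets borel" for k by (rule F_sigma_borel[OF FF])
    have "hausdorff_outer CARD('m) E = hausdorff_outer CARD('m) (\<Union>k. F k)"
    proof (rule antisym)
      have "hausdorff_outer CARD('m) E \<le> hausdorff_outer CARD('m) ((\<Union>k. F k) \<union> (E - (\<Union>k. F k)))"
        by (rule hausdorff_outer_mono) blast
      also have "\<dots> \<le> hausdorff_outer CARD('m) (\<Union>k. F k) + hausdorff_outer CARD('m) (E - (\<Union>k. F k))" by (rule hausdorff_outer_Un)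
      finally show "hausdorff_outer CARD('m) E \<le> hausdorff_outer CARD('m) (\<Union>k. F k)" by (simp only: null add_0_right)
    qed (rule hausdorff_outer_mono[OF FE])
    also have "\<dots> = emeasure (hausdorff_measure CARD('m)) (\<Union>k. F k)"
      using Fb by (intro emeasure_hausdorff_measure[symmetric]) auto
    also have "\<dots> = (\<Sum>k. emeasure (hausdorff_measure CARD('m)) (F k))"
      using Fb dF by (intro suminf_emeasure[symmetric]) auto
    also have "\<dots> = (\<Sum>k. hausdorff_outer CARD('m) (F k))" using Fb by (simp add: emeasure_hausdorff_measure)
    finally show "hausdorff_outer CARD('m) E = (\<Sum>k. hausdorff_outer CARD('m) (F k))" .
  qed
qed

section \<open>Bands of almost tangential directions\<close>

lemma band_decreasing: "\<delta> \<le> \<delta>' \<Longrightarrow> band \<delta> \<nu> \<subseteq> band \<delta>' \<nu>"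
  by (auto simp: band_def)

lemma band_subset_sphere: "band \<delta> \<nu> \<subseteq> sphere 0 1"
  by (auto simp: band_def)

text \<open>The equator is an isometric image of the unit sphere in a space of the measured
  dimension, where spheres are Lebesgue null.\<close>

lemma equator_null:
  fixes \<iota> :: "'b::euclidean_space \<Rightarrow> 'a::euclidean_space"
  assumes fr: "frame \<iota> \<nu>"
  shows "hausdorff_outer DIM('b) {v \<in> sphere 0 1. v \<bullet> \<nu> = 0} = 0"
proof -
  have \<iota>: "\<And>y. norm (\<iota> y) = norm y" "range \<iota> = {u. \<nu> \<bullet> u = 0}" using fr unfolding frame_def by blast+
  have "{v \<in> sphere 0 1. v \<bullet> \<nu> = 0} = \<iota> ` sphere 0 1"
  proof (intro set_eqI iffI)
    fix v assume v: "v \<in> {v \<in> sphere 0 1. v \<bullet> \<nu> = 0}"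
    then have "v \<in> range \<iota>" unfolding \<iota>(2) by (simp add: inner_commute)
    then obtain y where "v = \<iota> y" by blast
    then show "v \<in> \<iota> ` sphere 0 1" using v \<iota>(1) by auto
  next
    fix v assume "v \<in> \<iota> ` sphere 0 1"
    then obtain y where y: "v = \<iota> y" "norm y = 1" by auto
    have "v \<in> {u. \<nu> \<bullet> u = 0}" using y \<iota>(2) by blast
    then show "v \<in> {v \<in> sphere 0 1. v \<bullet> \<nu> = 0}" using y \<iota>(1) by (simp add: inner_commute)
  qed
  then show ?thesis using frame_hausdorff_image[OF fr] hausdorff_outer_null[OF negligible_sphere] by simp
qed

text \<open>Continuity from above, which relies on the finite area of the sphere. The widths
  \<open>1 / (real k + 2)\<close> lie strictly between 0 and 1, as \<open>\<delta>\<close> does in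
  \<open>flat_piece\<close>.\<close>

lemma band_tendsto:
  fixes \<iota> :: "'b::euclidean_space \<Rightarrow> 'a::euclidean_space"
  assumes fr: "frame \<iota> \<nu>" and fin: "hausdorff_outer DIM('b) (sphere (0::'a) 1) < top"
  shows "(\<lambda>k. hausdorff_outer DIM('b) (band (1 / (real k + 2)) \<nu>)) \<longlonglongrightarrow> 0"
proof -
  let ?H = "hausdorff_measure DIM('b) :: 'a measure"
  let ?B = "\<lambda>k::nat. band (1 / (real k + 2)) \<nu>"
  have eq: "emeasure ?H (?B k) = hausdorff_outer DIM('b) (?B k)" for k
    by (rule emeasure_hausdorff_measure[OF band_borel])
  have "(\<lambda>k. emeasure ?H (?B k)) \<longlonglongrightarrow> emeasure ?H (\<Inter>k. ?B k)"
  proof (rule Lim_emeasure_decseq)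
    show "range ?B \<subseteq> sets ?H" using band_borel by auto
    show "decseq ?B" unfolding decseq_def by (intro allI impI band_decreasing) (simp add: frac_le)
    show "emeasure ?H (?B k) \<noteq> \<infinity>" for k
      using hausdorff_outer_mono[OF band_subset_sphere, of "DIM('b)" "1 / (real k + 2)" \<nu>] fin eq[of k]
      by (metis infinity_ennreal_def leD top.extremum)
  qed
  also have "(\<Inter>k. ?B k) = {v \<in> sphere 0 1. v \<bullet> \<nu> = 0}"
  proof (intro set_eqI iffI)
    fix v assume v: "v \<in> (\<Inter>k. ?B k)"
    have "v \<bullet> \<nu> = 0"
    proof (rule ccontr)
      assume "v \<bullet> \<nu> \<noteq> 0"
      then obtain k where k: "1 / real (Suc k) < \<bar>v \<bullet> \<nu>\<bar>" using nat_approx_posE[of "\<bar>v \<bullet> \<nu>\<bar>"] by auto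
      have "1 / (real k + 2) \<le> 1 / real (Suc k)" by (simp add: field_simps)
      moreover have "\<bar>v \<bullet> \<nu>\<bar> < 1 / (real k + 2)" using v by (auto simp: band_def)
      ultimately show False using k by linarith
    qed
    then show "v \<in> {v \<in> sphere 0 1. v \<bullet> \<nu> = 0}" using v by (auto simp: band_def)
  qed (auto simp: band_def)
  also have "emeasure ?H \<dots> = 0"
  proof -
    have "{v \<in> sphere 0 1. v \<bullet> \<nu> = 0} = sphere 0 1 \<inter> {v. v \<bullet> \<nu> = 0}" by blast
    also have "\<dots> \<in> sets borel" by (intro borel_closed closed_Int closed_sphere closed_Collect_eq continuous_intros)
    finally show ?thesis using equator_null[OF fr] by (simp add: emeasure_hausdorff_measure)
  qed
  finally show ?thesis unfolding eq .
qed

section \<open>The unit sphere, parametrised by central projection from its tangent planes\<close>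

definition sphere_chart :: "('b \<Rightarrow> 'a) \<Rightarrow> 'a \<Rightarrow> 'b \<Rightarrow> 'a::euclidean_space" where
  "sphere_chart \<iota> b y = (b + \<iota> y) /\<^sub>R norm (b + \<iota> y)"

lemma normalize_lipschitz:
  fixes x y :: "'a::real_normed_vector"
  assumes "norm x \<ge> 1" "norm y \<ge> 1"
  shows "norm (x /\<^sub>R norm x - y /\<^sub>R norm y) \<le> 2 * norm (x - y)"
proof -
  have n: "norm x > 0" "norm y > 0" using assms by auto
  have eq: "x /\<^sub>R norm x - y /\<^sub>R norm y = (x - y) /\<^sub>R norm x + (inverse (norm x) - inverse (norm y)) *\<^sub>R y"
    by (simp add: algebra_simps)
  have "inverse (norm x) - inverse (norm y) = (norm y - norm x) * inverse (norm x) * inverse (norm y)"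
    using n by (simp add: field_simps)
  then have "norm ((inverse (norm x) - inverse (norm y)) *\<^sub>R y) = \<bar>norm y - norm x\<bar> * inverse (norm x)"
    using n by (simp add: abs_mult)
  also have "\<dots> \<le> norm (x - y) * inverse (norm x)"
    using norm_triangle_ineq3[of y x] by (intro mult_right_mono) (auto simp: norm_minus_commute)
  finally have "norm (x /\<^sub>R norm x - y /\<^sub>R norm y) \<le> norm (x - y) * inverse (norm x) + norm (x - y) * inverse (norm x)"
    unfolding eq by (intro order_trans[OF norm_triangle_ineq add_mono]) (auto simp: mult.commute)
  also have "\<dots> \<le> norm (x - y) * 1 + norm (x - y) * 1"
    using assms by (intro add_mono mult_left_mono) (auto simp: inverse_le_1_iff)
  finally show ?thesis by simp
qed

lemma sphere_chart_lipschitz: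
  fixes \<iota> :: "'b::euclidean_space \<Rightarrow> 'a::euclidean_space"
  assumes "frame \<iota> b"
  shows "2-lipschitz_on UNIV (sphere_chart \<iota> b)"
proof (rule lipschitz_onI)
  have \<iota>: "linear \<iota>" "\<And>y. norm (\<iota> y) = norm y" "range \<iota> = {u. b \<bullet> u = 0}" "norm b = 1" using assms unfolding frame_def by blast+
  have big: "norm (b + \<iota> y) \<ge> 1" for y
  proof -
    have "b \<bullet> \<iota> y = 0" using \<iota>(3) by blast
    then have "b \<bullet> (b + \<iota> y) = 1" using \<iota>(4) by (simp add: inner_add_right dot_square_norm)
    then show ?thesis using Cauchy_Schwarz_ineq2[of b "b + \<iota> y"] \<iota>(4) by simp
  qed
  fix x y
  have "dist (sphere_chart \<iota> b x) (sphere_chart \<iota> b y) \<le> 2 * norm ((b + \<iota> x) - (b + \<iota> y))"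
    unfolding sphere_chart_def dist_norm by (rule normalize_lipschitz[OF big big])
  also have "norm ((b + \<iota> x) - (b + \<iota> y)) = dist x y"
    using linear_norm_dist[OF \<iota>(1,2), of x y] by (simp add: dist_norm)
  finally show "dist (sphere_chart \<iota> b x) (sphere_chart \<iota> b y) \<le> 2 * dist x y" .
qed simp

text \<open>The absolute values of the coordinates of a unit vector add up to at least 1, so one of
  them is at least \<open>1 / real DIM('a)\<close>. Dividing by it moves \<open>x\<close> into the
  tangent plane at the corresponding \<open>b\<close>, to a point whose coordinate vector
  \<open>y\<close> has norm at most \<open>real DIM('a)\<close>.\<close>

lemma sphere_subset_charts:
  fixes j :: "'a \<Rightarrow> 'b::euclidean_space \<Rightarrow> 'a::euclidean_space"
  assumes fr: "\<And>b. norm b = 1 \<Longrightarrow> frame (j b) b"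
  shows "sphere 0 1 \<subseteq> (\<Union>b\<in>Basis \<union> uminus ` Basis. sphere_chart (j b) b ` cball 0 (real DIM('a)))"
proof
  fix x :: 'a assume x: "x \<in> sphere 0 1"
  have "\<exists>i\<in>Basis. 1 / real DIM('a) \<le> \<bar>x \<bullet> i\<bar>"
  proof (rule ccontr)
    assume "\<not> ?thesis"
    then have "(\<Sum>i\<in>Basis. \<bar>x \<bullet> i\<bar>) < (\<Sum>i\<in>(Basis::'a set). 1 / real DIM('a))"
      by (intro sum_strict_mono) auto
    then show False using norm_le_l1[of x] x by simp
  qed
  then obtain i where i: "i \<in> Basis" "1 / real DIM('a) \<le> \<bar>x \<bullet> i\<bar>" by blast
  define b where "b = (if x \<bullet> i \<ge> 0 then i else - i)"
  have bB: "b \<in> Basis \<union> uminus ` Basis" using i(1) by (simp add: b_def)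
  have nb: "norm b = 1" using i(1) by (simp add: b_def)
  define s where "s = b \<bullet> x"
  have s: "1 / real DIM('a) \<le> s" using i(2) by (auto simp: s_def b_def inner_commute split: if_splits)
  have "1 / real DIM('a) > 0" by simp
  then have s0: "s > 0" using s by linarith
  have \<iota>: "\<And>y. norm (j b y) = norm y" "range (j b) = {u. b \<bullet> u = 0}" using fr[OF nb] unfolding frame_def by blast+
  have "b \<bullet> (x /\<^sub>R s - b) = 0" using s0 nb by (simp add: inner_diff_right s_def[symmetric] dot_square_norm)
  then obtain y where y: "x /\<^sub>R s - b = j b y" using \<iota>(2) by blast
  then have bj: "b + j b y = x /\<^sub>R s" by (metis add.commute diff_add_cancel)
  have "norm (x /\<^sub>R s) = inverse s" using x s0 by simp
  then have "sphere_chart (j b) b y = x" unfolding sphere_chart_def bj using s0 by simp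
  moreover have "norm y \<le> real DIM('a)"
  proof -
    have "norm (perp b (x /\<^sub>R s)) \<le> norm (x /\<^sub>R s)" by (rule norm_perp_le[OF nb])
    also have "perp b (x /\<^sub>R s) = x /\<^sub>R s - b" using s0 by (simp add: perp_def s_def[symmetric])
    finally have "norm y \<le> inverse s" using x s0 y \<iota>(1)[of y] by simp
    also have "\<dots> \<le> real DIM('a)" using s s0 by (simp add: field_simps)
    finally show ?thesis .
  qed
  ultimately show "x \<in> (\<Union>b\<in>Basis \<union> uminus ` Basis. sphere_chart (j b) b ` cball 0 (real DIM('a)))"
    using bB by (intro UN_I[of b] image_eqI[of _ _ y]) auto
qed

lemma frames_choice:
  assumes "DIM('a::euclidean_space) = Suc DIM('b::euclidean_space)"
  obtains j :: "'a \<Rightarrow> 'b::euclidean_space \<Rightarrow> 'a::euclidean_space" where "\<forall>b. norm b = 1 \<longrightarrow> frame (j b) b"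
proof -
  have "\<forall>b\<in>{b::'a. norm b = 1}. \<exists>\<iota> :: 'b \<Rightarrow> 'a. frame \<iota> b"
  proof
    fix b :: 'a assume "b \<in> {b. norm b = 1}"
    then have "norm b = 1" by simp
    then obtain \<iota> :: "'b \<Rightarrow> 'a" where "frame \<iota> b" by (rule frame_exists[OF assms])
    then show "\<exists>\<iota> :: 'b \<Rightarrow> 'a. frame \<iota> b" by blast
  qed
  then obtain j :: "'a \<Rightarrow> 'b \<Rightarrow> 'a" where "\<forall>b\<in>{b. norm b = 1}. frame (j b) b" by (rule bchoice[THEN exE])
  then show ?thesis by (intro that[of j]) simp
qed

lemma hausdorff_sphere_finite:
  assumes dim: "DIM('a::euclidean_space) = Suc DIM('b::euclidean_space)"
  shows "hausdorff_outer DIM('b) (sphere (0::'a) 1) < top"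
proof -
  obtain j :: "'a \<Rightarrow> 'b \<Rightarrow> 'a" where "\<forall>b. norm b = 1 \<longrightarrow> frame (j b) b" by (rule frames_choice[OF dim])
  then have j: "frame (j b) b" if "norm b = 1" for b using that by blast
  let ?I = "Basis \<union> uminus ` Basis :: 'a set"
  have fin: "hausdorff_outer DIM('b) (\<Union>b\<in>I. sphere_chart (j b) b ` cball 0 (real DIM('a))) < top"
    if "finite I" "I \<subseteq> ?I" for I
    using that
  proof (induction I)
    case empty
    then show ?case by (simp add: hausdorff_outer_empty)
  next
    case (insert b I)
    then have "norm b = 1" by auto
    then have "hausdorff_outer DIM('b) (sphere_chart (j b) b ` cball 0 (real DIM('a))) < top"
      by (intro lipschitz_image_finite[OF sphere_chart_lipschitz[OF j]]) auto
    moreover have "hausdorff_outer DIM('b) (\<Union>b\<in>I. sphere_chart (j b) b ` cball 0 (real DIM('a))) < top"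
      using insert by simp
    ultimately have "hausdorff_outer DIM('b) (sphere_chart (j b) b ` cball 0 (real DIM('a))) +
      hausdorff_outer DIM('b) (\<Union>b\<in>I. sphere_chart (j b) b ` cball 0 (real DIM('a))) < top"
      by simp
    from le_less_trans[OF hausdorff_outer_Un this] show ?case by simp
  qed
  have "hausdorff_outer DIM('b) (sphere (0::'a) 1) \<le> hausdorff_outer DIM('b) (\<Union>b\<in>?I. sphere_chart (j b) b ` cball 0 (real DIM('a)))"
    by (intro hausdorff_outer_mono sphere_subset_charts j)
  also have "\<dots> < top" by (rule fin) auto
  finally show ?thesis .
qed

lemma sphere_covered:
  assumes dim: "CARD('n::finite) = Suc CARD('m::finite)"
  shows "lipschitz_covered TYPE(real^'m) (sphere (0::real^'n) 1)"
proof -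
  have dim': "DIM(real^'n) = Suc DIM(real^'m)" using dim by simp
  obtain j :: "real^'n \<Rightarrow> real^'m \<Rightarrow> real^'n" where "\<forall>b. norm b = 1 \<longrightarrow> frame (j b) b" by (rule frames_choice[OF dim'])
  then have j: "frame (j b) b" if "norm b = 1" for b using that by blast
  let ?I = "Basis \<union> uminus ` Basis :: (real^'n) set"
  have n1: "norm b = 1" if "b \<in> ?I" for b using that by auto
  let ?F = "(\<lambda>b. sphere_chart (j b) b) ` ?I"
  have "sphere 0 1 - (\<Union>f\<in>?F. range f) = {}"
    using sphere_subset_charts[of j, OF j] by blast
  then have "hausdorff_outer CARD('m) (sphere 0 1 - (\<Union>f\<in>?F. range f)) = 0" by (simp only: hausdorff_outer_empty)
  moreover have "countable ?F" by (intro countable_image countable_finite) auto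
  moreover have "\<forall>f\<in>?F. \<exists>L. L-lipschitz_on UNIV f" using sphere_chart_lipschitz[OF j[OF n1]] by blast
  ultimately show ?thesis unfolding lipschitz_covered_def by blast
qed

lemma shadow_sphere:
  fixes v :: "'a::euclidean_space"
  assumes dim: "DIM('a) = Suc DIM('b::euclidean_space)" and v: "norm v = 1"
  shows "shadow (sphere 0 1) v = ennreal (2 * unit_ball_vol (real DIM('b)))"
proof -
  obtain \<iota> :: "'b \<Rightarrow> 'a" where fr: "frame \<iota> v" by (rule frame_exists[OF dim v])
  have \<iota>: "linear \<iota>" "\<And>y. norm (\<iota> y) = norm y" "range \<iota> = {u. v \<bullet> u = 0}" using fr unfolding frame_def by blast+
  have m: "DIM('a) - 1 = DIM('b)" using dim by simp
  have FS: "F_sigma (sphere (0::'a) 1)" by (rule F_sigma_closed) (rule closed_sphere)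
  have nt: "(norm (\<iota> y + t *\<^sub>R v))\<^sup>2 = (norm y)\<^sup>2 + t\<^sup>2" for y t
  proof -
    have "v \<bullet> \<iota> y = 0" using \<iota>(3) by blast
    then have "orthogonal (\<iota> y) (t *\<^sub>R v)" by (simp add: orthogonal_def inner_commute)
    from norm_add_Pythagorean[OF this] have "(norm (\<iota> y + t *\<^sub>R v))\<^sup>2 = (norm (\<iota> y))\<^sup>2 + t\<^sup>2"
      using v by simp
    then show ?thesis by (simp add: \<iota>(2))
  qed
  \<comment> \<open>The excluded \<open>y\<close> belong to the tangent lines, which meet the sphere
    once; they form a null set.\<close>
  have hit: "hits (sphere 0 1) v (\<iota> y) = 2 * indicator (ball 0 1) y" if y: "y \<notin> sphere 0 1" for y
  proof -
    have eq: "{t. \<iota> y + t *\<^sub>R v \<in> sphere 0 1} = {t. t\<^sup>2 = 1 - (norm y)\<^sup>2}"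
    proof (intro Collect_cong)
      fix t
      have "\<iota> y + t *\<^sub>R v \<in> sphere 0 1 \<longleftrightarrow> (norm (\<iota> y + t *\<^sub>R v))\<^sup>2 = 1\<^sup>2"
        by (subst power2_eq_iff_nonneg) auto
      then show "\<iota> y + t *\<^sub>R v \<in> sphere 0 1 \<longleftrightarrow> t\<^sup>2 = 1 - (norm y)\<^sup>2" unfolding nt by auto
    qed
    show ?thesis
    proof (cases "norm y < 1")
      case True
      define r where "r = sqrt (1 - (norm y)\<^sup>2)"
      have "(norm y)\<^sup>2 < 1" using True by (simp add: power_less_one_iff abs_square_less_1)
      then have r: "r > 0" "r\<^sup>2 = 1 - (norm y)\<^sup>2" by (simp_all add: r_def)
      have "{t. t\<^sup>2 = 1 - (norm y)\<^sup>2} = {r, - r}" unfolding r(2)[symmetric] by (auto simp: power2_eq_iff)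
      moreover have "card {r, - r} = 2" using r(1) by simp
      ultimately show ?thesis unfolding hits_def eq using True by (simp add: emeasure_count_space_finite)
    next
      case False
      then have "1 < norm y" using y by simp
      then have "1\<^sup>2 < (norm y)\<^sup>2" by (intro power_strict_mono) auto
      then have "{t. t\<^sup>2 = 1 - (norm y)\<^sup>2} = {}" by (auto simp: not_le) (metis less_iff_diff_less_0 not_less zero_le_power2)
      then show ?thesis unfolding hits_def eq using False by simp
    qed
  qed
  have "shadow (sphere 0 1) v = (\<integral>\<^sup>+y. hits (sphere 0 1) v (\<iota> y) \<partial>hausdorff_measure DIM('b))"
    unfolding shadow_def m \<iota>(3)[symmetric]
    by (rule nn_integral_hausdorff_isometry[OF linear_norm_dist[OF \<iota>(1,2)] _ borel_measurable_hits'[OF FS]])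
      (simp add: \<iota>(3) hyperplane_borel)
  also have "\<dots> = (\<integral>\<^sup>+y. 2 * indicator (ball 0 1) y \<partial>(lborel :: 'b measure))"
    unfolding hausdorff_measure_eq_lborel
  proof (rule nn_integral_cong_AE)
    have "sphere (0::'b) 1 \<in> null_sets lebesgue" using negligible_sphere negligible_iff_null_sets by blast
    then have "sphere (0::'b) 1 \<in> null_sets lborel" by (simp add: null_sets_completion_iff)
    then have "AE y in lborel. y \<notin> sphere (0::'b) 1" by (rule AE_not_in)
    then show "AE y in lborel. hits (sphere 0 1) v (\<iota> y) = 2 * indicator (ball 0 1) y"
      by eventually_elim (rule hit)
  qed
  also have "\<dots> = 2 * emeasure lborel (ball (0::'b) 1)" by (rule nn_integral_cmult_indicator) simp
  also have "\<dots> = ennreal (2 * unit_ball_vol (real DIM('b)))" by (simp add: emeasure_ball ennreal_mult)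
  finally show ?thesis .
qed

text \<open>The pieces are chosen anew for every \<open>\<delta>\<close>, so the estimates are
  summed to estimates for \<open>E\<close> before \<open>\<delta>\<close> tends to 0. Hypothesis
  \<open>c\<close> excludes the product of 0 and infinity, where the limits could fail. The unit
  sphere meets it by its finite area while the constant is still unknown; once the constant is known
  to be nonzero, \<open>E\<close> may have infinite area.\<close>

lemma crofton_constant:
  fixes E :: "(real^'n) set"
  assumes dim: "CARD('n) = Suc CARD('m::{finite,wellorder})" and E: "closed E"
    and cov: "lipschitz_covered TYPE(real^'m::{finite,wellorder}) E"
    and fr: "frame (\<iota> :: real^'m::_ \<Rightarrow> real^'n) \<nu>"
    and c: "line_count (\<iota> ` unit_cube) \<noteq> 0 \<or> hausdorff_outer CARD('m) E < top"
  shows "line_count E = line_count (\<iota> ` unit_cube) * hausdorff_outer CARD('m) E"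
proof -
  have dim'': "DIM(real^'n) = Suc DIM((real,'m) vec)" using dim by simp
  have m: "DIM(real^'n) - 1 = CARD('m)" using dim by simp
  let ?M = "CARD('m)"
  let ?H = "\<lambda>X :: (real^'n) set. hausdorff_outer ?M X"
  define S where "S = ?H (sphere 0 1)"
  have S: "S < top" using hausdorff_sphere_finite[OF dim''] by (simp add: S_def)
  define cc where "cc = line_count (\<iota> ` unit_cube)"
  have "cc \<le> (\<integral>\<^sup>+v. indicator (sphere 0 1) v \<partial>(hausdorff_measure ?M :: (real^'n) measure))"
    unfolding cc_def line_count_def m
  proof (rule nn_integral_mono)
    fix v :: "real^'n"
    show "shadow (\<iota> ` unit_cube) v * indicator (sphere 0 1) v \<le> indicator (sphere 0 1) v"
    proof (cases "v \<in> sphere 0 1")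
      case True
      then have "shadow (\<iota> ` unit_cube) v \<le> ?H (\<iota> ` unit_cube)"
        using shadow_le_hausdorff[OF _ frame_image_F_sigma[OF fr], of v] m by simp
      also have "\<dots> = 1"
        using frame_hausdorff_image[OF fr] hausdorff_outer_eq_lborel[where 'a = "(real,'m) vec", OF unit_cube(2)]
        by (simp add: unit_cube(4))
      finally show ?thesis using True by simp
    qed simp
  qed
  also have "\<dots> = S" by (simp add: S_def emeasure_hausdorff_measure)
  finally have ccS: "cc < top" using S by (rule le_less_trans)
  define x where "x = enn2real cc"
  have x: "cc = ennreal x" "x \<ge> 0" using ccS by (simp_all add: x_def)
  define d where "d k = 1 / (real k + 2)" for k :: nat
  have d: "0 < d k" "d k < 1" for k by (simp_all add: d_def)
  define b where "b k = enn2real (?H (band (d k) \<nu>))" for k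
  have bk: "?H (band (d k) \<nu>) = ennreal (b k)" for k
    using le_less_trans[OF hausdorff_outer_mono[OF band_subset_sphere] S[unfolded S_def], of "d k" \<nu>] by (simp add: b_def)
  have b0: "b k \<ge> 0" for k by (simp add: b_def)
  have "(\<lambda>k. ?H (band (d k) \<nu>)) \<longlonglongrightarrow> ennreal 0"
    using band_tendsto[OF fr] S unfolding S_def d_def by simp
  then have blim: "b \<longlonglongrightarrow> 0" unfolding bk using b0 by (subst (asm) tendsto_ennreal_iff) auto
  have "(\<lambda>k. 1 / real (k + 2)) \<longlonglongrightarrow> 0" by (rule LIMSEQ_ignore_initial_segment[OF lim_const_over_n])
  then have dlim: "d \<longlonglongrightarrow> 0" by (simp add: d_def[abs_def] add.commute)
  define a1 a2 b1 b2 where "a1 k = (1 - (d k)\<^sup>2) ^ ?M" and "a2 k = (1 + d k) ^ ?M"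
    and "b1 k = (1 - d k) ^ ?M * (1 - (d k)\<^sup>2) ^ ?M" and "b2 k = (1 + (d k)\<^sup>2) ^ ?M" for k
  have lims: "a1 \<longlonglongrightarrow> 1" "a2 \<longlonglongrightarrow> 1" "b1 \<longlonglongrightarrow> 1" "b2 \<longlonglongrightarrow> 1"
  proof -
    have "(\<lambda>k. (1 - (d k)\<^sup>2) ^ ?M) \<longlonglongrightarrow> (1 - 0\<^sup>2) ^ ?M" "(\<lambda>k. (1 + d k) ^ ?M) \<longlonglongrightarrow> (1 + 0) ^ ?M"
      "(\<lambda>k. (1 - d k) ^ ?M * (1 - (d k)\<^sup>2) ^ ?M) \<longlonglongrightarrow> (1 - 0) ^ ?M * (1 - 0\<^sup>2) ^ ?M"
      "(\<lambda>k. (1 + (d k)\<^sup>2) ^ ?M) \<longlonglongrightarrow> (1 + 0\<^sup>2) ^ ?M"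
      by (intro tendsto_intros dlim)+
    then show "a1 \<longlonglongrightarrow> 1" "a2 \<longlonglongrightarrow> 1" "b1 \<longlonglongrightarrow> 1" "b2 \<longlonglongrightarrow> 1" unfolding a1_def a2_def b1_def b2_def by simp_all
  qed
  have nn: "a1 k \<ge> 0" "a2 k \<ge> 0" "b1 k \<ge> 0" "b2 k \<ge> 0" for k
  proof -
    have "(d k)\<^sup>2 \<le> 1" using d[of k] by (intro power_le_one) auto
    then show "a1 k \<ge> 0" "a2 k \<ge> 0" "b1 k \<ge> 0" "b2 k \<ge> 0"
      using d[of k] unfolding a1_def a2_def b1_def b2_def by auto
  qed
  have est: "ennreal (a1 k) * line_count E \<le> ennreal (a2 k * x + b k) * ?H E"
       "ennreal (b1 k * x - b2 k * b k) * ?H E \<le> ennreal (b2 k) * line_count E" for k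
  proof -
    have "(d k)\<^sup>2 > 0" using d[of k] by simp
    from covered_pieces[OF dim E cov this]
    obtain F :: "nat \<Rightarrow> (real^'n) set" where F: "\<And>i. F_sigma (F i)"
      "\<And>i. \<exists>(f :: (real,'m) vec \<Rightarrow> real^'n) C Q. good_piece ((d k)\<^sup>2) (f, C, Q) \<and> F i \<subseteq> f ` C"
      "line_count E = (\<Sum>i. line_count (F i))" "?H E = (\<Sum>i. ?H (F i))" by metis
    have piece: "ennreal (a1 k) * line_count (F i) \<le> ennreal (a2 k * x + b k) * ?H (F i)"
       "ennreal (b1 k * x - b2 k * b k) * ?H (F i) \<le> ennreal (b2 k) * line_count (F i)" for i
    proof -
      obtain f :: "(real,'m) vec \<Rightarrow> real^'n" and C Q where gp: "good_piece ((d k)\<^sup>2) (f, C, Q)" "F i \<subseteq> f ` C" using F(2) by blast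
      note pe = good_piece_estimates[OF dim fr d gp(1) F(1) gp(2), folded a1_def a2_def b1_def b2_def cc_def, unfolded bk x(1)]
      have "ennreal (a2 k) * ennreal x + ennreal (b k) = ennreal (a2 k * x + b k)"
        using nn[of k] x(2) b0[of k] by (simp add: ennreal_mult ennreal_plus)
      then show "ennreal (a1 k) * line_count (F i) \<le> ennreal (a2 k * x + b k) * ?H (F i)" using pe(1) by simp
      \<comment> \<open>A single piece has finite area, so its lower estimate can be rearranged in
        the real numbers; the area of \<open>E\<close> itself may be infinite.\<close>
      obtain h where h: "?H (F i) = ennreal h" "h \<ge> 0" using pe(3) by (metis ennreal_cases less_irrefl)
      show "ennreal (b1 k * x - b2 k * b k) * ?H (F i) \<le> ennreal (b2 k) * line_count (F i)"
      proof (cases "line_count (F i)" rule: ennreal_cases)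
        case (real l)
        have "ennreal (b1 k * x * h) \<le> ennreal (b2 k * (l + b k * h))"
          using pe(2) nn[of k] x(2) b0[of k] real h by (simp add: ennreal_mult ennreal_plus)
        then have "b1 k * x * h \<le> b2 k * (l + b k * h)"
          using nn[of k] b0[of k] real h by (subst (asm) ennreal_le_iff) auto
        then have "(b1 k * x - b2 k * b k) * h \<le> b2 k * l" by (simp add: algebra_simps)
        then have "ennreal ((b1 k * x - b2 k * b k) * h) \<le> ennreal (b2 k * l)" by (rule ennreal_leI)
        \<comment> \<open>A negative coefficient becomes 0 in \<open>ennreal\<close>, and the
          estimate is then trivial.\<close>
        then show ?thesis using h real nn[of k] by (cases "b1 k * x - b2 k * b k \<ge> 0") (auto simp: ennreal_mult ennreal_neg)
      next
        case top
        have "b2 k > 0" unfolding b2_def by (intro zero_less_power) (simp add: add_pos_nonneg)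
        then show ?thesis using top by (simp add: ennreal_mult_top)
      qed
    qed
    show "ennreal (a1 k) * line_count E \<le> ennreal (a2 k * x + b k) * ?H E"
      unfolding F(3,4) ennreal_suminf_cmult[symmetric] by (intro suminf_le piece(1)) auto
    show "ennreal (b1 k * x - b2 k * b k) * ?H E \<le> ennreal (b2 k) * line_count E"
      unfolding F(3,4) ennreal_suminf_cmult[symmetric] by (intro suminf_le piece(2)) auto
  qed
  have fin: "\<not> (ennreal x = 0 \<and> ?H E = \<infinity> \<or> ennreal x = \<infinity> \<and> ?H E = 0)"
    using c x unfolding cc_def[symmetric] by auto
  have l1: "(\<lambda>k. ennreal (a1 k) * line_count E) \<longlonglongrightarrow> ennreal 1 * line_count E"
    by (intro tendsto_mult_ennreal tendsto_ennrealI lims tendsto_const) auto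
  have l2: "(\<lambda>k. ennreal (b2 k) * line_count E) \<longlonglongrightarrow> ennreal 1 * line_count E"
    by (intro tendsto_mult_ennreal tendsto_ennrealI lims tendsto_const) auto
  have "(\<lambda>k. a2 k * x + b k) \<longlonglongrightarrow> 1 * x + 0" by (intro tendsto_intros lims blim)
  then have l3: "(\<lambda>k. ennreal (a2 k * x + b k) * ?H E) \<longlonglongrightarrow> ennreal x * ?H E"
    using fin by (intro tendsto_mult_ennreal tendsto_ennrealI tendsto_const) auto
  have "(\<lambda>k. b1 k * x - b2 k * b k) \<longlonglongrightarrow> 1 * x - 1 * 0" by (intro tendsto_intros lims blim)
  then have l4: "(\<lambda>k. ennreal (b1 k * x - b2 k * b k) * ?H E) \<longlonglongrightarrow> ennreal x * ?H E"
    using fin by (intro tendsto_mult_ennreal tendsto_ennrealI tendsto_const) auto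
  have "line_count E \<le> ennreal x * ?H E" using LIMSEQ_le[OF l1 l3] est(1) by auto
  moreover have "ennreal x * ?H E \<le> line_count E" using LIMSEQ_le[OF l4 l2] est(2) by auto
  ultimately show ?thesis unfolding cc_def[symmetric] x(1) by (rule antisym)
qed

theorem crofton:
  fixes E :: "(real^'n) set"
  assumes dim: "CARD('n) = Suc CARD('m::{finite,wellorder})" and E: "closed E"
    and cov: "lipschitz_covered TYPE(real^'m::{finite,wellorder}) E"
  shows "line_count E = ennreal (2 * unit_ball_vol (real CARD('m))) * hausdorff_outer CARD('m) E"
proof -
  have dim'': "DIM(real^'n) = Suc DIM((real,'m) vec)" using dim by simp
  have m: "DIM(real^'n) - 1 = CARD('m)" using dim by simp
  let ?w = "2 * unit_ball_vol (real CARD('m))"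
  have w: "?w > 0" by simp
  obtain \<iota> :: "(real,'m) vec \<Rightarrow> real^'n" where fr: "frame \<iota> (axis undefined 1)"
    by (rule frame_exists[OF dim'', of "axis undefined 1"]) (simp_all add: norm_axis_1)
  let ?S = "sphere (0::real^'n) 1"
  have fin: "hausdorff_outer CARD('m) ?S < top" using hausdorff_sphere_finite[OF dim''] by simp
  have "line_count ?S = (\<integral>\<^sup>+v. ennreal ?w * indicator ?S v \<partial>hausdorff_measure CARD('m))"
    unfolding line_count_def m
    by (intro nn_integral_cong) (use shadow_sphere[OF dim''] in \<open>auto simp: indicator_def\<close>)
  also have "\<dots> = ennreal ?w * hausdorff_outer CARD('m) ?S"
    by (simp add: nn_integral_cmult_indicator emeasure_hausdorff_measure)
  finally have 1: "line_count ?S = ennreal ?w * hausdorff_outer CARD('m) ?S" .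
  have 2: "line_count ?S = line_count (\<iota> ` unit_cube) * hausdorff_outer CARD('m) ?S"
    by (rule crofton_constant[OF dim closed_sphere sphere_covered[OF dim] fr]) (use fin in simp)
  \<comment> \<open>The shadow of the sphere is positive and bounds its area from below, so this
    area can be cancelled when the constant is computed.\<close>
  have "norm (axis undefined 1 :: real^'n) = 1" by (simp add: norm_axis_1)
  from shadow_le_hausdorff[OF this F_sigma_closed[OF closed_sphere], of 0 1] shadow_sphere[OF dim'' this]
  have "ennreal ?w \<le> hausdorff_outer CARD('m) ?S" using m by simp
  moreover have w': "ennreal ?w > 0" using w by (simp only: ennreal_less_zero_iff)
  ultimately have pos: "hausdorff_outer CARD('m) ?S \<noteq> 0" by (metis leD)
  have "line_count (\<iota> ` unit_cube) = ennreal ?w"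
    using 1 2 pos fin mult_divide_eq_ennreal by (metis less_irrefl)
  then show ?thesis using crofton_constant[OF dim E cov fr] w' by (metis less_irrefl)
qed

section \<open>The boundary of a submanifold\<close>

text \<open>Invariance of domain is used in both directions. At an interior point, a chart with its
  value on the bounding hyperplane would map a neighbourhood onto an open set, which cannot stay in
  the half space. Conversely, a chart value off that hyperplane has an open neighbourhood in the
  chart's image, and the inverse chart turns it into an open subset of \<open>K\<close>, so the
  point would be interior.\<close>

lemma manifold_boundary_eq_frontier:
  fixes K :: "'a::euclidean_space set"
  assumes K: "closed K" and mf: "submanifold_with_boundary K"
  shows "manifold_boundary K = frontier K"
proof (intro set_eqI iffI)
  fix x assume "x \<in> manifold_boundary K"
  then obtain e U V h where x: "x \<in> K" "x \<in> U" "h x \<bullet> e = 0" and e: "e \<in> Basis" and ch: "half_space_chart K e U V h"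
    unfolding manifold_boundary_def by blast
  obtain g where U: "openin (top_of_set K) U" and V: "openin (top_of_set (half_space e)) V" and hom: "homeomorphism U V h g"
    using ch unfolding half_space_chart_def by blast
  have "x \<notin> interior K"
  proof
    assume xi: "x \<in> interior K"
    obtain T where T: "open T" "U = K \<inter> T" using U openin_open by metis
    define W where "W = T \<inter> interior K"
    have W: "open W" "W \<subseteq> U" "x \<in> W" using T x xi interior_subset unfolding W_def by auto
    have "open (h ` W)"
    proof (rule invariance_of_domain)
      show "continuous_on W h" by (rule continuous_on_subset[OF homeomorphism_cont1[OF hom] W(2)])
      show "inj_on h W"
        by (rule inj_on_inverseI[of _ g]) (rule homeomorphism_apply1[OF hom subsetD[OF W(2)]])
    qed (rule W(1))
    moreover have "h x \<in> h ` W" using W(3) by blast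
    ultimately obtain r where r: "r > 0" "ball (h x) r \<subseteq> h ` W" using open_contains_ball by blast
    have "h x - (r / 2) *\<^sub>R e \<in> ball (h x) r" using r(1) e by (simp add: dist_norm)
    then have "h x - (r / 2) *\<^sub>R e \<in> h ` W" using r(2) by blast
    also have "h ` W \<subseteq> V" using image_mono[OF W(2), of h] homeomorphism_image1[OF hom] by simp
    also have "V \<subseteq> half_space e" using V openin_imp_subset by blast
    finally have "0 \<le> (h x - (r / 2) *\<^sub>R e) \<bullet> e" by (simp add: half_space_def)
    then show False using x(3) r(1) e by (simp add: inner_diff_left)
  qed
  then show "x \<in> frontier K" using x(1) K by (simp add: frontier_def)
next
  fix x assume xf: "x \<in> frontier K"
  then have xK: "x \<in> K" using K frontier_subset_closed by blast
  obtain e U V h where e: "e \<in> Basis" and ch: "half_space_chart K e U V h" and xU: "x \<in> U"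
    using mf xK unfolding submanifold_with_boundary_def by blast
  obtain g where U: "openin (top_of_set K) U" and V: "openin (top_of_set (half_space e)) V" and hom: "homeomorphism U V h g"
    using ch unfolding half_space_chart_def by blast
  have hV: "h x \<in> V" using imageI[OF xU, of h] homeomorphism_image1[OF hom] by simp
  have "h x \<bullet> e = 0"
  proof (rule ccontr)
    assume ne: "h x \<bullet> e \<noteq> 0"
    obtain T where T: "open T" "V = half_space e \<inter> T" using V openin_open by metis
    define W where "W = T \<inter> {y. 0 < y \<bullet> e}"
    have W: "W \<subseteq> V" "h x \<in> W" using T hV ne unfolding W_def half_space_def by auto
    have "open W" unfolding W_def by (intro open_Int T(1) open_Collect_less continuous_intros)
    have "open (g ` W)"
    proof (rule invariance_of_domain)
      show "continuous_on W g" by (rule continuous_on_subset[OF homeomorphism_cont2[OF hom] W(1)])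
      show "inj_on g W"
        by (rule inj_on_inverseI[of _ h]) (rule homeomorphism_apply2[OF hom subsetD[OF W(1)]])
    qed fact
    moreover have "x \<in> g ` W" using imageI[OF W(2), of g] homeomorphism_apply1[OF hom xU] by simp
    moreover have "g ` W \<subseteq> K"
    proof -
      have "g ` W \<subseteq> U" using image_mono[OF W(1), of g] homeomorphism_image2[OF hom] by simp
      then show ?thesis using U openin_imp_subset by blast
    qed
    ultimately have "x \<in> interior K" using interior_maximal by blast
    then show False using xf by (simp add: frontier_def)
  qed
  then show "x \<in> manifold_boundary K" unfolding manifold_boundary_def using xK e ch xU by blast
qed

lemma rectifiable_lipschitz_covered:
  fixes E :: "(real^'n) set"
  assumes "rectifiable CARD('m::finite) E"
  shows "lipschitz_covered TYPE(real^'m) E"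
proof -
  obtain V :: "(real^'n) set" and f :: "nat \<Rightarrow> real^'n \<Rightarrow> real^'n" where V: "subspace V" "dim V = CARD('m)"
    and f: "\<And>i. \<exists>L. L-lipschitz_on V (f i)" and null: "hausdorff_outer CARD('m) (E - (\<Union>i. f i ` V)) = 0"
    using assms unfolding rectifiable_def by blast
  obtain j :: "real^'m \<Rightarrow> real^'n" where j: "linear j" "range j = V" "\<And>x. norm (j x) = norm x"
    by (rule isometry_subspaces[of "UNIV :: (real^'m) set" V]) (use V in auto)
  have "\<exists>L. L-lipschitz_on UNIV (f i \<circ> j)" for i
  proof -
    obtain L where L: "L-lipschitz_on V (f i)" using f by blast
    have "L-lipschitz_on UNIV (f i \<circ> j)"
    proof (rule lipschitz_onI)
      fix x y
      have "dist (f i (j x)) (f i (j y)) \<le> L * dist (j x) (j y)" using lipschitz_onD[OF L] j(2) by blast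
      then show "dist ((f i \<circ> j) x) ((f i \<circ> j) y) \<le> L * dist x y" by (simp add: linear_norm_dist[OF j(1,3)])
    qed (rule lipschitz_on_nonneg[OF L])
    then show ?thesis by blast
  qed
  moreover have "(\<Union>g\<in>range (\<lambda>i. f i \<circ> j). range g) = (\<Union>i. f i ` V)" unfolding j(2)[symmetric] by (auto simp: image_comp)
  ultimately show ?thesis unfolding lipschitz_covered_def using null
    by (intro exI[of _ "range (\<lambda>i. f i \<circ> j)"]) auto
qed

text \<open>An index type with one element less, so that hyperplanes of \<open>real^'n\<close> are copies of \<open>real^'n pred_index\<close>.\<close>

typedef 'n pred_index = "{..<max 1 (CARD('n::finite) - 1)} :: nat set"
  by (intro exI[of _ 0]) simp

text \<open>The maximum keeps the type inhabited when \<open>CARD('n) = 1\<close>; that dimension is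
  treated by \<open>line_count_dim_1\<close>.\<close>

lemma card_pred_index: "card (UNIV :: 'n::finite pred_index set) = max 1 (CARD('n) - 1)"
  using type_definition.card[OF type_definition_pred_index] by simp

instance pred_index :: (finite) finite
  by intro_classes (rule card_ge_0_finite, simp add: card_pred_index)

text \<open>\<open>crofton\<close> asks for a well-ordered index type, a requirement that goes back
  to the determinant formula in \<open>emeasure_linear_image\<close>.\<close>

instantiation pred_index :: (finite) wellorder
begin

definition less_eq_pred_index :: "'a pred_index \<Rightarrow> 'a pred_index \<Rightarrow> bool" where
  "less_eq_pred_index x y \<longleftrightarrow> Rep_pred_index x \<le> Rep_pred_index y"

definition less_pred_index :: "'a pred_index \<Rightarrow> 'a pred_index \<Rightarrow> bool" where
  "less_pred_index x y \<longleftrightarrow> Rep_pred_index x < Rep_pred_index y"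

instance
proof
  fix P :: "'a pred_index \<Rightarrow> bool" and a
  assume "\<And>x. (\<And>y. y < x \<Longrightarrow> P y) \<Longrightarrow> P x"
  then show "P a" unfolding less_pred_index_def by (rule measure_induct_rule)
qed (auto simp: less_eq_pred_index_def less_pred_index_def Rep_pred_index_inject)

end

section \<open>Dimension one: counting points\<close>

lemma hausdorff_outer_0_singleton: "hausdorff_outer 0 {x} = 1"
proof -
  have "hausdorff_pre 0 \<delta> {x} = 1" if \<delta>: "\<delta> > 0" for \<delta>
  proof (rule antisym)
    have "hausdorff_pre 0 \<delta> {x} \<le> (\<integral>\<^sup>+i. hausdorff_gauge 0 {x} \<partial>count_space {()})"
      by (rule hausdorff_pre_le_countable) (use \<delta> in auto)
    also have "\<dots> = 1" by (simp add: nn_integral_count_space_finite hausdorff_gauge_def)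
    finally show "hausdorff_pre 0 \<delta> {x} \<le> 1" .
    show "1 \<le> hausdorff_pre 0 \<delta> {x}"
      unfolding hausdorff_pre_def
    proof (rule INF_greatest)
      fix C assume "C \<in> {C :: nat \<Rightarrow> 'a set. (\<forall>i. bounded (C i) \<and> diameter (C i) \<le> \<delta>) \<and> {x} \<subseteq> (\<Union>i. C i)}"
      then obtain i where "x \<in> C i" by blast
      \<comment> \<open>In dimension 0 every nonempty set has gauge 1: the unit ball has volume 1
        and so has any zeroth power the value 1.\<close>
      then have "1 = hausdorff_gauge 0 (C i)" by (auto simp: hausdorff_gauge_def)
      also have "\<dots> = sum (\<lambda>i. hausdorff_gauge 0 (C i)) {i}" by simp
      also have "\<dots> \<le> (\<Sum>i. hausdorff_gauge 0 (C i))" by (rule sum_le_suminf) auto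
      finally show "1 \<le> (\<Sum>i. hausdorff_gauge 0 (C i))" .
    qed
  qed
  then show ?thesis unfolding hausdorff_outer_def by (simp add: SUP_constant)
qed

lemma hausdorff_measure_0:
  fixes A :: "'a::metric_space set"
  assumes A: "A \<in> sets borel"
  shows "emeasure (hausdorff_measure 0) A = ecard A"
proof -
  have s: "emeasure (hausdorff_measure 0) {x :: 'a} = 1" for x
    by (simp add: emeasure_hausdorff_measure hausdorff_outer_0_singleton)
  have fin: "emeasure (hausdorff_measure 0) S = of_nat (card S)" if "finite S" for S :: "'a set"
    using that by (subst emeasure_eq_sum_singleton) (auto simp: s)
  show ?thesis
  proof (cases "finite A")
    case True
    then show ?thesis by (simp add: fin emeasure_count_space_finite)
  next
    case False
    have "ecard A \<le> emeasure (hausdorff_measure 0) A"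
    proof (rule ecard_geI)
      fix S assume "finite S" "S \<subseteq> A"
      then show "of_nat (card S) \<le> emeasure (hausdorff_measure 0) A"
        using emeasure_mono[of S A "hausdorff_measure 0"] A fin[of S] by simp
    qed
    then show ?thesis using False by (simp add: emeasure_count_space_infinite top_unique)
  qed
qed

text \<open>Hyperplanes are points here, and Euclidean space types have positive dimension, so the
  coordinates of the general argument do not exist. Directly: there are two unit vectors, and for
  each of them the only line is the whole space, which meets \<open>E\<close> in all its
  points.\<close>

lemma line_count_dim_1:
  fixes E :: "'a::euclidean_space set"
  assumes dim: "DIM('a) = 1" and E: "E \<in> sets borel"
  shows "line_count E = 2 * emeasure (hausdorff_measure 0) E"
proof -
  let ?H = "hausdorff_measure 0 :: 'a measure"
  have m: "DIM('a) - 1 = 0" using dim by simp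
  have span: "x = (v \<bullet> x) *\<^sub>R v" if v: "norm v = 1" for v x :: 'a
  proof -
    have "v \<noteq> 0" using v by auto
    then have "dim {u. v \<bullet> u = 0} = 0" using dim by (simp add: dim_hyperplane)
    moreover have "perp v x \<in> {u. v \<bullet> u = 0}" using perp_orthogonal[OF v] by simp
    ultimately have "perp v x = 0" by (metis dim_eq_0 singletonD subsetD)
    then show ?thesis by (simp add: perp_def)
  qed
  have s: "emeasure ?H {x} = 1" for x by (simp add: emeasure_hausdorff_measure hausdorff_outer_0_singleton)
  have sh: "shadow E v = ecard E" if v: "norm v = 1" for v
  proof -
    have "{u. v \<bullet> u = 0} = {0}"
    proof (intro set_eqI iffI)
      fix u assume "u \<in> {u. v \<bullet> u = 0}"
      then show "u \<in> {0}" using span[OF v, of u] by simp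
    qed simp
    then have "shadow E v = (\<integral>\<^sup>+u. hits E v u * indicator {0} u \<partial>?H)" unfolding shadow_def using dim by simp
    also have "\<dots> = hits E v 0" by (subst nn_integral_indicator_singleton) (auto simp: s)
    also have "\<dots> = ecard ((\<lambda>t. t *\<^sub>R v) ` {t. t *\<^sub>R v \<in> E})"
    proof -
      have "inj_on (\<lambda>t. t *\<^sub>R v) {t. t *\<^sub>R v \<in> E}" using v by (auto simp: inj_on_def)
      then show ?thesis by (simp add: hits_def ecard_image)
    qed
    also have "(\<lambda>t. t *\<^sub>R v) ` {t. t *\<^sub>R v \<in> E} = E"
    proof (intro set_eqI iffI)
      fix x assume "x \<in> E"
      then show "x \<in> (\<lambda>t. t *\<^sub>R v) ` {t. t *\<^sub>R v \<in> E}" using span[OF v, of x] by (intro image_eqI[of _ _ "v \<bullet> x"]) auto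
    qed auto
    finally show ?thesis .
  qed
  obtain b :: 'a where b: "b \<in> Basis" using nonempty_Basis by blast
  have sph: "sphere 0 1 = {b, - b}"
  proof (intro set_eqI iffI)
    fix x :: 'a assume x: "x \<in> sphere 0 1"
    have eq: "x = (b \<bullet> x) *\<^sub>R b" using span[of b x] b by simp
    then have "norm x = \<bar>b \<bullet> x\<bar> * norm b" by (metis norm_scaleR)
    then have "\<bar>b \<bullet> x\<bar> = 1" using x b by simp
    then have "b \<bullet> x = 1 \<or> b \<bullet> x = - 1" by linarith
    then show "x \<in> {b, - b}" using eq by (metis insertI1 insertI2 scaleR_minus1_left scaleR_one)
  qed (use b in auto)
  have "b \<noteq> 0" using b by auto
  then have "b \<noteq> - b" by (metis add.inverse_unique add_cancel_right_right mult_2 scaleR_2 scaleR_eq_0_iff zero_neq_numeral add.right_inverse)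
  then have c2: "emeasure ?H (sphere 0 1) = 2"
    using hausdorff_measure_0[of "sphere (0::'a) 1"] unfolding sph by (simp add: emeasure_count_space_finite)
  have "line_count E = (\<integral>\<^sup>+v. ecard E * indicator (sphere 0 1) v \<partial>?H)"
    unfolding line_count_def m by (rule nn_integral_cong) (use sh in \<open>auto simp: indicator_def\<close>)
  also have "\<dots> = ecard E * emeasure ?H (sphere 0 1)" by (rule nn_integral_cmult_indicator) (simp add: borel_closed)
  finally show ?thesis using c2 hausdorff_measure_0[OF E] by (simp add: mult.commute)
qed

theorem theorem2:
  fixes K \<Sigma> :: "(real ^ 'n) set"
  assumes "compact K"
    and "submanifold_with_boundary K"
    and "\<Sigma> = manifold_boundary K"
    and "rectifiable (CARD('n) - 1) \<Sigma>"
  shows "emeasure (hausdorff_measure (CARD('n) - 1)) \<Sigma> =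
    ennreal (1 / (2 * unit_ball_vol (real (CARD('n) - 1)))) *
    lines_nn_integral (\<lambda>l. emeasure (count_space UNIV) (line_points l \<inter> \<Sigma>))"
proof -
  have cl: "closed \<Sigma>"
    using manifold_boundary_eq_frontier[OF compact_imp_closed[OF assms(1)] assms(2)] assms(3) by simp
  define w where "w = 2 * unit_ball_vol (real (CARD('n) - 1))"
  have w: "w > 0" by (simp add: w_def)
  have "line_count \<Sigma> = ennreal w * emeasure (hausdorff_measure (CARD('n) - 1)) \<Sigma>"
  proof (cases "CARD('n) = 1")
    case True
    \<comment> \<open>\<open>unit_ball_vol 0\<close> is 1, so \<open>w\<close> is 2 here.\<close>
    then show ?thesis using line_count_dim_1[of \<Sigma>] cl by (simp add: w_def)
  next
    case False
    have "CARD('n) \<noteq> 0" by simp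
    then have "CARD('n) \<ge> 2" using False by linarith
    then have c: "CARD('n) = Suc CARD('n pred_index)" by (simp add: card_pred_index max_def)
    then have m: "CARD('n) - 1 = CARD('n pred_index)" by simp
    have "lipschitz_covered TYPE(real^('n pred_index)) \<Sigma>"
      using assms(4) unfolding m by (rule rectifiable_lipschitz_covered)
    from crofton[OF c cl this] show ?thesis
      unfolding w_def m emeasure_hausdorff_measure[OF borel_closed[OF cl]] .
  qed
  \<comment> \<open>\<open>w\<close> is a positive real number, so it cancels even if the area is
    infinite.\<close>
  then have "ennreal (1 / w) * line_count \<Sigma> = (ennreal (1 / w) * ennreal w) * emeasure (hausdorff_measure (CARD('n) - 1)) \<Sigma>"
    by (simp add: mult.assoc)
  also have "ennreal (1 / w) * ennreal w = 1" using w by (simp add: ennreal_mult[symmetric])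
  finally show ?thesis unfolding lines_nn_integral_eq_line_count w_def by simp
qed

end
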